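(* Let $T>0$, $\gamma\in(1/2,1]$, $\alpha\in(1-\gamma,1/2)$ and $X_0\in\mathbb{R}$. Let $W$ be a standard $\mathcal F_t$-Wiener process and $Z$ an $\mathcal F_t$-adapted process which is almost surely $\gamma$-Hölder continuous on $[0,T]$. Suppose that $a,b,c:[0,T]\times\mathbb{R}\to\mathbb{R}$, with $c$ differentiable in its second argument, satisfy for some $K>0$, $K_1>0$ and $\beta>1/2$ and for all $t,s\in[0,T]$, $x,y\in\mathbb{R}$: $$|a(t,x)|+|b(t,x)|+|c(t,x)|\le K(1+|x|),\qquad |\partial_x c(t,x)|\le K,\qquad |b(t,x)|\le K_1,$$ $$|a(t,x)-a(t,y)|+|b(t,x)-b(t,y)|+|\partial_x c(t,x)-\partial_x c(t,y)|\le K|x-y|,$$ $$|a(s,x)-a(t,x)|+|b(s,x)-b(t,x)|+|c(s,x)-c(t,x)|+|\partial_x c(s,x)-\partial_x c(t,x)|\le K|s-t|^\beta.$$ Suppose moreover that $$\mathsf{E}\Big[\exp\big\{\theta\,\|Z\|_{0,T}^{1/(1-2\alpha)}\big\}\Big]<\infty\quad\text{for all }\theta>0.$$ Let $X$ be the unique solution (with $\|X\|_{\infty,T}<\infty$ a.s.) of $$X_t=X_0+\int_0^t a(s,X_s)\,ds+\int_0^t b(s,X_s)\,dW_s+\int_0^t c(s,X_s)\,dZ_s,\quad t\in[0,T].$$ Then all moments of $X$ are bounded, i.e. $\sup_{t\in[0,T]}\mathsf{E}[|X_t|^p]<\infty$ for all $p>0$; moreover, $\mathsf{E}\big[\|X\|_{\infty,T}^p\big]<\infty$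 for all $p>0$.
   Context: $(\Omega,\mathcal F,\{\mathcal F_t\}_{t\in[0,T]},P)$ is a complete probability space with a filtration satisfying the standard assumptions. $W$ and $Z$ may be dependent. A solution is a continuous $\mathcal F_t$-adapted process satisfying the equation almost surely for all $t\in[0,T]$; under the stated conditions on $a,b,c$ (including boundedness of $b$) the equation is known to be uniquely solvable. Norms: for $\alpha$ fixed, $$\|f\|_{t}=|f(t)|+\int_0^t|f(t)-f(s)|(t-s)^{-1-\alpha}ds,\qquad \|f\|_{\infty,t}=\sup_{s\in[0,t]}\|f\|_{s},$$ $$\|f\|_{0,t}=\sup_{0\le u<v<t}\Big(\frac{|f(v)-f(u)|}{(v-u)^{1-\alpha}}+\int_u^v\frac{|f(u)-f(z)|}{(z-u)^{2-\alpha}}dz\Big).$$ Integrals: the integral with respect to $W$ is the Itô integral. The integral with respect to $Z$ is the pathwise generalized Lebesgue–Stieltjes integral $$\int_u^v f(x)\,dg(x)=e^{i\pi\alpha}\int_u^v (D^{\alpha}_{u+}f)(x)\,(D^{1-\alpha}_{v-}g_{v-})(x)\,dx,\qquad g_{v-}(x)=g(x)-g(v),$$ defined when $D^\alpha_{u+}f\in L_1[u,v]$ and $D^{1-\alpha}_{v-}g_{v-}\in L_\infty[u,v]$, where for $x\in(u,v)$ $$(D_{u+}^{\alpha}f)(x)=\frac{1}{\Gamma(1-\alpha)}\Big(\frac{f(x)}{(x-u)^\alpha}+\alpha\int_u^x\frac{f(x)-f(y)}{(x-y)^{1+\alpha}}dy\Big),$$ $$(D_{v-}^{1-\alpha}g)(x)=\frac{e^{-i\pi\alpha}}{\Gamma(\alpha)}\Big(\frac{g(x)}{(v-x)^{1-\alpha}}+(1-\alpha)\int_x^v\frac{g(x)-g(y)}{(y-x)^{2-\alpha}}dy\Big).$$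 *)

theory Defs
  imports "HOL-Probability.Probability"
begin

section \<open>Powers and exponentials of extended nonnegative reals\<close>

definition ennreal_rpow :: "ennreal \<Rightarrow> real \<Rightarrow> ennreal" where
  "ennreal_rpow x p = (if x = \<infinity> then \<infinity> else ennreal (enn2real x powr p))"

definition ennreal_exp :: "ennreal \<Rightarrow> ennreal" where
  "ennreal_exp x = (if x = \<infinity> then \<infinity> else ennreal (exp (enn2real x)))"


section \<open>Path norms\<close>

text \<open>All three norms take values in the extended nonnegative reals, so that finiteness is a
  genuine condition.\<close>

definition pnorm :: "real \<Rightarrow> real \<Rightarrow> (real \<Rightarrow> real) \<Rightarrow> ennreal" where
  "pnorm \<alpha> t f = ennreal \<bar>f t\<bar>
     + (\<integral>\<^sup>+s\<in>{0<..<t}. ennreal (\<bar>f t - f s\<bar> * (t - s) powr (- 1 - \<alpha>)) \<partial>lborel)"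

definition pnorm_sup :: "real \<Rightarrow> real \<Rightarrow> (real \<Rightarrow> real) \<Rightarrow> ennreal" where
  "pnorm_sup \<alpha> t f = (SUP s\<in>{0..t}. pnorm \<alpha> s f)"

definition pnorm_zero :: "real \<Rightarrow> real \<Rightarrow> (real \<Rightarrow> real) \<Rightarrow> ennreal" where
  "pnorm_zero \<alpha> t f = (SUP (u, v)\<in>{(u, v). 0 \<le> u \<and> u < v \<and> v < t}.
     ennreal (\<bar>f v - f u\<bar> / (v - u) powr (1 - \<alpha>))
     + (\<integral>\<^sup>+z\<in>{u<..<v}. ennreal (\<bar>f u - f z\<bar> / (z - u) powr (2 - \<alpha>)) \<partial>lborel))"


section \<open>Generalized Lebesgue--Stieltjes integral\<close>

definition frac_deriv_left :: "real \<Rightarrow> real \<Rightarrow> (real \<Rightarrow> real) \<Rightarrow> real \<Rightarrow> real" where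
  "frac_deriv_left \<alpha> u f x = 1 / Gamma (1 - \<alpha>) *
     (f x / (x - u) powr \<alpha> + \<alpha> * (LBINT y:{u<..<x}. (f x - f y) / (x - y) powr (1 + \<alpha>)))"

text \<open>The parameter \<open>\<alpha>\<close> below is that of the integral; the order of the derivative is \<open>1 - \<alpha>\<close>.\<close>

definition frac_deriv_right :: "real \<Rightarrow> real \<Rightarrow> (real \<Rightarrow> real) \<Rightarrow> real \<Rightarrow> complex" where
  "frac_deriv_right \<alpha> v g x = exp (- \<i> * of_real (pi * \<alpha>)) / of_real (Gamma \<alpha>) * of_real
     (g x / (v - x) powr (1 - \<alpha>)
      + (1 - \<alpha>) * (LBINT y:{x<..<v}. (g x - g y) / (y - x) powr (2 - \<alpha>)))"

text \<open>The derivatives exist (their defining integrals converge absolutely) almost everywhere, the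
  left one of \<open>f\<close> is in \<open>L\<^sub>1\<close> and the right one of \<open>g - g v\<close> is in \<open>L\<^sub>\<infinity>\<close>.\<close>

definition gls_integrable :: "real \<Rightarrow> real \<Rightarrow> real \<Rightarrow> (real \<Rightarrow> real) \<Rightarrow> (real \<Rightarrow> real) \<Rightarrow> bool" where
  "gls_integrable \<alpha> u v f g \<longleftrightarrow>
     (AE x in lborel. x \<in> {u<..<v} \<longrightarrow>
        set_integrable lborel {u<..<x} (\<lambda>y. (f x - f y) / (x - y) powr (1 + \<alpha>))) \<and>
     set_integrable lborel {u<..<v} (frac_deriv_left \<alpha> u f) \<and>
     (AE x in lborel. x \<in> {u<..<v} \<longrightarrow>
        set_integrable lborel {x<..<v} (\<lambda>y. (g x - g y) / (y - x) powr (2 - \<alpha>))) \<and>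
     set_borel_measurable lborel {u<..<v} (frac_deriv_right \<alpha> v (\<lambda>x. g x - g v)) \<and>
     (\<exists>B. AE x in lborel. x \<in> {u<..<v} \<longrightarrow>
        cmod (frac_deriv_right \<alpha> v (\<lambda>x. g x - g v) x) \<le> B)"

text \<open>With \<open>exp (- \<i> * pi * \<alpha>)\<close> in \<^const>\<open>frac_deriv_right\<close>, the phases cancel to \<open>1\<close> and the value for
  smooth \<open>f\<close> and \<open>g\<close> is the negative of the Riemann--Stieltjes integral; the usual sign results from
  \<open>exp (\<i> * pi * (1 - \<alpha>))\<close> instead. Since replacing \<open>g\<close> by \<open>- g\<close> negates the integral, the two
  conventions differ only by the sign of the integrator.\<close>

definition gls_integral :: "real \<Rightarrow> real \<Rightarrow> real \<Rightarrow> (real \<Rightarrow> real) \<Rightarrow> (real \<Rightarrow> real) \<Rightarrow> complex" where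
  "gls_integral \<alpha> u v f g = exp (\<i> * of_real (pi * \<alpha>)) *
     (LBINT x:{u<..<v}. of_real (frac_deriv_left \<alpha> u f x)
        * frac_deriv_right \<alpha> v (\<lambda>x. g x - g v) x)"


section \<open>Filtrations and processes on a compact time interval\<close>

text \<open>A filtration or process indexed by \<open>{0..T}\<close> is a function on all of \<^typ>\<open>real\<close> whose values
  outside \<open>{0..T}\<close> are irrelevant.\<close>

definition usual_filtration :: "'a measure \<Rightarrow> real \<Rightarrow> (real \<Rightarrow> 'a measure) \<Rightarrow> bool" where
  "usual_filtration M T F \<longleftrightarrow>
     (\<forall>t\<in>{0..T}. subalgebra M (F t)) \<and>
     (\<forall>s\<in>{0..T}. \<forall>t\<in>{0..T}. s \<le> t \<longrightarrow> sets (F s) \<subseteq> sets (F t)) \<and>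
     (\<forall>t\<in>{0..<T}. sets (F t) = (\<Inter>s\<in>{t<..T}. sets (F s))) \<and>
     null_sets M \<subseteq> sets (F 0)"

definition adapted_on :: "real \<Rightarrow> (real \<Rightarrow> 'a measure) \<Rightarrow> (real \<Rightarrow> 'a \<Rightarrow> real) \<Rightarrow> bool" where
  "adapted_on T F X \<longleftrightarrow> (\<forall>t\<in>{0..T}. X t \<in> borel_measurable (F t))"

definition continuous_paths :: "'a measure \<Rightarrow> real \<Rightarrow> (real \<Rightarrow> 'a \<Rightarrow> real) \<Rightarrow> bool" where
  "continuous_paths M T X \<longleftrightarrow> (AE \<omega> in M. continuous_on {0..T} (\<lambda>t. X t \<omega>))"

definition hoelder_paths :: "'a measure \<Rightarrow> real \<Rightarrow> real \<Rightarrow> (real \<Rightarrow> 'a \<Rightarrow> real) \<Rightarrow> bool" where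
  "hoelder_paths M T \<gamma> Z \<longleftrightarrow>
     (AE \<omega> in M. \<exists>C. \<forall>s\<in>{0..T}. \<forall>t\<in>{0..T}. \<bar>Z s \<omega> - Z t \<omega>\<bar> \<le> C * \<bar>s - t\<bar> powr \<gamma>)"

definition wiener_process ::
    "'a measure \<Rightarrow> real \<Rightarrow> (real \<Rightarrow> 'a measure) \<Rightarrow> (real \<Rightarrow> 'a \<Rightarrow> real) \<Rightarrow> bool" where
  "wiener_process M T F W \<longleftrightarrow>
     adapted_on T F W \<and>
     continuous_paths M T W \<and>
     (AE \<omega> in M. W 0 \<omega> = 0) \<and>
     (\<forall>s t. 0 \<le> s \<and> s < t \<and> t \<le> T \<longrightarrow>
        distributed M lborel (\<lambda>\<omega>. W t \<omega> - W s \<omega>) (normal_density 0 (sqrt (t - s))) \<and>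
        prob_space.indep_set M (sets (F s))
          {(\<lambda>\<omega>. W t \<omega> - W s \<omega>) -` B \<inter> space M | B. B \<in> sets borel})"


section \<open>It\^o integral\<close>

definition tendsto_in_prob ::
    "'a measure \<Rightarrow> (nat \<Rightarrow> 'a \<Rightarrow> real) \<Rightarrow> ('a \<Rightarrow> real) \<Rightarrow> bool" where
  "tendsto_in_prob M Y L \<longleftrightarrow>
     (\<forall>k. Y k \<in> borel_measurable M) \<and> L \<in> borel_measurable M \<and>
     (\<forall>\<epsilon>>0. (\<lambda>k. measure M {\<omega> \<in> space M. \<epsilon> < \<bar>Y k \<omega> - L \<omega>\<bar>}) \<longlonglongrightarrow> 0)"

text \<open>A simple process is given by a partition \<open>0 = \<tau> 0 < \<dots> < \<tau> n = T\<close> and the bounded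
  \<open>F (\<tau> i)\<close>-measurable values \<open>\<xi> i\<close> taken on \<open>{\<tau> i<..\<tau> (Suc i)}\<close>.\<close>

definition simple_process ::
    "'a measure \<Rightarrow> real \<Rightarrow> (real \<Rightarrow> 'a measure) \<Rightarrow> nat \<Rightarrow> (nat \<Rightarrow> real) \<Rightarrow> (nat \<Rightarrow> 'a \<Rightarrow> real) \<Rightarrow> bool" where
  "simple_process M T F n \<tau> \<xi> \<longleftrightarrow>
     \<tau> 0 = 0 \<and> \<tau> n = T \<and> (\<forall>i<n. \<tau> i < \<tau> (Suc i)) \<and>
     (\<forall>i<n. \<xi> i \<in> borel_measurable (F (\<tau> i)) \<and> (\<exists>B. \<forall>\<omega>\<in>space M. \<bar>\<xi> i \<omega>\<bar> \<le> B))"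

definition simple_value ::
    "nat \<Rightarrow> (nat \<Rightarrow> real) \<Rightarrow> (nat \<Rightarrow> 'a \<Rightarrow> real) \<Rightarrow> real \<Rightarrow> 'a \<Rightarrow> real" where
  "simple_value n \<tau> \<xi> s \<omega> = (\<Sum>i<n. \<xi> i \<omega> * indicator {\<tau> i<..\<tau> (Suc i)} s)"

definition simple_integral ::
    "(real \<Rightarrow> 'a \<Rightarrow> real) \<Rightarrow> nat \<Rightarrow> (nat \<Rightarrow> real) \<Rightarrow> (nat \<Rightarrow> 'a \<Rightarrow> real) \<Rightarrow> real \<Rightarrow> 'a \<Rightarrow> real" where
  "simple_integral W n \<tau> \<xi> t \<omega> =
     (\<Sum>i<n. \<xi> i \<omega> * (W (min (\<tau> (Suc i)) t) \<omega> - W (min (\<tau> i) t) \<omega>))"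

text \<open>\<open>ito_integral M T F W H I\<close>: the process \<open>I\<close> is a continuous version of the It\^o integral
  \<open>t \<mapsto> \<integral>\<^sub>0\<^sup>t H dW\<close> on \<open>{0..T}\<close>; it is determined up to indistinguishability. No joint measurability of \<open>H\<close>
  is demanded: together with measurability of almost every path, the approximability by simple
  processes forces \<open>H\<close> to agree, for almost every \<open>\<omega>\<close> and almost every time, with a progressively
  measurable process.\<close>

definition ito_integral ::
    "'a measure \<Rightarrow> real \<Rightarrow> (real \<Rightarrow> 'a measure) \<Rightarrow> (real \<Rightarrow> 'a \<Rightarrow> real) \<Rightarrow>
     (real \<Rightarrow> 'a \<Rightarrow> real) \<Rightarrow> (real \<Rightarrow> 'a \<Rightarrow> real) \<Rightarrow> bool" where
  "ito_integral M T F W H I \<longleftrightarrow>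
     adapted_on T F H \<and>
     (AE \<omega> in M. set_borel_measurable lborel {0..T} (\<lambda>s. H s \<omega>) \<and>
                 set_integrable lborel {0..T} (\<lambda>s. (H s \<omega>)\<^sup>2)) \<and>
     adapted_on T F I \<and> continuous_paths M T I \<and>
     (\<exists>n \<tau> \<xi>.
        (\<forall>k. simple_process M T F (n k) (\<tau> k) (\<xi> k)) \<and>
        tendsto_in_prob M
          (\<lambda>k \<omega>. LBINT s:{0..T}. (simple_value (n k) (\<tau> k) (\<xi> k) s \<omega> - H s \<omega>)\<^sup>2) (\<lambda>\<omega>. 0) \<and>
        (\<forall>t\<in>{0..T}.
           tendsto_in_prob M (\<lambda>k. simple_integral W (n k) (\<tau> k) (\<xi> k) t) (I t)))"


section \<open>The mixed stochastic differential equation\<close>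

text \<open>The equation is stated in \<^typ>\<open>complex\<close> because the generalized Lebesgue--Stieltjes integral is
  defined there.\<close>

definition mixed_sde_solution ::
    "'a measure \<Rightarrow> real \<Rightarrow> (real \<Rightarrow> 'a measure) \<Rightarrow> real \<Rightarrow> (real \<Rightarrow> real \<Rightarrow> real) \<Rightarrow> (real \<Rightarrow> real \<Rightarrow> real) \<Rightarrow>
     (real \<Rightarrow> real \<Rightarrow> real) \<Rightarrow> (real \<Rightarrow> 'a \<Rightarrow> real) \<Rightarrow> (real \<Rightarrow> 'a \<Rightarrow> real) \<Rightarrow> real \<Rightarrow> (real \<Rightarrow> 'a \<Rightarrow> real) \<Rightarrow> bool" where
  "mixed_sde_solution M T F \<alpha> a b c W Z X0 X \<longleftrightarrow>
     adapted_on T F X \<and> continuous_paths M T X \<and>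
     (\<exists>I. ito_integral M T F W (\<lambda>s \<omega>. b s (X s \<omega>)) I \<and>
        (AE \<omega> in M. \<forall>t\<in>{0..T}.
           set_integrable lborel {0..t} (\<lambda>s. a s (X s \<omega>)) \<and>
           gls_integrable \<alpha> 0 t (\<lambda>s. c s (X s \<omega>)) (\<lambda>s. Z s \<omega>) \<and>
           complex_of_real (X t \<omega>) =
             complex_of_real (X0 + (LBINT s:{0..t}. a s (X s \<omega>)) + I t \<omega>)
             + gls_integral \<alpha> 0 t (\<lambda>s. c s (X s \<omega>)) (\<lambda>s. Z s \<omega>)))"

end

theory Submission
  imports Defs
begin

text \<open>The first claim follows from the second, as \<open>\<bar>X\<^sub>t\<bar> \<le> \<parallel>X\<parallel>\<^sub>t \<le> \<parallel>X\<parallel>\<^sub>\<infinity>\<^sub>,\<^sub>T\<close>. The second combines a deterministic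
  estimate of each path with moment estimates for the Ito integral.

  \<^emph>\<open>Paths.\<close> Fix a path, let \<open>A = \<parallel>Z\<parallel>\<^sub>0\<^sub>,\<^sub>T\<close> and let \<open>\<xi>\<close> be a Hoelder constant, for an exponent \<open>\<eta> \<in> ]\<alpha>, 1/2[\<close>, of the
  Ito integral. The norm \<open>\<parallel>X\<parallel>\<^sub>t\<close> involves increments of the Stieltjes integral. The integrals over \<open>[0, s]\<close> and \<open>[0, t]\<close> share the left-sided derivative, and
  the right-sided derivatives with end points \<open>s\<close> and \<open>t\<close> differ at \<open>x < s\<close> by at most
  \<open>A / \<Gamma>(\<alpha>) * ((t - s) / (t - x)) powr (1 - \<alpha>)\<close> (\<open>weyl_right_diff_le\<close>). Integrated against \<open>(t - s) powr (- 1 - \<alpha>)\<close>, this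
  kernel leaves the singularity \<open>(t - x) powr (- \<alpha>)\<close> only (\<open>inc_kernel_integral_le\<close>), whereas the left-sided derivative
  at \<open>x\<close> is of order \<open>(1 + \<parallel>X\<parallel>\<^sub>x) * x powr (- \<alpha>)\<close>. Altogether
  \<open>\<parallel>X\<parallel>\<^sub>t \<le> \<bar>X\<^sub>0\<bar> + C * \<xi> + C * (1 + A) * \<integral>\<^sub>0\<^sup>t (1 + \<parallel>X\<parallel>\<^sub>x) * x powr (- \<alpha>) * (t - x) powr (- \<alpha>) dx\<close>.
  In terms of the supremum \<open>S\<close> of \<open>exp (- l * t) * (1 + \<parallel>X\<parallel>\<^sub>t)\<close>, the last term is at most
  \<open>C * (1 + A) * S * l powr (2 * \<alpha> - 1) * exp (l * t)\<close>. A suitable \<open>l\<close> of order \<open>(1 + A) powr (1 / (1 - 2 * \<alpha>))\<close> allows to absorb it,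
  and \<open>\<parallel>X\<parallel>\<^sub>\<infinity>\<^sub>,\<^sub>T \<le> C * (1 + \<xi>) * exp (C * (1 + A) powr (1 / (1 - 2 * \<alpha>)))\<close> (\<open>pnorm_sup_bound\<close>).

  \<^emph>\<open>Moments.\<close> The integrand of the Ito integral \<open>I\<close> is bounded by \<open>K1\<close>. The exponential martingales of simple
  processes and Fatou's lemma give \<open>E[exp (\<theta> * (I\<^sub>t - I\<^sub>s))] \<le> exp (\<theta>\<^sup>2 * K1\<^sup>2 * (t - s))\<close>. Hence the increments have moments of all
  orders with the scaling of Brownian motion, and dyadic chaining turns this into a moment of any prescribed order of \<open>\<xi>\<close>. The
  exponential factor in the pathwise bound is integrable, with all its powers, by the hypothesis on \<open>Z\<close>,
  and \<open>u * v \<le> u\<^sup>2 + v\<^sup>2\<close> deals with the product.\<close>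

section \<open>Exponential martingales of simple processes\<close>

text \<open>Multiplying the centred Gaussian density by this exponential shifts its mean to
  \<open>\<theta> * \<sigma>\<^sup>2\<close>, so the integral is the total mass of a probability measure.\<close>

lemma nn_integral_exp_normal:
  fixes \<theta> \<sigma> :: real
  assumes "\<sigma> > 0"
  shows "(\<integral>\<^sup>+w. ennreal (exp (\<theta> * w - \<theta>\<^sup>2 * \<sigma>\<^sup>2 / 2)) \<partial>density lborel (normal_density 0 \<sigma>)) = 1"
proof -
  interpret N: prob_space "density lborel (normal_density (\<theta> * \<sigma>\<^sup>2) \<sigma>)"
    using assms by (rule prob_space_normal_density)
  have tilt: "normal_density 0 \<sigma> w * exp (\<theta> * w - \<theta>\<^sup>2 * \<sigma>\<^sup>2 / 2) = normal_density (\<theta> * \<sigma>\<^sup>2) \<sigma> w" for w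
  proof -
    have "-(w - 0)\<^sup>2 / (2 * \<sigma>\<^sup>2) + (\<theta> * w - \<theta>\<^sup>2 * \<sigma>\<^sup>2 / 2) = -(w - \<theta> * \<sigma>\<^sup>2)\<^sup>2 / (2 * \<sigma>\<^sup>2)"
      using assms by (simp add: field_simps power2_eq_square)
    then show ?thesis
      unfolding normal_density_def by (metis (no_types, lifting) exp_add mult.assoc)
  qed
  have "(\<integral>\<^sup>+w. ennreal (exp (\<theta> * w - \<theta>\<^sup>2 * \<sigma>\<^sup>2 / 2)) \<partial>density lborel (normal_density 0 \<sigma>))
      = (\<integral>\<^sup>+w. ennreal (normal_density (\<theta> * \<sigma>\<^sup>2) \<sigma> w) \<partial>lborel)"
    by (subst nn_integral_density) (auto simp flip: ennreal_mult simp: tilt)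
  also have "\<dots> = 1"
    using N.emeasure_space_1 by (simp add: emeasure_density)
  finally show ?thesis .
qed

text \<open>Independence of \<open>Y\<close> from the whole \<open>\<sigma>\<close>-algebra \<open>N\<close> says that the law of the pair
  \<open>(\<omega>, Y \<omega>)\<close> is a product measure, so that \<open>Y\<close> can be integrated out with \<open>\<omega>\<close> held fixed. This
  expresses conditioning on \<open>N\<close> by an iterated integral.\<close>

lemma (in prob_space) nn_integral_indep_increment:
  assumes sub: "subalgebra M N" and Y[measurable]: "Y \<in> borel_measurable M"
    and ind: "indep_set (sets N) {Y -` B \<inter> space M | B. B \<in> sets borel}"
    and g[measurable]: "g \<in> borel_measurable (N \<Otimes>\<^sub>M borel)"
  shows "(\<integral>\<^sup>+\<omega>. g (\<omega>, Y \<omega>) \<partial>M) = (\<integral>\<^sup>+\<omega>. (\<integral>\<^sup>+w. g (\<omega>, w) \<partial>distr M borel Y) \<partial>M)"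
proof -
  have idm[measurable]: "(\<lambda>\<omega>. \<omega>) \<in> measurable M N"
    by (rule measurableI) (use sub in \<open>auto simp: subalgebra_def\<close>)
  have sp: "space N = space M" "sets N \<subseteq> sets M" using sub by (auto simp: subalgebra_def)
  interpret D: prob_space "distr M borel Y" by (rule prob_space_distr) simp
  interpret D': prob_space "distr M N (\<lambda>\<omega>. \<omega>)" by (rule prob_space_distr) simp
  have eq: "distr M N (\<lambda>\<omega>. \<omega>) \<Otimes>\<^sub>M distr M borel Y = distr M (N \<Otimes>\<^sub>M borel) (\<lambda>\<omega>. (\<omega>, Y \<omega>))"
  proof (rule pair_measure_eqI)
    show "sigma_finite_measure (distr M N (\<lambda>\<omega>. \<omega>))" "sigma_finite_measure (distr M borel Y)"
      by unfold_locales
    show "sets (distr M N (\<lambda>\<omega>. \<omega>) \<Otimes>\<^sub>M distr M borel Y) = sets (distr M (N \<Otimes>\<^sub>M borel) (\<lambda>\<omega>. (\<omega>, Y \<omega>)))"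
      by (simp cong: sets_pair_measure_cong)
    fix A B assume "A \<in> sets (distr M N (\<lambda>\<omega>. \<omega>))" "B \<in> sets (distr M borel Y)"
    then have AB[measurable]: "A \<in> sets N" "B \<in> sets borel" by auto
    have AM: "A \<in> events" "A \<subseteq> space M" using AB sp sets.sets_into_space[OF AB(1)] by auto
    have "prob (A \<inter> (Y -` B \<inter> space M)) = prob A * prob (Y -` B \<inter> space M)"
      using ind AB by (intro indep_setD) auto
    then have "emeasure M A * emeasure M (Y -` B \<inter> space M) = emeasure M (A \<inter> (Y -` B \<inter> space M))"
      by (simp add: emeasure_eq_measure ennreal_mult)
    also have "A \<inter> (Y -` B \<inter> space M) = (\<lambda>\<omega>. (\<omega>, Y \<omega>)) -` (A \<times> B) \<inter> space M"
      using AM by auto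
    finally show "emeasure (distr M N (\<lambda>\<omega>. \<omega>)) A * emeasure (distr M borel Y) B
        = emeasure (distr M (N \<Otimes>\<^sub>M borel) (\<lambda>\<omega>. (\<omega>, Y \<omega>))) (A \<times> B)"
      using AM by (simp add: emeasure_distr Int_absorb2)
  qed
  have gm: "g \<in> borel_measurable (distr M N (\<lambda>\<omega>. \<omega>) \<Otimes>\<^sub>M distr M borel Y)" by measurable
  have gm': "(\<lambda>\<omega>. \<integral>\<^sup>+w. g (\<omega>, w) \<partial>distr M borel Y) \<in> borel_measurable N" by measurable
  have "(\<integral>\<^sup>+\<omega>. g (\<omega>, Y \<omega>) \<partial>M) = (\<integral>\<^sup>+z. g z \<partial>distr M (N \<Otimes>\<^sub>M borel) (\<lambda>\<omega>. (\<omega>, Y \<omega>)))"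
    by (simp add: nn_integral_distr)
  also have "\<dots> = (\<integral>\<^sup>+\<omega>. (\<integral>\<^sup>+w. g (\<omega>, w) \<partial>distr M borel Y) \<partial>distr M N (\<lambda>\<omega>. \<omega>))"
    unfolding eq[symmetric] by (rule D.nn_integral_fst[symmetric]) (rule gm)
  also have "\<dots> = (\<integral>\<^sup>+\<omega>. (\<integral>\<^sup>+w. g (\<omega>, w) \<partial>distr M borel Y) \<partial>M)"
    by (subst nn_integral_distr) (use gm' in auto)
  finally show ?thesis .
qed

text \<open>The exponential martingale of a simple integrand. Integrating out the last increment, whose
  coefficient is known at time \<open>\<sigma> m\<close>, contributes the factor \<open>1\<close>. A coefficient has to be known only
  where time advances, because clipping a partition to a subinterval produces repeated times.\<close>

lemma (in prob_space) nn_integral_exp_martingale: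
  assumes F: "usual_filtration M T F" and W: "wiener_process M T F W"
    and \<sigma>: "\<And>i. i < n \<Longrightarrow> \<sigma> i \<le> \<sigma> (Suc i)" "\<And>i. i \<le> n \<Longrightarrow> \<sigma> i \<in> {0..T}"
    and x: "\<And>i. i < n \<Longrightarrow> \<sigma> i < \<sigma> (Suc i) \<Longrightarrow> x i \<in> borel_measurable (F (\<sigma> i))"
  shows "(\<integral>\<^sup>+\<omega>. ennreal (exp (\<Sum>i<n. x i \<omega> * (W (\<sigma> (Suc i)) \<omega> - W (\<sigma> i) \<omega>)
            - (x i \<omega>)\<^sup>2 * (\<sigma> (Suc i) - \<sigma> i) / 2)) \<partial>M) = 1"
proof -
  define S where "S m \<omega> = (\<Sum>i<m. x i \<omega> * (W (\<sigma> (Suc i)) \<omega> - W (\<sigma> i) \<omega>)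
            - (x i \<omega>)\<^sup>2 * (\<sigma> (Suc i) - \<sigma> i) / 2)" for m \<omega>
  have sub: "subalgebra M (F t)" if "t \<in> {0..T}" for t
    using F that by (auto simp: usual_filtration_def)
  have mono: "h \<in> borel_measurable (F t)"
    if "h \<in> borel_measurable (F s)" "s \<le> t" "s \<in> {0..T}" "t \<in> {0..T}" for h :: "'a \<Rightarrow> real" and s t
  proof -
    have "sets (F s) \<subseteq> sets (F t)" using F that by (auto simp: usual_filtration_def)
    moreover have "space (F s) = space (F t)" using sub that by (auto simp: subalgebra_def)
    ultimately have "subalgebra (F t) (F s)" by (auto simp: subalgebra_def)
    then show ?thesis using measurable_from_subalg that(1) by blast
  qed
  have Wm: "W t \<in> borel_measurable (F t)" if "t \<in> {0..T}" for t
    using W that by (auto simp: wiener_process_def adapted_on_def)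
  have Sm: "S m \<in> borel_measurable (F (\<sigma> m))" if "m \<le> n" for m
    using that
  proof (induction m)
    case 0
    have "S 0 = (\<lambda>_. 0)" by (simp add: S_def fun_eq_iff)
    then show ?case by simp
  next
    case (Suc m)
    let ?N = "F (\<sigma> (Suc m))"
    have le: "\<sigma> m \<le> \<sigma> (Suc m)" "\<sigma> m \<in> {0..T}" "\<sigma> (Suc m) \<in> {0..T}" using Suc \<sigma> by auto
    have a: "S m \<in> borel_measurable ?N" using mono[OF Suc.IH le] Suc.prems by auto
    have b: "W (\<sigma> m) \<in> borel_measurable ?N" "W (\<sigma> (Suc m)) \<in> borel_measurable ?N"
      using mono[OF Wm le] Wm le by auto
    show ?case
    proof (cases "\<sigma> m < \<sigma> (Suc m)")
      case True
      then have c: "x m \<in> borel_measurable ?N" using mono[OF x[of m] le] Suc.prems by auto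
      have "S (Suc m) = (\<lambda>\<omega>. S m \<omega> + (x m \<omega> * (W (\<sigma> (Suc m)) \<omega> - W (\<sigma> m) \<omega>)
            - (x m \<omega>)\<^sup>2 * (\<sigma> (Suc m) - \<sigma> m) / 2))" by (simp add: S_def fun_eq_iff)
      then show ?thesis using a b c by simp
    next
      case False
      then have "S (Suc m) = S m" using le by (simp add: S_def fun_eq_iff)
      then show ?thesis using a by simp
    qed
  qed
  have "(\<integral>\<^sup>+\<omega>. ennreal (exp (S m \<omega>)) \<partial>M) = 1" if "m \<le> n" for m
    using that
  proof (induction m)
    case 0
    then show ?case by (simp add: S_def emeasure_space_1)
  next
    case (Suc m)
    show ?case
    proof (cases "\<sigma> m < \<sigma> (Suc m)")
      case False
      then have "S (Suc m) = S m" using Suc.prems \<sigma>(1)[of m] by (simp add: S_def fun_eq_iff)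
      then show ?thesis using Suc by simp
    next
      case True
      let ?N = "F (\<sigma> m)" and ?Y = "\<lambda>\<omega>. W (\<sigma> (Suc m)) \<omega> - W (\<sigma> m) \<omega>"
      let ?d = "\<sigma> (Suc m) - \<sigma> m"
      have le: "0 \<le> \<sigma> m" "\<sigma> (Suc m) \<le> T" "\<sigma> m \<in> {0..T}" using Suc.prems \<sigma>(2)[of m] \<sigma>(2)[of "Suc m"] by auto
      have dist: "distributed M lborel ?Y (normal_density 0 (sqrt ?d))"
        and ind: "indep_set (sets ?N) {?Y -` B \<inter> space M | B. B \<in> sets borel}"
        using W True le by (auto simp: wiener_process_def)
      have Y: "?Y \<in> borel_measurable M" using dist by (simp add: distributed_def)
      have law: "distr M borel ?Y = density lborel (normal_density 0 (sqrt ?d))"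
        using dist by (simp add: distributed_def cong: distr_cong)
      have Nm: "S m \<in> borel_measurable ?N" "x m \<in> borel_measurable ?N"
        using Sm x Suc.prems True by auto
      note [measurable] = Nm
      define g where "g = (\<lambda>(\<omega>, w). ennreal (exp (S m \<omega>)) * ennreal (exp (x m \<omega> * w - (x m \<omega>)\<^sup>2 * (sqrt ?d)\<^sup>2 / 2)))"
      have gm: "g \<in> borel_measurable (?N \<Otimes>\<^sub>M borel)" unfolding g_def by measurable
      have "(\<integral>\<^sup>+\<omega>. ennreal (exp (S (Suc m) \<omega>)) \<partial>M) = (\<integral>\<^sup>+\<omega>. g (\<omega>, ?Y \<omega>) \<partial>M)"
        unfolding g_def using True by (simp add: S_def exp_add flip: ennreal_mult)
      also have "\<dots> = (\<integral>\<^sup>+\<omega>. (\<integral>\<^sup>+w. g (\<omega>, w) \<partial>density lborel (normal_density 0 (sqrt ?d))) \<partial>M)"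
        unfolding law[symmetric] by (rule nn_integral_indep_increment[OF sub[OF le(3)] Y ind gm])
      also have "\<dots> = (\<integral>\<^sup>+\<omega>. ennreal (exp (S m \<omega>)) \<partial>M)"
        unfolding g_def prod.case
        by (subst nn_integral_cmult) (use True nn_integral_exp_normal[of "sqrt ?d"] in auto)
      finally show ?thesis using Suc by simp
    qed
  qed
  then show ?thesis by (simp add: S_def)
qed

section \<open>Moments of Ito integrals with bounded integrand\<close>

lemma tendsto_in_prob_subseq:
  assumes "tendsto_in_prob M Y L" "strict_mono (r :: nat \<Rightarrow> nat)"
  shows "tendsto_in_prob M (\<lambda>k. Y (r k)) L"
  using assms LIMSEQ_subseq_LIMSEQ[of "\<lambda>k. measure M {\<omega> \<in> space M. e < \<bar>Y k \<omega> - L \<omega>\<bar>}" 0 r for e]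
  by (auto simp: tendsto_in_prob_def o_def)

text \<open>The subsequence is chosen such that the exceptional probabilities are summable, and Borel--Cantelli
  applies.\<close>

lemma (in prob_space) tendsto_in_prob_AE_subseq:
  assumes "tendsto_in_prob M Y L"
  obtains r :: "nat \<Rightarrow> nat" where "strict_mono r" "AE \<omega> in M. (\<lambda>k. Y (r k) \<omega>) \<longlonglongrightarrow> L \<omega>"
proof -
  have m[measurable]: "\<And>k. Y k \<in> borel_measurable M" "L \<in> borel_measurable M"
    and lim: "\<And>e. e > 0 \<Longrightarrow> (\<lambda>k. prob {\<omega> \<in> space M. e < \<bar>Y k \<omega> - L \<omega>\<bar>}) \<longlonglongrightarrow> 0"
    using assms by (auto simp: tendsto_in_prob_def)
  define P where "P n k \<longleftrightarrow> prob {\<omega> \<in> space M. (1/2)^n < \<bar>Y k \<omega> - L \<omega>\<bar>} < (1/2)^n" for n k :: nat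
  have ev: "eventually (P n) sequentially" for n
    unfolding P_def by (rule order_tendstoD(2)[OF lim]) auto
  have "\<exists>r. \<forall>n. P n (r n) \<and> r n < r (Suc n)"
  proof (rule dependent_nat_choice)
    show "\<exists>x. P 0 x" using ev[of 0] by (auto simp: eventually_sequentially)
    fix x n
    have "eventually (\<lambda>k. P (Suc n) k \<and> x < k) sequentially"
      using ev[of "Suc n"] eventually_gt_at_top[of x] by eventually_elim simp
    then show "\<exists>y. P (Suc n) y \<and> x < y" by (auto simp: eventually_sequentially)
  qed
  then obtain r where r: "\<And>n. P n (r n)" "\<And>n. r n < r (Suc n)" by auto
  then have mono: "strict_mono r" by (simp add: strict_mono_Suc_iff)
  have "AE \<omega> in M. eventually (\<lambda>n. \<omega> \<in> space M - {\<omega> \<in> space M. (1/2)^n < \<bar>Y (r n) \<omega> - L \<omega>\<bar>}) sequentially"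
  proof (rule borel_cantelli_AE1)
    show "summable (\<lambda>n. prob {\<omega> \<in> space M. (1/2)^n < \<bar>Y (r n) \<omega> - L \<omega>\<bar>})"
      by (rule summable_comparison_test'[OF summable_geometric[of "1/2::real"], of 0])
         (use r in \<open>auto simp: P_def less_imp_le\<close>)
  qed (auto simp: emeasure_eq_measure)
  then have "AE \<omega> in M. (\<lambda>k. Y (r k) \<omega>) \<longlonglongrightarrow> L \<omega>"
  proof eventually_elim
    case (elim \<omega>)
    then have "eventually (\<lambda>n. norm (Y (r n) \<omega> - L \<omega>) \<le> (1/2)^n) sequentially"
      by eventually_elim (auto simp: not_less)
    then have "(\<lambda>n. Y (r n) \<omega> - L \<omega>) \<longlonglongrightarrow> 0"
      by (rule Lim_null_comparison) (simp add: LIMSEQ_realpow_zero)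
    then show ?case by (simp add: LIM_zero_iff)
  qed
  with mono that show thesis by blast
qed

text \<open>The increment over \<open>[s, t]\<close> is the integral along the partition clipped to \<open>[s, t]\<close>, which makes
  the exponential martingale applicable to increments.\<close>

lemma simple_integral_diff:
  assumes "\<And>i. i < n \<Longrightarrow> \<tau> i < \<tau> (Suc i)" "s \<le> t"
  shows "simple_integral W n \<tau> \<xi> t \<omega> - simple_integral W n \<tau> \<xi> s \<omega>
    = (\<Sum>i<n. \<xi> i \<omega> * (W (max s (min (\<tau> (Suc i)) t)) \<omega> - W (max s (min (\<tau> i) t)) \<omega>))"
proof -
  have W: "W (max s (min r t)) \<omega> = W (min r t) \<omega> - W (min r s) \<omega> + W s \<omega>" for r
    using assms(2) by (cases "r \<le> s"; cases "r \<le> t") (auto simp: max_def min_def)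
  show ?thesis
    unfolding simple_integral_def sum_subtractf[symmetric]
    by (rule sum.cong) (simp_all add: W algebra_simps)
qed

lemma simple_value_square:
  assumes "\<And>i. i < n \<Longrightarrow> \<tau> i < \<tau> (Suc i)"
  shows "(simple_value n \<tau> \<xi> u \<omega>)\<^sup>2 = (\<Sum>i<n. (\<xi> i \<omega>)\<^sup>2 * indicator {\<tau> i<..\<tau> (Suc i)} u)"
proof (cases "\<exists>j<n. u \<in> {\<tau> j<..\<tau> (Suc j)}")
  case True
  then obtain j where j: "j < n" "\<tau> j < u" "u \<le> \<tau> (Suc j)" by auto
  have mono: "\<tau> i \<le> \<tau> k" if "i \<le> k" "k \<le> n" for i k
    using that
  proof (induction k rule: dec_induct)
    case (step m)
    then show ?case using assms[of m] by simp
  qed simp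
  have ind: "indicator {\<tau> i<..\<tau> (Suc i)} u = (if i = j then 1 else 0 :: real)" if "i < n" for i
  proof -
    have "\<not> (\<tau> i < u \<and> u \<le> \<tau> (Suc i))" if "i \<noteq> j"
      using that mono[of "Suc i" j] mono[of "Suc j" i] j \<open>i < n\<close> by (cases "i < j") auto
    then show ?thesis using j by (auto simp: indicator_def)
  qed
  have "simple_value n \<tau> \<xi> u \<omega> = (\<Sum>i<n. \<xi> i \<omega> * (if i = j then 1 else 0))"
    unfolding simple_value_def by (rule sum.cong) (simp_all add: ind)
  also have "\<dots> = \<xi> j \<omega>" using j by (simp add: if_distrib cong: if_cong)
  finally have 1: "simple_value n \<tau> \<xi> u \<omega> = \<xi> j \<omega>" .
  have "(\<Sum>i<n. (\<xi> i \<omega>)\<^sup>2 * indicator {\<tau> i<..\<tau> (Suc i)} u) = (\<Sum>i<n. (\<xi> i \<omega>)\<^sup>2 * (if i = j then 1 else 0))"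
    by (rule sum.cong) (simp_all add: ind)
  also have "\<dots> = (\<xi> j \<omega>)\<^sup>2" using j by (simp add: if_distrib cong: if_cong)
  finally show ?thesis by (simp add: 1)
next
  case False
  then have ind: "indicator {\<tau> i<..\<tau> (Suc i)} u = (0 :: real)" if "i < n" for i
    using that by (auto simp: indicator_def)
  then show ?thesis by (simp add: simple_value_def)
qed

text \<open>By \<open>V\<^sup>2 \<le> 2 * H\<^sup>2 + 2 * (V - H)\<^sup>2\<close>, the quadratic variation of approximating integrals is controlled
  by the bound on the limit integrand; the approximants themselves may have arbitrarily large bounds.\<close>

lemma simple_quadratic_variation_le:
  fixes H :: "real \<Rightarrow> real"
  assumes \<tau>: "\<And>i. i < n \<Longrightarrow> \<tau> i < \<tau> (Suc i)" and st: "0 \<le> s" "s \<le> t" "t \<le> T"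
    and H: "set_borel_measurable lborel {0..T} H" "\<And>u. u \<in> {0..T} \<Longrightarrow> \<bar>H u\<bar> \<le> B"
  shows "(\<Sum>i<n. (\<xi> i \<omega>)\<^sup>2 * (max s (min (\<tau> (Suc i)) t) - max s (min (\<tau> i) t)))
     \<le> 2 * B\<^sup>2 * (t - s) + 2 * (LBINT u:{0..T}. (simple_value n \<tau> \<xi> u \<omega> - H u)\<^sup>2)"
proof -
  let ?\<sigma> = "\<lambda>i. max s (min (\<tau> i) t)" and ?V = "\<lambda>u. simple_value n \<tau> \<xi> u \<omega>"
  define C where "C = (\<Sum>i<n. \<bar>\<xi> i \<omega>\<bar>)"
  have Vm[measurable]: "?V \<in> borel_measurable borel" unfolding simple_value_def by measurable
  have Vb: "\<bar>?V u\<bar> \<le> C" for u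
    unfolding simple_value_def C_def
    by (rule order.trans[OF sum_abs]) (auto intro!: sum_mono simp: indicator_def)
  have "(\<lambda>u. indicator {0..T} u * H u) \<in> borel_measurable borel"
    using H(1) by (simp add: set_borel_measurable_def)
  then have m: "(\<lambda>u. indicator {0..T} u * (?V u - indicator {0..T} u * H u)\<^sup>2) \<in> borel_measurable borel"
    by measurable
  have i0: "integrable lborel (indicat_real {0..T})"
    by (rule integrable_real_indicator) (use st in auto)
  have "integrable lborel (\<lambda>u. indicator {0..T} u * (?V u - indicator {0..T} u * H u)\<^sup>2)"
  proof (rule Bochner_Integration.integrable_bound[where f = "\<lambda>u. indicator {0..T} u * (C + \<bar>B\<bar>)\<^sup>2"])
    show "AE u in lborel. norm (indicator {0..T} u * (?V u - indicator {0..T} u * H u)\<^sup>2)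
        \<le> norm (indicator {0..T} u * (C + \<bar>B\<bar>)\<^sup>2)"
    proof (rule AE_I2)
      fix u
      have "\<bar>?V u - H u\<bar> \<le> C + \<bar>B\<bar>" if "u \<in> {0..T}"
        using Vb[of u] H(2)[OF that] by linarith
      then show "norm (indicator {0..T} u * (?V u - indicator {0..T} u * H u)\<^sup>2)
        \<le> norm (indicator {0..T} u * (C + \<bar>B\<bar>)\<^sup>2)"
        by (auto simp: indicator_def abs_le_square_iff intro: power_mono)
           (metis abs_ge_zero abs_of_nonneg order_trans power2_abs power_mono)
    qed
  qed (use m i0 in auto)
  moreover have eq: "indicator {0..T} u * (?V u - indicator {0..T} u * H u)\<^sup>2 = indicator {0..T} u * (?V u - H u)\<^sup>2" for u
    by (auto simp: indicator_def)
  ultimately have i1: "integrable lborel (\<lambda>u. indicator {0..T} u * (?V u - H u)\<^sup>2)" by simp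
  have "integrable lborel (indicat_real {s<..t})"
    by (rule integrable_real_indicator) (use st in auto)
  then have i2: "integrable lborel (\<lambda>u. indicator {s<..t} u * (2 * B\<^sup>2))" by simp
  have \<sigma>fin: "emeasure lborel {?\<sigma> i<..?\<sigma> (Suc i)} < \<infinity>" if "i < n" for i
    using \<tau>[OF that] st by (subst emeasure_lborel_Ioc) auto
  have i4: "integrable lborel (indicat_real {?\<sigma> i<..?\<sigma> (Suc i)})" if "i < n" for i
    by (rule integrable_real_indicator) (use \<sigma>fin[OF that] in auto)
  have meas: "measure lborel {?\<sigma> i<..?\<sigma> (Suc i)} = ?\<sigma> (Suc i) - ?\<sigma> i" if "i < n" for i
    by (rule measure_lborel_Ioc) (use \<tau>[OF that] in auto)
  have i3: "integrable lborel (\<lambda>u. \<Sum>i<n. (\<xi> i \<omega>)\<^sup>2 * indicator {?\<sigma> i<..?\<sigma> (Suc i)} u)"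
    by (intro Bochner_Integration.integrable_sum integrable_mult_right) (use i4 in auto)
  have "(\<Sum>i<n. (\<xi> i \<omega>)\<^sup>2 * (?\<sigma> (Suc i) - ?\<sigma> i))
      = (\<integral>u. (\<Sum>i<n. (\<xi> i \<omega>)\<^sup>2 * indicator {?\<sigma> i<..?\<sigma> (Suc i)} u) \<partial>lborel)"
    by (subst Bochner_Integration.integral_sum) (use i4 meas in auto)
  also have "\<dots> \<le> (\<integral>u. indicator {s<..t} u * (2 * B\<^sup>2) + 2 * (indicator {0..T} u * (?V u - H u)\<^sup>2) \<partial>lborel)"
  proof (rule integral_mono[OF i3])
    show "integrable lborel (\<lambda>u. indicator {s<..t} u * (2 * B\<^sup>2) + 2 * (indicator {0..T} u * (?V u - H u)\<^sup>2))"
      using i1 i2 by simp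
    fix u
    have "(\<Sum>i<n. (\<xi> i \<omega>)\<^sup>2 * indicator {?\<sigma> i<..?\<sigma> (Suc i)} u)
        = (\<Sum>i<n. (\<xi> i \<omega>)\<^sup>2 * indicator {\<tau> i<..\<tau> (Suc i)} u) * indicator {s<..t} u"
      unfolding sum_distrib_right
      by (rule sum.cong) (use st \<tau> in \<open>auto simp: indicator_def max_def min_def split: if_splits\<close>)
    also have "\<dots> = (?V u)\<^sup>2 * indicator {s<..t} u"
      by (subst simple_value_square) (use \<tau> in auto)
    also have "\<dots> \<le> indicator {s<..t} u * (2 * B\<^sup>2) + 2 * (indicator {0..T} u * (?V u - H u)\<^sup>2)"
    proof (cases "u \<in> {s<..t}")
      case True
      then have u: "u \<in> {0..T}" using st by auto
      have "(?V u)\<^sup>2 \<le> 2 * (H u)\<^sup>2 + 2 * (?V u - H u)\<^sup>2"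
        using zero_le_power2[of "?V u - 2 * H u"] by (simp add: power2_eq_square algebra_simps)
      moreover have "(H u)\<^sup>2 \<le> B\<^sup>2" using H(2)[OF u] by (simp add: abs_le_square_iff[symmetric])
      ultimately show ?thesis using True u by simp
    qed simp
    finally show "(\<Sum>i<n. (\<xi> i \<omega>)\<^sup>2 * indicator {?\<sigma> i<..?\<sigma> (Suc i)} u)
       \<le> indicator {s<..t} u * (2 * B\<^sup>2) + 2 * (indicator {0..T} u * (?V u - H u)\<^sup>2)" .
  qed
  also have "\<dots> = 2 * B\<^sup>2 * (t - s) + 2 * (\<integral>u. indicator {0..T} u * (?V u - H u)\<^sup>2 \<partial>lborel)"
    using i1 i2 st by simp
  finally show ?thesis by (simp add: set_lebesgue_integral_def)
qed

text \<open>Sub-Gaussian increments: the exponential martingales of the approximating simple processes have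
  expectation \<open>1\<close>, their quadratic variations are asymptotically at most \<open>2 * B\<^sup>2 * (t - s)\<close>, and Fatou's
  lemma passes to the limit along an almost surely convergent subsequence.\<close>

lemma (in prob_space) ito_integral_exp_moment:
  assumes F: "usual_filtration M T F" and W: "wiener_process M T F W"
    and I: "ito_integral M T F W H I"
    and H: "\<And>u \<omega>. u \<in> {0..T} \<Longrightarrow> \<bar>H u \<omega>\<bar> \<le> B"
    and st: "0 \<le> s" "s \<le> t" "t \<le> T"
  shows "(\<integral>\<^sup>+\<omega>. ennreal (exp (\<theta> * (I t \<omega> - I s \<omega>))) \<partial>M) \<le> ennreal (exp (\<theta>\<^sup>2 * B\<^sup>2 * (t - s)))"
proof -
  from I obtain n \<tau> \<xi> where simple: "\<And>k. simple_process M T F (n k) (\<tau> k) (\<xi> k)"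
    and QV: "tendsto_in_prob M
          (\<lambda>k \<omega>. LBINT s:{0..T}. (simple_value (n k) (\<tau> k) (\<xi> k) s \<omega> - H s \<omega>)\<^sup>2) (\<lambda>\<omega>. 0)"
      (is "tendsto_in_prob M ?V _")
    and SI: "\<And>t. t \<in> {0..T} \<Longrightarrow> tendsto_in_prob M (\<lambda>k. simple_integral W (n k) (\<tau> k) (\<xi> k) t) (I t)"
    and Hm: "AE \<omega> in M. set_borel_measurable lborel {0..T} (\<lambda>s. H s \<omega>)"
    unfolding ito_integral_def by fastforce
  define J where "J k = simple_integral W (n k) (\<tau> k) (\<xi> k)" for k
  have J: "tendsto_in_prob M (\<lambda>k. J k t) (I t)" "tendsto_in_prob M (\<lambda>k. J k s) (I s)"
    using SI st by (auto simp: J_def)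
  \<comment> \<open>Three nested subsequences, along which the squared distances and both integrals converge
     almost surely.\<close>
  obtain r1 where r1: "strict_mono r1" "AE \<omega> in M. (\<lambda>k. ?V (r1 k) \<omega>) \<longlonglongrightarrow> 0"
    using tendsto_in_prob_AE_subseq[OF QV] by blast
  obtain r2 where r2: "strict_mono r2" "AE \<omega> in M. (\<lambda>k. J (r1 (r2 k)) t \<omega>) \<longlonglongrightarrow> I t \<omega>"
    using tendsto_in_prob_AE_subseq[OF tendsto_in_prob_subseq[OF J(1) r1(1)]] by blast
  have r12: "strict_mono (\<lambda>k. r1 (r2 k))" using r1 r2 by (simp add: strict_mono_def)
  obtain r3 where r3: "strict_mono r3" "AE \<omega> in M. (\<lambda>k. J (r1 (r2 (r3 k))) s \<omega>) \<longlonglongrightarrow> I s \<omega>"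
    using tendsto_in_prob_AE_subseq[OF tendsto_in_prob_subseq[OF J(2) r12]] by blast
  define r where "r k = r1 (r2 (r3 k))" for k
  have r23: "strict_mono (\<lambda>k. r2 (r3 k))" using r2 r3 by (simp add: strict_mono_def)
  define \<sigma> where "\<sigma> k i = max s (min (\<tau> k i) t)" for k i
  define Q where "Q k \<omega> = (\<Sum>i<n k. (\<xi> k i \<omega>)\<^sup>2 * (\<sigma> k (Suc i) - \<sigma> k i))" for k \<omega>
  have \<tau>: "\<tau> k i < \<tau> k (Suc i)" if "i < n k" for k i
    using simple that by (auto simp: simple_process_def)
  have sub: "subalgebra M (F u)" if "u \<in> {0..T}" for u
    using F that by (auto simp: usual_filtration_def)
  have \<tau>0: "0 \<le> \<tau> k i \<and> \<tau> k i \<le> T" if "i \<le> n k" for k i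
  proof -
    have "\<tau> k 0 \<le> \<tau> k i" using that
      by (induction i) (use \<tau> in \<open>force simp: Suc_le_eq intro: order.trans less_imp_le\<close>)+
    moreover have "\<tau> k i \<le> \<tau> k (n k)" using that
    proof (induction rule: inc_induct)
      case (step m)
      then show ?case using \<tau>[of m k] by simp
    qed simp
    ultimately show ?thesis using simple[of k] by (simp add: simple_process_def)
  qed
  have \<xi>m: "\<xi> k i \<in> borel_measurable (F (\<tau> k i))" if "i < n k" for k i
    using simple that by (auto simp: simple_process_def)
  have \<xi>M: "\<xi> k i \<in> borel_measurable M" if "i < n k" for k i
    using measurable_from_subalg[OF sub \<xi>m[OF that]] \<tau>0 that by auto
  have Jm: "J k u \<in> borel_measurable M" if "u \<in> {0..T}" for k u
    using SI[OF that] by (auto simp: tendsto_in_prob_def J_def)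
  have Qm: "Q k \<in> borel_measurable M" for k
    unfolding Q_def by (intro borel_measurable_sum) (use \<xi>M in measurable)
  define E where "E k \<omega> = \<theta> * (J k t \<omega> - J k s \<omega>) - \<theta>\<^sup>2 * Q k \<omega> / 2" for k \<omega>
  have Em[measurable]: "E k \<in> borel_measurable M" for k
  proof -
    have [measurable]: "J k t \<in> borel_measurable M" "J k s \<in> borel_measurable M" "Q k \<in> borel_measurable M"
      using Jm Qm st by auto
    show ?thesis unfolding E_def by measurable
  qed
  have diff: "simple_integral W (n k) (\<tau> k) (\<xi> k) t \<omega> - simple_integral W (n k) (\<tau> k) (\<xi> k) s \<omega>
    = (\<Sum>i<n k. \<xi> k i \<omega> * (W (max s (min (\<tau> k (Suc i)) t)) \<omega> - W (max s (min (\<tau> k i) t)) \<omega>))" for k \<omega>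
    by (rule simple_integral_diff) (use \<tau> st in auto)
  have E1: "(\<integral>\<^sup>+\<omega>. ennreal (exp (E k \<omega>)) \<partial>M) = 1" for k
  proof -
    have "E k \<omega> = (\<Sum>i<n k. (\<theta> * \<xi> k i \<omega>) * (W (\<sigma> k (Suc i)) \<omega> - W (\<sigma> k i) \<omega>)
        - (\<theta> * \<xi> k i \<omega>)\<^sup>2 * (\<sigma> k (Suc i) - \<sigma> k i) / 2)" for \<omega>
      unfolding E_def J_def Q_def diff \<sigma>_def
      by (simp add: sum_distrib_left sum_divide_distrib sum_subtractf power_mult_distrib mult.assoc)
    moreover have "(\<integral>\<^sup>+\<omega>. ennreal (exp (\<Sum>i<n k. (\<theta> * \<xi> k i \<omega>) * (W (\<sigma> k (Suc i)) \<omega> - W (\<sigma> k i) \<omega>)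
        - (\<theta> * \<xi> k i \<omega>)\<^sup>2 * (\<sigma> k (Suc i) - \<sigma> k i) / 2)) \<partial>M) = 1"
    proof (rule nn_integral_exp_martingale[OF F W])
      fix i assume i: "i < n k"
      show "\<sigma> k i \<le> \<sigma> k (Suc i)" using \<tau>[OF i] by (auto simp: \<sigma>_def)
      assume "\<sigma> k i < \<sigma> k (Suc i)"
      then have le: "\<tau> k i \<le> \<sigma> k i" using st by (auto simp: \<sigma>_def max_def min_def split: if_splits)
      have a: "\<sigma> k i \<in> {0..T}" "\<tau> k i \<in> {0..T}" using \<tau>0[of i k] i st by (auto simp: \<sigma>_def)
      then have "subalgebra (F (\<sigma> k i)) (F (\<tau> k i))"
        using F sub le by (auto simp: usual_filtration_def subalgebra_def)
      then have "\<xi> k i \<in> borel_measurable (F (\<sigma> k i))" using measurable_from_subalg \<xi>m[OF i] by blast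
      then show "(\<lambda>\<omega>. \<theta> * \<xi> k i \<omega>) \<in> borel_measurable (F (\<sigma> k i))" by simp
    qed (use st in \<open>auto simp: \<sigma>_def\<close>)
    ultimately show ?thesis by simp
  qed
  have "AE \<omega> in M. (\<lambda>k. ?V (r k) \<omega>) \<longlonglongrightarrow> 0 \<and> (\<lambda>k. J (r k) t \<omega>) \<longlonglongrightarrow> I t \<omega> \<and> (\<lambda>k. J (r k) s \<omega>) \<longlonglongrightarrow> I s \<omega>
      \<and> set_borel_measurable lborel {0..T} (\<lambda>s. H s \<omega>)"
    using r1(2) r2(2) r3(2) Hm
  proof eventually_elim
    case (elim \<omega>)
    then show ?case
      using LIMSEQ_subseq_LIMSEQ[OF elim(1) r23] LIMSEQ_subseq_LIMSEQ[OF elim(2) r3(1)]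
      by (simp add: r_def o_def)
  qed
  then have "AE \<omega> in M. ennreal (exp (\<theta> * (I t \<omega> - I s \<omega>) - \<theta>\<^sup>2 * B\<^sup>2 * (t - s)))
      \<le> liminf (\<lambda>k. ennreal (exp (E (r k) \<omega>)))"
  proof eventually_elim
    case (elim \<omega>)
    let ?e = "\<lambda>k. exp (\<theta> * (J (r k) t \<omega> - J (r k) s \<omega>) - \<theta>\<^sup>2 * (B\<^sup>2 * (t - s) + ?V (r k) \<omega>))"
    have lim: "(\<lambda>k. ennreal (?e k)) \<longlonglongrightarrow> ennreal (exp (\<theta> * (I t \<omega> - I s \<omega>) - \<theta>\<^sup>2 * (B\<^sup>2 * (t - s) + 0)))"
      by (intro tendsto_intros tendsto_ennrealI) (use elim in auto)
    have le: "ennreal (?e k) \<le> ennreal (exp (E (r k) \<omega>))" for k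
    proof -
      have "Q (r k) \<omega> \<le> 2 * B\<^sup>2 * (t - s) + 2 * ?V (r k) \<omega>"
        unfolding Q_def \<sigma>_def
        by (rule simple_quadratic_variation_le) (use \<tau> st elim H in auto)
      then have "\<theta>\<^sup>2 * Q (r k) \<omega> \<le> \<theta>\<^sup>2 * (2 * B\<^sup>2 * (t - s) + 2 * ?V (r k) \<omega>)"
        by (intro mult_left_mono) auto
      then show ?thesis unfolding E_def by (intro ennreal_leI) (simp add: algebra_simps)
    qed
    have "ennreal (exp (\<theta> * (I t \<omega> - I s \<omega>) - \<theta>\<^sup>2 * B\<^sup>2 * (t - s))) = liminf (\<lambda>k. ennreal (?e k))"
      using lim_imp_Liminf[OF _ lim] by (simp add: mult.assoc)
    also have "\<dots> \<le> liminf (\<lambda>k. ennreal (exp (E (r k) \<omega>)))"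
      by (rule Liminf_mono) (use le in auto)
    finally show ?case .
  qed
  then have "(\<integral>\<^sup>+\<omega>. ennreal (exp (\<theta> * (I t \<omega> - I s \<omega>) - \<theta>\<^sup>2 * B\<^sup>2 * (t - s))) \<partial>M)
      \<le> (\<integral>\<^sup>+\<omega>. liminf (\<lambda>k. ennreal (exp (E (r k) \<omega>))) \<partial>M)"
    by (rule nn_integral_mono_AE)
  also have "\<dots> \<le> liminf (\<lambda>k. \<integral>\<^sup>+\<omega>. ennreal (exp (E (r k) \<omega>)) \<partial>M)"
    by (rule nn_integral_liminf) measurable
  also have "\<dots> = 1" by (simp add: E1 Liminf_const)
  finally have le1: "(\<integral>\<^sup>+\<omega>. ennreal (exp (\<theta> * (I t \<omega> - I s \<omega>) - \<theta>\<^sup>2 * B\<^sup>2 * (t - s))) \<partial>M) \<le> 1" .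
  have [measurable]: "I t \<in> borel_measurable M" "I s \<in> borel_measurable M"
    using J by (auto simp: tendsto_in_prob_def)
  have "(\<integral>\<^sup>+\<omega>. ennreal (exp (\<theta> * (I t \<omega> - I s \<omega>))) \<partial>M)
     = (\<integral>\<^sup>+\<omega>. ennreal (exp (\<theta>\<^sup>2 * B\<^sup>2 * (t - s))) * ennreal (exp (\<theta> * (I t \<omega> - I s \<omega>) - \<theta>\<^sup>2 * B\<^sup>2 * (t - s))) \<partial>M)"
    by (simp flip: ennreal_mult exp_add)
  also have "\<dots> = ennreal (exp (\<theta>\<^sup>2 * B\<^sup>2 * (t - s)))
      * (\<integral>\<^sup>+\<omega>. ennreal (exp (\<theta> * (I t \<omega> - I s \<omega>) - \<theta>\<^sup>2 * B\<^sup>2 * (t - s))) \<partial>M)"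
    by (rule nn_integral_cmult) measurable
  also have "\<dots> \<le> ennreal (exp (\<theta>\<^sup>2 * B\<^sup>2 * (t - s))) * 1"
    by (intro mult_left_mono le1) auto
  finally show ?thesis by simp
qed

text \<open>The exponential bound at the natural scale \<open>\<theta> = (t - s) powr (-1/2)\<close>, combined with
  \<open>y ^ m \<le> fact m * exp y\<close>.\<close>

lemma (in prob_space) ito_integral_increment_moment:
  assumes F: "usual_filtration M T F" and W: "wiener_process M T F W"
    and I: "ito_integral M T F W H I"
    and H: "\<And>u \<omega>. u \<in> {0..T} \<Longrightarrow> \<bar>H u \<omega>\<bar> \<le> B"
    and st: "0 \<le> s" "s < t" "t \<le> T"
  shows "(\<integral>\<^sup>+\<omega>. ennreal (\<bar>I t \<omega> - I s \<omega>\<bar> ^ m) \<partial>M) \<le> ennreal (2 * fact m * exp (B\<^sup>2) * (t - s) powr (m / 2))"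
proof -
  define \<theta> where "\<theta> = (t - s) powr (- 1/2)"
  have \<theta>: "\<theta> > 0" "\<theta>\<^sup>2 * (t - s) = 1"
    using st by (auto simp: \<theta>_def power2_eq_square simp flip: powr_add)
  have [measurable]: "I u \<in> borel_measurable M" if "u \<in> {0..T}" for u
  proof -
    have "subalgebra M (F u)" "I u \<in> borel_measurable (F u)"
      using F I that by (auto simp: usual_filtration_def ito_integral_def adapted_on_def)
    then show ?thesis using measurable_from_subalg by blast
  qed
  have [measurable]: "I t \<in> borel_measurable M" "I s \<in> borel_measurable M" using st by auto
  have scale: "inverse \<theta> ^ m = (t - s) powr (m / 2)"
    using st by (simp add: \<theta>_def powr_powr flip: powr_minus powr_realpow)
  have pw: "\<bar>x\<bar> ^ m \<le> fact m * (t - s) powr (m / 2) * (exp (\<theta> * x) + exp ((-\<theta>) * x))" for x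
  proof -
    define y where "y = \<theta> * \<bar>x\<bar>"
    have "y \<ge> 0" using \<theta> by (simp add: y_def)
    then have "y ^ m / fact m \<le> exp y"
      using sum_le_suminf[OF summable_exp_generic[of y], of "{m}"]
      by (auto simp: exp_def divide_inverse mult.commute)
    moreover have "exp y \<le> exp (\<theta> * x) + exp ((-\<theta>) * x)"
      unfolding y_def by (cases "x \<ge> 0") (auto simp: add_increasing add_increasing2)
    ultimately have "y ^ m / fact m \<le> exp (\<theta> * x) + exp ((-\<theta>) * x)" by linarith
    then have "y ^ m \<le> fact m * (exp (\<theta> * x) + exp ((-\<theta>) * x))"
      by (simp add: pos_divide_le_eq mult.commute)
    moreover have "\<bar>x\<bar> = inverse \<theta> * y" using \<theta> by (simp add: y_def)
    ultimately show ?thesis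
      using mult_left_mono[of "y ^ m" "fact m * (exp (\<theta> * x) + exp ((-\<theta>) * x))" "inverse \<theta> ^ m"] \<theta>
      by (simp add: power_mult_distrib scale mult_ac)
  qed
  let ?c = "fact m * (t - s) powr (m / 2)"
  have "(\<integral>\<^sup>+\<omega>. ennreal (\<bar>I t \<omega> - I s \<omega>\<bar> ^ m) \<partial>M)
     \<le> (\<integral>\<^sup>+\<omega>. ennreal ?c * (ennreal (exp (\<theta> * (I t \<omega> - I s \<omega>))) + ennreal (exp ((-\<theta>) * (I t \<omega> - I s \<omega>)))) \<partial>M)"
    by (intro nn_integral_mono) (use pw in \<open>simp flip: ennreal_mult ennreal_plus\<close>)
  also have "\<dots> = ennreal ?c * ((\<integral>\<^sup>+\<omega>. ennreal (exp (\<theta> * (I t \<omega> - I s \<omega>))) \<partial>M) + (\<integral>\<^sup>+\<omega>. ennreal (exp ((-\<theta>) * (I t \<omega> - I s \<omega>))) \<partial>M))"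
    by (subst nn_integral_cmult) (simp_all add: nn_integral_add)
  also have "\<dots> \<le> ennreal ?c * (ennreal (exp (\<theta>\<^sup>2 * B\<^sup>2 * (t - s))) + ennreal (exp ((-\<theta>)\<^sup>2 * B\<^sup>2 * (t - s))))"
    by (intro mult_left_mono add_mono ito_integral_exp_moment[OF F W I H]) (use st in auto)
  also have "\<theta>\<^sup>2 * B\<^sup>2 * (t - s) = B\<^sup>2" using \<theta>(2) by (metis mult.assoc mult.commute mult_1)
  also have "(-\<theta>)\<^sup>2 * B\<^sup>2 * (t - s) = B\<^sup>2" using \<theta>(2) by (metis mult.assoc mult.commute mult_1 power2_minus)
  finally show ?thesis
    by (simp add: algebra_simps flip: ennreal_mult ennreal_plus)
qed

text \<open>All approximating simple integrals vanish at time \<open>0\<close>.\<close>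

lemma (in prob_space) ito_integral_at_0:
  assumes "ito_integral M T F W H I" and "T > 0"
  shows "AE \<omega> in M. I 0 \<omega> = 0"
proof -
  from assms obtain n \<tau> \<xi> where simple: "\<And>k. simple_process M T F (n k) (\<tau> k) (\<xi> k)"
    and lim: "tendsto_in_prob M (\<lambda>k. simple_integral W (n k) (\<tau> k) (\<xi> k) 0) (I 0)"
    unfolding ito_integral_def by fastforce
  have "simple_integral W (n k) (\<tau> k) (\<xi> k) 0 \<omega> = 0" for k \<omega>
  proof -
    have "0 \<le> \<tau> k i" if "i \<le> n k" for i
      using that
    proof (induction i)
      case 0
      then show ?case using simple[of k] by (simp add: simple_process_def)
    next
      case (Suc i)
      then have "\<tau> k i < \<tau> k (Suc i)" using simple[of k] by (simp add: simple_process_def)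
      then show ?case using Suc by simp
    qed
    then have "min (\<tau> k i) 0 = 0" if "i \<le> n k" for i using that by (simp add: min_absorb2)
    then show ?thesis by (simp add: simple_integral_def)
  qed
  moreover obtain r where "AE \<omega> in M. (\<lambda>k. simple_integral W (n (r k)) (\<tau> (r k)) (\<xi> (r k)) 0 \<omega>) \<longlonglongrightarrow> I 0 \<omega>"
    using tendsto_in_prob_AE_subseq[OF lim] by blast
  ultimately show ?thesis by (auto elim!: eventually_mono simp: LIMSEQ_const_iff)
qed

section \<open>Dyadic chaining\<close>

text \<open>Chaining. Let \<open>d n t\<close> be the largest dyadic point of level \<open>n\<close> not beyond \<open>t\<close>. Passing from level \<open>n\<close> to
  level \<open>n + 1\<close> moves it by at most one step, so \<open>f t - f (d m t)\<close> is a geometric sum. If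
  \<open>t - s\<close> is comparable with the mesh of level \<open>m\<close>, then \<open>d m s\<close> and \<open>d m t\<close> are equal or neighbours.\<close>

lemma hoelder_from_dyadic_increments:
  fixes f :: "real \<Rightarrow> real"
  assumes T: "T > 0" and \<eta>: "\<eta> > 0" and \<xi>: "\<xi> \<ge> 0" and cont: "continuous_on {0..T} f"
    and q: "q = 2 powr (-\<eta>)"
    and incr: "\<And>n k. k < 2 ^ n \<Longrightarrow> \<bar>f (T * real (Suc k) / 2 ^ n) - f (T * real k / 2 ^ n)\<bar> \<le> \<xi> * q ^ n"
    and st: "s \<in> {0..T}" "t \<in> {0..T}"
  shows "\<bar>f t - f s\<bar> \<le> (1 + 2 / (1 - q)) * (2 / T) powr \<eta> * \<xi> * \<bar>t - s\<bar> powr \<eta>"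
proof -
  have q01: "0 < q" "q < 1" using \<eta> by (auto simp: q powr_less_one)
  define N where "N n t = nat \<lfloor>2 ^ n * t / T\<rfloor>" for n :: nat and t
  define d where "d n t = T * real (N n t) / 2 ^ n" for n :: nat and t
  have N: "real (N n t) \<le> 2 ^ n * t / T" "2 ^ n * t / T < real (N n t) + 1" "N n t \<le> 2 ^ n"
    if "t \<in> {0..T}" for n t
  proof -
    have "0 \<le> 2 ^ n * t / T" using that T by simp
    then show a: "real (N n t) \<le> 2 ^ n * t / T" "2 ^ n * t / T < real (N n t) + 1"
      unfolding N_def by (simp_all add: of_nat_nat)
    have "2 ^ n * t / T \<le> 2 ^ n" using that T by (simp add: field_simps)
    then have "real (N n t) \<le> real (2 ^ n)" using a(1) unfolding of_nat_power of_nat_numeral by linarith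
    then show "N n t \<le> 2 ^ n" by (simp only: of_nat_le_iff)
  qed
  have dI: "d n t \<in> {0..T}" if "t \<in> {0..T}" for n t
  proof -
    have "real (N n t) \<le> real (2 ^ n)" using N(3)[OF that, of n] by (simp only: of_nat_le_iff)
    then show ?thesis using T by (auto simp: d_def field_simps)
  qed
  have one_step: "\<bar>f (d (Suc n) t) - f (d n t)\<bar> \<le> \<xi> * q ^ Suc n" if t: "t \<in> {0..T}" for n t
  proof -
    have "2 ^ Suc n * t / T = 2 * (2 ^ n * t / T)" by simp
    then have "real (N (Suc n) t) < 2 * real (N n t) + 2" "2 * real (N n t) < real (N (Suc n) t) + 1"
      using N(1,2)[OF t, of n] N(1,2)[OF t, of "Suc n"] by linarith+
    then consider "N (Suc n) t = 2 * N n t" | "N (Suc n) t = Suc (2 * N n t)" by linarith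
    then show ?thesis
    proof cases
      case 1
      then have "d (Suc n) t = d n t" by (simp add: d_def)
      then show ?thesis using \<xi> q01 by simp
    next
      case 2
      then have "2 * N n t < 2 ^ Suc n" using N(3)[OF t, of "Suc n"] by simp
      from incr[OF this] 2 show ?thesis by (simp add: d_def del: of_nat_Suc)
    qed
  qed
  have partial: "\<bar>f (d (m + k) t) - f (d m t)\<bar> \<le> \<xi> * q ^ m * (1 - q ^ k) / (1 - q)" if t: "t \<in> {0..T}" for m k t
  proof (induction k)
    case (Suc k)
    have "\<bar>f (d (m + Suc k) t) - f (d m t)\<bar> \<le> \<bar>f (d (m + k) t) - f (d m t)\<bar> + \<xi> * q ^ Suc (m + k)"
      using one_step[OF t, of "m + k"] by simp
    also have "\<dots> \<le> \<xi> * q ^ m * (1 - q ^ k) / (1 - q) + \<xi> * q ^ (m + k)"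
      using Suc \<xi> q01 by (intro add_mono mult_left_mono) (auto simp: mult_le_cancel_right1)
    also have "\<dots> = \<xi> * q ^ m * (1 - q ^ Suc k) / (1 - q)"
      using q01 by (simp add: field_simps power_add)
    finally show ?case .
  qed simp
  have d_lim: "(\<lambda>k. d (m + k) t) \<longlonglongrightarrow> t" if t: "t \<in> {0..T}" for m t
  proof -
    have "\<bar>d n t - t\<bar> \<le> T * (1/2) ^ n" for n
    proof -
      have "t - d n t = T * (1/2) ^ n * (2 ^ n * t / T - real (N n t))"
        using T by (simp add: d_def field_simps power_one_over)
      moreover have "T * (1/2) ^ n * (2 ^ n * t / T - real (N n t)) \<le> T * (1/2) ^ n * 1"
        using N(1,2)[OF t, of n] T by (intro mult_left_mono) auto
      moreover have "0 \<le> T * (1/2) ^ n * (2 ^ n * t / T - real (N n t))"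
        using N(1,2)[OF t, of n] T by (intro mult_nonneg_nonneg) auto
      ultimately show ?thesis by linarith
    qed
    then have le: "\<bar>d (m + k) t - t\<bar> \<le> T * (1/2) ^ (k + m)" for k by (simp add: add.commute)
    have "(\<lambda>k. T * (1/2) ^ (k + m)) \<longlonglongrightarrow> 0"
      by (rule tendsto_mult_right_zero, rule LIMSEQ_ignore_initial_segment) (simp add: LIMSEQ_realpow_zero)
    then have "(\<lambda>k. d (m + k) t - t) \<longlonglongrightarrow> 0"
      by (rule Lim_null_comparison[rotated]) (use le in simp)
    then show ?thesis by (simp add: LIM_zero_iff)
  qed
  have tail: "\<bar>f t - f (d m t)\<bar> \<le> \<xi> * q ^ m / (1 - q)" if t: "t \<in> {0..T}" for m t
  proof (rule LIMSEQ_le_const2)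
    have "(\<lambda>k. f (d (m + k) t)) \<longlonglongrightarrow> f t"
      by (rule continuous_on_tendsto_compose[OF cont d_lim[OF t] t]) (use dI[OF t] in auto)
    then show "(\<lambda>k. \<bar>f (d (m + k) t) - f (d m t)\<bar>) \<longlonglongrightarrow> \<bar>f t - f (d m t)\<bar>"
      by (intro tendsto_intros)
    have "\<xi> * q ^ m * (1 - q ^ k) / (1 - q) \<le> \<xi> * q ^ m / (1 - q)" for k
      using \<xi> q01 by (intro divide_right_mono mult_left_le) auto
    then show "\<exists>k0. \<forall>k\<ge>k0. \<bar>f (d (m + k) t) - f (d m t)\<bar> \<le> \<xi> * q ^ m / (1 - q)"
      using partial[OF t] order.trans by blast
  qed
  have main: "\<bar>f t - f s\<bar> \<le> (1 + 2 / (1 - q)) * (2 / T) powr \<eta> * \<xi> * \<bar>t - s\<bar> powr \<eta>"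
    if st: "s \<in> {0..T}" "t \<in> {0..T}" "s < t" for s t
  proof -
    have "\<exists>m. T * (1/2) ^ Suc m < t - s"
    proof -
      have "(\<lambda>m. T * (1/2) ^ Suc m) \<longlonglongrightarrow> 0"
        by (rule tendsto_mult_right_zero, rule LIMSEQ_Suc) (simp add: LIMSEQ_realpow_zero)
      from order_tendstoD(2)[OF this, of "t - s"] st show ?thesis
        by (auto simp: eventually_sequentially)
    qed
    then obtain m where m: "T * (1/2) ^ Suc m < t - s" "\<And>j. j < m \<Longrightarrow> \<not> T * (1/2) ^ Suc j < t - s"
      using exists_least_iff[of "\<lambda>m. T * (1/2) ^ Suc m < t - s"] by blast
    have m': "t - s \<le> T * (1/2) ^ m"
      using m(2)[of "m - 1"] st by (cases m) auto
    then have "2 ^ m * t / T \<le> 2 ^ m * s / T + 1" using T by (simp add: field_simps power_one_over)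
    moreover have "2 ^ m * s / T \<le> 2 ^ m * t / T" using T st by (simp add: field_simps)
    ultimately have "real (N m t) < real (N m s) + 2" "real (N m s) < real (N m t) + 1"
      using N(1,2)[OF st(1), of m] N(1,2)[OF st(2), of m] by linarith+
    then consider "N m t = N m s" | "N m t = Suc (N m s)" by linarith
    then have mid: "\<bar>f (d m t) - f (d m s)\<bar> \<le> \<xi> * q ^ m"
    proof cases
      case 1
      then show ?thesis using \<xi> q01 by (simp add: d_def)
    next
      case 2
      then have "N m s < 2 ^ m" using N(3)[OF st(2), of m] by simp
      from incr[OF this] 2 show ?thesis by (simp add: d_def del: of_nat_Suc)
    qed
    \<comment> \<open>The mesh of level \<open>m + 1\<close> is below \<open>t - s\<close>; this costs the factor \<open>2\<close> in \<open>2 / T\<close>.\<close>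
    have qp: "q ^ k = ((1/2) ^ k) powr \<eta>" for k
      by (simp add: q powr_minus power_inverse powr_power powr_powr powr_divide power_one_over mult.commute
          flip: powr_realpow) (simp add: inverse_eq_divide)
    have "q ^ m = (2 / T * (T * (1/2) ^ Suc m)) powr \<eta>" using T by (simp add: qp)
    also have "\<dots> \<le> (2 / T * (t - s)) powr \<eta>"
      using m(1) T \<eta> by (intro powr_mono2 mult_left_mono) auto
    also have "\<dots> = (2 / T) powr \<eta> * (t - s) powr \<eta>" using T st by (metis powr_mult)
    finally have qm: "q ^ m \<le> (2 / T) powr \<eta> * (t - s) powr \<eta>" .
    have "\<bar>f t - f s\<bar> \<le> \<xi> * q ^ m / (1 - q) + \<xi> * q ^ m / (1 - q) + \<xi> * q ^ m"
      using tail[OF st(1), of m] tail[OF st(2), of m] mid by linarith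
    also have "\<dots> = (1 + 2 / (1 - q)) * \<xi> * q ^ m" by (simp add: algebra_simps)
    also have "\<dots> \<le> (1 + 2 / (1 - q)) * \<xi> * ((2 / T) powr \<eta> * (t - s) powr \<eta>)"
      using \<xi> q01 by (intro mult_left_mono qm) auto
    finally show ?thesis using st by (simp add: mult_ac)
  qed
  show ?thesis
    using main[OF st] main[OF st(2,1)] by (cases s t rule: linorder_cases) (auto simp: abs_minus_commute)
qed

text \<open>Kolmogorov's continuity argument in quantitative form. The \<open>m\<close>-th power of the Hoelder constant is
  dominated by the sum of the \<open>m\<close>-th powers of all weighted dyadic increments. The expectation of the
  \<open>2 ^ n\<close> terms of level \<open>n\<close> is of order \<open>2 powr (n * (1 + \<eta> * m - m / 2))\<close>, a convergent geometric series.\<close>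

lemma (in prob_space) hoelder_modulus_moment:
  fixes Y :: "real \<Rightarrow> 'a \<Rightarrow> real"
  assumes T: "T > 0" and \<eta>: "\<eta> > 0" and m: "m > 0" "\<eta> * real m + 1 < real m / 2"
    and Ym: "\<And>t. t \<in> {0..T} \<Longrightarrow> Y t \<in> borel_measurable M" and cont: "continuous_paths M T Y"
    and c: "c \<ge> 0" and mom: "\<And>s t. 0 \<le> s \<Longrightarrow> s < t \<Longrightarrow> t \<le> T \<Longrightarrow>
      (\<integral>\<^sup>+\<omega>. ennreal (\<bar>Y t \<omega> - Y s \<omega>\<bar> ^ m) \<partial>M) \<le> ennreal (c * (t - s) powr (m / 2))"
  obtains \<xi> :: "'a \<Rightarrow> real" where "\<xi> \<in> borel_measurable M" "\<And>\<omega>. \<xi> \<omega> \<ge> 0"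
    "(\<integral>\<^sup>+\<omega>. ennreal (\<xi> \<omega> ^ m) \<partial>M) < \<infinity>"
    "AE \<omega> in M. \<forall>s\<in>{0..T}. \<forall>t\<in>{0..T}. \<bar>Y t \<omega> - Y s \<omega>\<bar> \<le> \<xi> \<omega> * \<bar>t - s\<bar> powr \<eta>"
proof -
  define q where "q = (2::real) powr (-\<eta>)"
  have q01: "0 < q" "q < 1" using \<eta> by (auto simp: q_def powr_less_one)
  define \<Delta> where "\<Delta> n k \<omega> = \<bar>Y (T * real (Suc k) / 2 ^ n) \<omega> - Y (T * real k / 2 ^ n) \<omega>\<bar>" for n k :: nat and \<omega>
  define S where "S \<omega> = (\<Sum>n. \<Sum>k<2^n. ennreal ((\<Delta> n k \<omega> / q ^ n) ^ m))" for \<omega>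
  have dy: "T * real k / 2 ^ n \<in> {0..T}" if "k \<le> 2 ^ n" for n k :: nat
  proof -
    have "real k \<le> real (2 ^ n)" using that by (simp only: of_nat_le_iff)
    then show ?thesis using T by (auto simp: field_simps)
  qed
  have \<Delta>m[measurable]: "\<Delta> n k \<in> borel_measurable M" if "k < 2 ^ n" for n k
  proof -
    have [measurable]: "Y (T * real (Suc k) / 2 ^ n) \<in> borel_measurable M" "Y (T * real k / 2 ^ n) \<in> borel_measurable M"
      using that by (auto intro!: Ym dy simp del: of_nat_Suc)
    show ?thesis unfolding \<Delta>_def by measurable
  qed
  have Sm[measurable]: "S \<in> borel_measurable M"
    unfolding S_def by (intro borel_measurable_suminf_order borel_measurable_sum) (use \<Delta>m in measurable)
  \<comment> \<open>The ratio of the geometric series; \<open>\<rho> < 1\<close> is the assumption relating \<open>m\<close> and \<open>\<eta>\<close>.\<close>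
  define \<rho> where "\<rho> = 2 powr (1 + \<eta> * real m - real m / 2)"
  have \<rho>: "0 < \<rho>" "\<rho> < 1" using m by (auto simp: \<rho>_def powr_less_one)
  have level: "(\<integral>\<^sup>+\<omega>. (\<Sum>k<2^n. ennreal ((\<Delta> n k \<omega> / q ^ n) ^ m)) \<partial>M) \<le> ennreal (c * T powr (m / 2) * \<rho> ^ n)" for n
  proof -
    have one: "(\<integral>\<^sup>+\<omega>. ennreal ((\<Delta> n k \<omega> / q ^ n) ^ m) \<partial>M) \<le> ennreal (c * (T / 2 ^ n) powr (m / 2) / (q ^ n) ^ m)"
      if k: "k < 2 ^ n" for k
    proof -
      have [measurable]: "\<Delta> n k \<in> borel_measurable M" using k by (rule \<Delta>m)
      have gap: "T * real (Suc k) / 2 ^ n - T * real k / 2 ^ n = T / 2 ^ n" by (simp add: field_simps)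
      have "(\<integral>\<^sup>+\<omega>. ennreal ((\<Delta> n k \<omega> / q ^ n) ^ m) \<partial>M) = (\<integral>\<^sup>+\<omega>. ennreal (1 / (q ^ n) ^ m) * ennreal (\<Delta> n k \<omega> ^ m) \<partial>M)"
        using q01 by (intro nn_integral_cong) (simp add: power_divide \<Delta>_def flip: ennreal_mult)
      also have "\<dots> = ennreal (1 / (q ^ n) ^ m) * (\<integral>\<^sup>+\<omega>. ennreal (\<Delta> n k \<omega> ^ m) \<partial>M)"
        by (rule nn_integral_cmult) measurable
      also have "\<dots> \<le> ennreal (1 / (q ^ n) ^ m) * ennreal (c * (T / 2 ^ n) powr (m / 2))"
        unfolding \<Delta>_def gap[symmetric]
        by (intro mult_left_mono mom) (use dy[of "Suc k" n] dy[of k n] k T in \<open>auto simp: divide_strict_right_mono\<close>)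
      finally show ?thesis using q01 c by (simp flip: ennreal_mult)
    qed
    have "(\<integral>\<^sup>+\<omega>. (\<Sum>k<2^n. ennreal ((\<Delta> n k \<omega> / q ^ n) ^ m)) \<partial>M)
        = (\<Sum>k<2^n. \<integral>\<^sup>+\<omega>. ennreal ((\<Delta> n k \<omega> / q ^ n) ^ m) \<partial>M)"
      by (rule nn_integral_sum) (use \<Delta>m in measurable)
    also have "\<dots> \<le> (\<Sum>k<(2::nat)^n. ennreal (c * (T / 2 ^ n) powr (m / 2) / (q ^ n) ^ m))"
      by (intro sum_mono one) auto
    also have "\<dots> = ennreal (2 ^ n * (c * (T / 2 ^ n) powr (m / 2) / (q ^ n) ^ m))"
      by (subst sum_ennreal) (use c q01 in \<open>simp_all add: divide_simps del: sum_constant\<close>, simp)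
    also have "2 ^ n * (c * (T / 2 ^ n) powr (m / 2) / (q ^ n) ^ m) = c * T powr (m / 2) * \<rho> ^ n"
    proof -
      have "\<rho> ^ n = 2 powr (real n + \<eta> * real m * real n - real m / 2 * real n)"
        by (simp add: \<rho>_def powr_power algebra_simps)
      also have "\<dots> = 2 ^ n * 2 powr (\<eta> * real m * real n) / 2 powr (real n * (real m / 2))"
        by (simp add: powr_diff powr_add powr_realpow mult_ac)
      also have "2 powr (\<eta> * real m * real n) = 1 / (q ^ n) ^ m"
      proof -
        have "(q ^ n) ^ m = q powr real (n * m)" using q01 by (simp only: powr_realpow power_mult)
        also have "\<dots> = 2 powr (- (\<eta> * real m * real n))" by (simp add: q_def powr_powr mult_ac)
        finally show ?thesis by (simp add: powr_minus inverse_eq_divide)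
      qed
      also have "2 powr (real n * (real m / 2)) = (2 ^ n) powr (real m / 2)"
        by (simp add: powr_powr flip: powr_realpow)
      finally show ?thesis using T by (simp add: powr_divide mult_ac)
    qed
    finally show ?thesis .
  qed
  have "(\<integral>\<^sup>+\<omega>. S \<omega> \<partial>M) = (\<Sum>n. \<integral>\<^sup>+\<omega>. (\<Sum>k<2^n. ennreal ((\<Delta> n k \<omega> / q ^ n) ^ m)) \<partial>M)"
    unfolding S_def by (rule nn_integral_suminf) (use \<Delta>m in measurable)
  also have "\<dots> \<le> (\<Sum>n. ennreal (c * T powr (m / 2) * \<rho> ^ n))"
    by (intro suminf_le level) auto
  also have "\<dots> = ennreal (\<Sum>n. c * T powr (m / 2) * \<rho> ^ n)"
    by (rule suminf_ennreal2) (use c \<rho> in \<open>auto intro!: summable_mult summable_geometric\<close>)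
  finally have S_fin: "(\<integral>\<^sup>+\<omega>. S \<omega> \<partial>M) < \<infinity>" using le_less_trans by fastforce
  then have S_AE: "AE \<omega> in M. S \<omega> \<noteq> \<infinity>" by (intro nn_integral_PInf_AE) auto
  define C where "C = (1 + 2 / (1 - q)) * (2 / T) powr \<eta>"
  have C: "C \<ge> 0" using q01 by (simp add: C_def)
  define \<xi> where "\<xi> \<omega> = C * enn2real (S \<omega>) powr (1 / m)" for \<omega>
  have \<xi>m: "\<xi> \<omega> ^ m = C ^ m * enn2real (S \<omega>)" for \<omega>
    using m(1) by (cases "enn2real (S \<omega>) = 0")
      (auto simp: \<xi>_def power_mult_distrib powr_powr simp flip: powr_realpow)
  show thesis
  proof (rule that)
    show "\<xi> \<in> borel_measurable M" unfolding \<xi>_def by measurable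
    show "\<xi> \<omega> \<ge> 0" for \<omega> using C by (simp add: \<xi>_def)
    have "(\<integral>\<^sup>+\<omega>. ennreal (\<xi> \<omega> ^ m) \<partial>M) \<le> (\<integral>\<^sup>+\<omega>. ennreal (C ^ m) * S \<omega> \<partial>M)"
    proof (intro nn_integral_mono)
      fix \<omega>
      show "ennreal (\<xi> \<omega> ^ m) \<le> ennreal (C ^ m) * S \<omega>"
        using C unfolding \<xi>m by (cases "S \<omega>") (auto simp: ennreal_mult ennreal_mult_top)
    qed
    also have "\<dots> = ennreal (C ^ m) * (\<integral>\<^sup>+\<omega>. S \<omega> \<partial>M)" by (rule nn_integral_cmult) measurable
    also have "\<dots> < \<infinity>" using S_fin by (simp add: ennreal_mult_less_top)
    finally show "(\<integral>\<^sup>+\<omega>. ennreal (\<xi> \<omega> ^ m) \<partial>M) < \<infinity>" .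
    show "AE \<omega> in M. \<forall>s\<in>{0..T}. \<forall>t\<in>{0..T}. \<bar>Y t \<omega> - Y s \<omega>\<bar> \<le> \<xi> \<omega> * \<bar>t - s\<bar> powr \<eta>"
      using S_AE cont[unfolded continuous_paths_def]
    proof eventually_elim
      case (elim \<omega>)
      define \<zeta> where "\<zeta> = enn2real (S \<omega>) powr (1 / m)"
      have "\<bar>Y (T * real (Suc k) / 2 ^ n) \<omega> - Y (T * real k / 2 ^ n) \<omega>\<bar> \<le> \<zeta> * q ^ n"
        if k: "k < 2 ^ n" for n k
      proof -
        have "ennreal ((\<Delta> n k \<omega> / q ^ n) ^ m) \<le> (\<Sum>k<2^n. ennreal ((\<Delta> n k \<omega> / q ^ n) ^ m))"
          by (rule member_le_sum) (use k in auto)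
        also have "\<dots> \<le> S \<omega>" unfolding S_def
          using sum_le_suminf[of "\<lambda>n. \<Sum>k<2^n. ennreal ((\<Delta> n k \<omega> / q ^ n) ^ m)" "{n}"] by auto
        finally have "(\<Delta> n k \<omega> / q ^ n) ^ m \<le> enn2real (S \<omega>)"
          using elim(1) q01 by (cases "S \<omega>") (auto simp: \<Delta>_def)
        also have "\<dots> = \<zeta> ^ m"
          using m(1) by (cases "enn2real (S \<omega>) = 0") (auto simp: \<zeta>_def powr_powr simp flip: powr_realpow)
        finally have "(\<Delta> n k \<omega> / q ^ n) ^ Suc (m - 1) \<le> \<zeta> ^ Suc (m - 1)" using m(1) by simp
        then have "\<Delta> n k \<omega> / q ^ n \<le> \<zeta>"
          by (rule power_le_imp_le_base) (simp add: \<zeta>_def)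
        then show ?thesis using q01 by (simp add: \<Delta>_def field_simps)
      qed
      then show ?case
        using hoelder_from_dyadic_increments[OF T \<eta> _ elim(2) q_def, of \<zeta>]
        by (simp add: \<xi>_def C_def \<zeta>_def mult_ac)
    qed
  qed
qed

section \<open>Singular integrals\<close>

text \<open>For a function that is not measurable, \<^const>\<open>nn_integral\<close> is a lower integral. It remains
  subadditive when one summand is measurable. This applies to functionals such as
  \<open>\<omega> \<mapsto> pnorm_zero \<alpha> T (\<lambda>t. Z t \<omega>)\<close>, a supremum over an uncountable set.\<close>

lemma nn_integral_add_le:
  assumes g: "g \<in> borel_measurable M"
  shows "(\<integral>\<^sup>+x. f x + g x \<partial>M) \<le> (\<integral>\<^sup>+x. f x \<partial>M) + (\<integral>\<^sup>+x. g x \<partial>M)"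
  unfolding nn_integral_def[of M "\<lambda>x. f x + g x"]
proof (rule SUP_least)
  fix h assume "h \<in> {h. simple_function M h \<and> h \<le> (\<lambda>x. f x + g x)}"
  then have h: "simple_function M h" "\<And>x. h x \<le> f x + g x" by (auto simp: le_fun_def)
  \<comment> \<open>The part of \<open>h\<close> not covered by \<open>g\<close> is measurable and below \<open>f\<close>; where \<open>g\<close> is infinite there is none.\<close>
  define k where "k x = (if g x = \<infinity> then 0 else h x - g x)" for x
  have [measurable]: "h \<in> borel_measurable M" "g \<in> borel_measurable M"
    using h g by (auto intro: borel_measurable_simple_function)
  have km: "k \<in> borel_measurable M" unfolding k_def by measurable
  have kf: "k x \<le> f x" for x
    using h(2)[of x] by (auto simp: k_def ennreal_minus_le_iff add.commute top_unique)
  have hk: "h x \<le> k x + g x" for x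
  proof (cases "g x = \<infinity> \<or> h x \<le> g x")
    case False
    then have "g x + (h x - g x) = h x" by (intro add_diff_inverse_ennreal) auto
    then show ?thesis using False by (metis add.commute k_def order_refl)
  qed (auto intro: add_increasing)
  have "integral\<^sup>S M h = (\<integral>\<^sup>+x. h x \<partial>M)" using h(1) by (simp add: nn_integral_eq_simple_integral)
  also have "\<dots> \<le> (\<integral>\<^sup>+x. k x + g x \<partial>M)" by (intro nn_integral_mono hk)
  also have "\<dots> = (\<integral>\<^sup>+x. k x \<partial>M) + (\<integral>\<^sup>+x. g x \<partial>M)" by (rule nn_integral_add[OF km g])
  also have "\<dots> \<le> (\<integral>\<^sup>+x. f x \<partial>M) + (\<integral>\<^sup>+x. g x \<partial>M)"
    by (intro add_mono nn_integral_mono kf order_refl)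
  finally show "integral\<^sup>S M h \<le> (\<integral>\<^sup>+x. f x \<partial>M) + (\<integral>\<^sup>+x. g x \<partial>M)" .
qed

lemma norm_integral_le_nn_integral:
  fixes f :: "'b \<Rightarrow> 'c :: {banach, second_countable_topology}"
  shows "ennreal (norm (integral\<^sup>L M f)) \<le> (\<integral>\<^sup>+x. ennreal (norm (f x)) \<partial>M)"
  by (cases "integrable M f") (simp_all add: integral_norm_bound_ennreal not_integrable_integral_eq)

lemma norm_set_integral_le_nn_integral:
  fixes f :: "'b \<Rightarrow> 'c :: {banach, second_countable_topology}"
  shows "ennreal (norm (LINT x:A|M. f x)) \<le> (\<integral>\<^sup>+x\<in>A. ennreal (norm (f x)) \<partial>M)"
proof -
  have "(\<integral>\<^sup>+x. ennreal (norm (indicator A x *\<^sub>R f x)) \<partial>M) = (\<integral>\<^sup>+x\<in>A. ennreal (norm (f x)) \<partial>M)"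
    by (intro nn_integral_cong) (auto simp: indicator_def)
  then show ?thesis
    using norm_integral_le_nn_integral[of M "\<lambda>x. indicator A x *\<^sub>R f x"] by (simp add: set_lebesgue_integral_def)
qed

lemma nn_integral_Icc_eq_Ioo:
  "(\<integral>\<^sup>+x\<in>{a..b}. f x \<partial>lborel) = (\<integral>\<^sup>+x\<in>{a<..<b::real}. f x \<partial>lborel)"
proof (rule nn_integral_cong_AE)
  show "AE x in lborel. f x * indicator {a..b} x = f x * indicator {a<..<b} x"
    using AE_lborel_singleton[of a] AE_lborel_singleton[of b]
    by eventually_elim (auto simp: indicator_def)
qed

lemma nn_integral_reflect:
  fixes f :: "real \<Rightarrow> ennreal"
  assumes [measurable]: "f \<in> borel_measurable borel"
  shows "(\<integral>\<^sup>+s\<in>{a<..<b}. f (t - s) \<partial>lborel) = (\<integral>\<^sup>+u\<in>{t - b<..<t - a}. f u \<partial>lborel)"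
proof -
  have "(\<integral>\<^sup>+u\<in>{t - b<..<t - a}. f u \<partial>lborel)
      = ennreal \<bar>-1\<bar> * (\<integral>\<^sup>+s. f (t + (-1) * s) * indicator {t - b<..<t - a} (t + (-1) * s) \<partial>lborel)"
    by (rule nn_integral_real_affine) auto
  also have "\<dots> = (\<integral>\<^sup>+s\<in>{a<..<b}. f (t - s) \<partial>lborel)"
    by (simp, intro nn_integral_cong) (auto simp: indicator_def)
  finally show ?thesis by simp
qed

lemma nn_integral_powr_Ioo_0:
  assumes "p > -1" "b \<ge> 0"
  shows "(\<integral>\<^sup>+u\<in>{0<..<b}. ennreal (u powr p) \<partial>lborel) = ennreal (b powr (p + 1) / (p + 1))"
proof -
  have "(\<integral>\<^sup>+u\<in>{0..b}. ennreal (u powr p) \<partial>lborel) = (\<integral>\<^sup>+u. ennreal (indicator {0..b} u * u powr p) \<partial>lborel)"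
    by (intro nn_integral_cong) (auto simp: indicator_def)
  also have "\<dots> = ennreal (b powr (p + 1) / (p + 1))"
    by (rule nn_integral_has_integral_lebesgue[OF _ has_integral_powr_from_0[OF assms]]) auto
  finally show ?thesis by (simp add: nn_integral_Icc_eq_Ioo)
qed

lemma nn_integral_powr_Ioo_end:
  assumes "p > -1" "a \<le> b"
  shows "(\<integral>\<^sup>+s\<in>{a<..<b}. ennreal ((b - s) powr p) \<partial>lborel) = ennreal ((b - a) powr (p + 1) / (p + 1))"
  using nn_integral_reflect[of "\<lambda>u. ennreal (u powr p)" b a b] nn_integral_powr_Ioo_0[of p "b - a"] assms by simp

lemma nn_integral_powr_tail:
  assumes "p < -1" "0 < x" "x < t"
  shows "(\<integral>\<^sup>+s\<in>{0<..<x}. ennreal ((t - s) powr p) \<partial>lborel) \<le> ennreal (- ((t - x) powr (p + 1)) / (p + 1))"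
proof -
  have "(\<integral>\<^sup>+s\<in>{0<..<x}. ennreal ((t - s) powr p) \<partial>lborel) = (\<integral>\<^sup>+u\<in>{t - x<..<t}. ennreal (u powr p) \<partial>lborel)"
    using nn_integral_reflect[of "\<lambda>u. ennreal (u powr p)" t 0 x] by simp
  also have "\<dots> \<le> (\<integral>\<^sup>+u. ennreal (indicator {t - x..} u * u powr p) \<partial>lborel)"
    by (intro nn_integral_mono) (auto simp: indicator_def)
  also have "\<dots> = ennreal (-((t - x) powr (p + 1)) / (p + 1))"
    by (rule nn_integral_has_integral_lebesgue[OF _ has_integral_powr_to_inf]) (use assms in auto)
  finally show ?thesis by simp
qed

text \<open>The integral over the whole half-line is Euler's integral after the substitution \<open>v = l * u\<close>.\<close>

lemma nn_integral_exp_powr_le: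
  assumes lam: "l > 0" and r: "r < 1"
  shows "(\<integral>\<^sup>+u\<in>{0<..<t}. ennreal (exp (- l * u) * u powr (- r)) \<partial>lborel) \<le> ennreal (Gamma (1 - r) * l powr (r - 1))"
proof -
  let ?f = "\<lambda>v. ennreal (indicator {0..} v * v powr (- r) / exp v)"
  have "ennreal (Gamma (1 - r)) = (\<integral>\<^sup>+v. ?f v \<partial>lborel)"
    using Gamma_conv_nn_integral_real[of "1 - r"] r by simp
  also have "\<dots> = ennreal \<bar>l\<bar> * (\<integral>\<^sup>+u. ?f (0 + l * u) \<partial>lborel)"
    by (rule nn_integral_real_affine) (use lam in auto)
  also have "\<dots> \<ge> ennreal \<bar>l\<bar> * (\<integral>\<^sup>+u\<in>{0<..<t}. ennreal (l powr (- r)) * ennreal (exp (- l * u) * u powr (- r)) \<partial>lborel)"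
    by (intro mult_left_mono nn_integral_mono)
       (use lam in \<open>auto simp: indicator_def powr_mult exp_minus divide_inverse mult_ac simp flip: ennreal_mult\<close>)
  finally have "ennreal l * (\<integral>\<^sup>+u\<in>{0<..<t}. ennreal (l powr (- r)) * ennreal (exp (- l * u) * u powr (- r)) \<partial>lborel)
      \<le> ennreal (Gamma (1 - r))" using lam by simp
  moreover have "(\<integral>\<^sup>+u\<in>{0<..<t}. ennreal (l powr (- r)) * ennreal (exp (- l * u) * u powr (- r)) \<partial>lborel)
      = ennreal (l powr (- r)) * (\<integral>\<^sup>+u\<in>{0<..<t}. ennreal (exp (- l * u) * u powr (- r)) \<partial>lborel)"
    by (subst nn_integral_cmult[symmetric]) (auto simp: mult.assoc)
  ultimately have le: "ennreal (l powr (1 - r)) * (\<integral>\<^sup>+u\<in>{0<..<t}. ennreal (exp (- l * u) * u powr (- r)) \<partial>lborel)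
      \<le> ennreal (Gamma (1 - r))"
    using lam by (simp add: powr_diff powr_minus divide_inverse ennreal_mult mult.assoc)
  have "(\<integral>\<^sup>+u\<in>{0<..<t}. ennreal (exp (- l * u) * u powr (- r)) \<partial>lborel)
      = ennreal (l powr (r - 1)) * (ennreal (l powr (1 - r)) * (\<integral>\<^sup>+u\<in>{0<..<t}. ennreal (exp (- l * u) * u powr (- r)) \<partial>lborel))"
    using lam by (simp add: mult.assoc[symmetric] flip: ennreal_mult powr_add)
  also have "\<dots> \<le> ennreal (l powr (r - 1)) * ennreal (Gamma (1 - r))"
    by (intro mult_left_mono le) auto
  finally show ?thesis using r by (simp add: ennreal_mult Gamma_real_pos less_imp_le mult.commute)
qed

text \<open>The weight \<open>exp (l * x)\<close> turns the two singularities into a gain of \<open>l powr (2 * \<alpha> - 1)\<close>. The product of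
  the two powers is at most the larger one squared, so each half of the interval reduces to one singularity
  of order \<open>2 * \<alpha>\<close>, integrable since \<open>\<alpha> < 1/2\<close>.\<close>

lemma nn_integral_exp_beta_le:
  fixes \<alpha> l t :: real
  assumes \<alpha>: "0 < \<alpha>" "\<alpha> < 1/2" and l: "l > 0"
  shows "(\<integral>\<^sup>+x\<in>{0<..<t}. ennreal (exp (l * x) * x powr (- \<alpha>) * (t - x) powr (- \<alpha>)) \<partial>lborel)
    \<le> ennreal (2 * Gamma (1 - 2 * \<alpha>) * l powr (2 * \<alpha> - 1) * exp (l * t))"
proof -
  let ?g = "\<lambda>u. ennreal (exp (- l * u) * u powr (- (2 * \<alpha>)))"
  have pw: "exp (l * x) * x powr (- \<alpha>) * (t - x) powr (- \<alpha>)
      \<le> exp (l * t) * (exp (- l * (t - x)) * (t - x) powr (- (2 * \<alpha>)) + exp (- l * x) * x powr (- (2 * \<alpha>)))"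
    if x: "0 < x" "x < t" for x
  proof -
    have sq: "y powr (- (2 * \<alpha>)) = y powr (- \<alpha>) * y powr (- \<alpha>)" for y :: real
      by (simp flip: powr_add)
    show ?thesis
    proof (cases "t - x \<le> x")
      case True
      then have "x powr (- \<alpha>) \<le> (t - x) powr (- \<alpha>)" using x \<alpha> by (intro powr_mono2') auto
      then have "exp (l * x) * x powr (- \<alpha>) * (t - x) powr (- \<alpha>) \<le> exp (l * x) * (t - x) powr (- (2 * \<alpha>))"
        unfolding sq mult.assoc by (intro mult_left_mono mult_right_mono) auto
      also have "\<dots> = exp (l * t) * (exp (- l * (t - x)) * (t - x) powr (- (2 * \<alpha>)))"
        by (simp add: mult.assoc[symmetric] algebra_simps flip: exp_add)
      finally show ?thesis by (simp add: distrib_left add_increasing2)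
    next
      case False
      then have "(t - x) powr (- \<alpha>) \<le> x powr (- \<alpha>)" using x \<alpha> by (intro powr_mono2') auto
      moreover have "l * x \<le> l * t + - l * x"
        using False l mult_left_mono[of "2 * x" t l] by (simp add: algebra_simps)
      then have "exp (l * x) \<le> exp (l * t) * exp (- l * x)" by (simp flip: exp_add)
      ultimately have "exp (l * x) * (x powr (- \<alpha>) * (t - x) powr (- \<alpha>))
          \<le> (exp (l * t) * exp (- l * x)) * x powr (- (2 * \<alpha>))"
        unfolding sq by (intro mult_mono) auto
      also have "\<dots> = exp (l * t) * (exp (- l * x) * x powr (- (2 * \<alpha>)))" by (simp only: mult.assoc)
      also have "\<dots> \<le> exp (l * t) * (exp (- l * (t - x)) * (t - x) powr (- (2 * \<alpha>)) + exp (- l * x) * x powr (- (2 * \<alpha>)))"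
        by (intro mult_left_mono) auto
      finally show ?thesis by (simp only: mult.assoc)
    qed
  qed
  have "(\<integral>\<^sup>+x\<in>{0<..<t}. ennreal (exp (l * x) * x powr (- \<alpha>) * (t - x) powr (- \<alpha>)) \<partial>lborel)
     \<le> (\<integral>\<^sup>+x. ennreal (exp (l * t)) * (?g (t - x) * indicator {0<..<t} x + ?g x * indicator {0<..<t} x) \<partial>lborel)"
    by (intro nn_integral_mono)
       (use pw in \<open>auto simp: indicator_def intro!: ennreal_leI simp flip: ennreal_mult ennreal_plus\<close>)
  also have "\<dots> = ennreal (exp (l * t)) * ((\<integral>\<^sup>+x\<in>{0<..<t}. ?g (t - x) \<partial>lborel) + (\<integral>\<^sup>+x\<in>{0<..<t}. ?g x \<partial>lborel))"
    by (subst nn_integral_cmult, simp, subst nn_integral_add) auto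
  also have "(\<integral>\<^sup>+x\<in>{0<..<t}. ?g (t - x) \<partial>lborel) = (\<integral>\<^sup>+x\<in>{0<..<t}. ?g x \<partial>lborel)"
    using nn_integral_reflect[of ?g t 0 t] by simp
  also have "ennreal (exp (l * t)) * ((\<integral>\<^sup>+x\<in>{0<..<t}. ?g x \<partial>lborel) + (\<integral>\<^sup>+x\<in>{0<..<t}. ?g x \<partial>lborel))
      \<le> ennreal (exp (l * t)) * (ennreal (Gamma (1 - 2 * \<alpha>) * l powr (2 * \<alpha> - 1)) + ennreal (Gamma (1 - 2 * \<alpha>) * l powr (2 * \<alpha> - 1)))"
    by (intro mult_left_mono add_mono nn_integral_exp_powr_le) (use \<alpha> l in auto)
  also have "\<dots> = ennreal (2 * Gamma (1 - 2 * \<alpha>) * l powr (2 * \<alpha> - 1) * exp (l * t))"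
    using \<alpha> by (simp add: Gamma_real_pos less_imp_le mult_ac flip: ennreal_mult ennreal_plus)
  finally show ?thesis .
qed

text \<open>Up to the factor \<open>A / Gamma \<alpha>\<close>, this kernel bounds the change of the right-sided derivative at \<open>x\<close> when
  the right end point moves from \<open>s\<close> to \<open>t\<close>; for \<open>x \<ge> s\<close> the derivative with end point \<open>s\<close> is absent.\<close>

definition inc_kernel :: "real \<Rightarrow> real \<Rightarrow> real \<Rightarrow> real \<Rightarrow> real" where
  "inc_kernel \<alpha> t s x = (if x < s then ((t - s) / (t - x)) powr (1 - \<alpha>) else 1)"

lemma inc_kernel_measurable [measurable]:
  "(\<lambda>(s, x). inc_kernel \<alpha> t s x) \<in> borel_measurable (borel \<Otimes>\<^sub>M borel)"
  "inc_kernel \<alpha> t s \<in> borel_measurable borel"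
  "(\<lambda>s. inc_kernel \<alpha> t s x) \<in> borel_measurable borel"
  unfolding inc_kernel_def by measurable

lemma inc_kernel_nonneg [simp]: "inc_kernel \<alpha> t s x \<ge> 0"
  by (simp add: inc_kernel_def)

text \<open>Splitting at \<open>s = x\<close>. Above \<open>x\<close> the integrand is \<open>(t - x) powr (\<alpha> - 1) * (t - s) powr (- 2 * \<alpha>)\<close>, below it is
  \<open>(t - s) powr (- 1 - \<alpha>)\<close>; both integrals are multiples of \<open>(t - x) powr (- \<alpha>)\<close>.\<close>

lemma inc_kernel_integral_le:
  assumes \<alpha>: "0 < \<alpha>" "\<alpha> < 1/2" and x: "0 < x" "x < t"
  shows "(\<integral>\<^sup>+s\<in>{0<..<t}. ennreal (inc_kernel \<alpha> t s x * (t - s) powr (- 1 - \<alpha>)) \<partial>lborel)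
    \<le> ennreal ((1 / (1 - 2 * \<alpha>) + 1 / \<alpha>) * (t - x) powr (- \<alpha>))"
proof -
  have "(\<integral>\<^sup>+s\<in>{0<..<t}. ennreal (inc_kernel \<alpha> t s x * (t - s) powr (- 1 - \<alpha>)) \<partial>lborel)
    \<le> (\<integral>\<^sup>+s. (ennreal ((t - x) powr (\<alpha> - 1)) * (ennreal ((t - s) powr (- 2 * \<alpha>)) * indicator {x<..<t} s))
        + ennreal ((t - s) powr (- 1 - \<alpha>)) * indicator {0<..<x} s \<partial>lborel)"
  proof (rule nn_integral_mono_AE)
    show "AE s in lborel. ennreal (inc_kernel \<alpha> t s x * (t - s) powr (- 1 - \<alpha>)) * indicator {0<..<t} s
      \<le> (ennreal ((t - x) powr (\<alpha> - 1)) * (ennreal ((t - s) powr (- 2 * \<alpha>)) * indicator {x<..<t} s))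
        + ennreal ((t - s) powr (- 1 - \<alpha>)) * indicator {0<..<x} s"
      using AE_lborel_singleton[of x]
    proof eventually_elim
      case (elim s)
      have "((t - s) / (t - x)) powr (1 - \<alpha>) * (t - s) powr (- 1 - \<alpha>) = (t - x) powr (\<alpha> - 1) * (t - s) powr (- 2 * \<alpha>)"
        if "x < s" "s < t"
      proof -
        have "(t - s) powr (1 - \<alpha>) * (t - s) powr (- 1 - \<alpha>) = (t - s) powr (- 2 * \<alpha>)"
          using that by (simp flip: powr_add)
        moreover have "(t - x) powr (\<alpha> - 1) = 1 / (t - x) powr (1 - \<alpha>)"
          by (metis minus_diff_eq powr_minus_divide)
        ultimately show ?thesis using that by (simp add: powr_divide)
      qed
      then show ?case using elim x
        by (auto simp: indicator_def inc_kernel_def simp flip: ennreal_mult)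
    qed
  qed
  also have "\<dots> = ennreal ((t - x) powr (\<alpha> - 1)) * (\<integral>\<^sup>+s\<in>{x<..<t}. ennreal ((t - s) powr (- 2 * \<alpha>)) \<partial>lborel)
      + (\<integral>\<^sup>+s\<in>{0<..<x}. ennreal ((t - s) powr (- 1 - \<alpha>)) \<partial>lborel)"
    by (subst nn_integral_add, simp, simp, subst nn_integral_cmult) auto
  also have "\<dots> \<le> ennreal ((t - x) powr (\<alpha> - 1)) * ennreal ((t - x) powr (- 2 * \<alpha> + 1) / (- 2 * \<alpha> + 1))
      + ennreal (- ((t - x) powr (- 1 - \<alpha> + 1)) / (- 1 - \<alpha> + 1))"
    using nn_integral_powr_Ioo_end[of "- 2 * \<alpha>" x t] nn_integral_powr_tail[of "- 1 - \<alpha>" x t] \<alpha> x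
    by (intro add_mono mult_left_mono) auto
  also have "\<dots> = ennreal ((1 / (1 - 2 * \<alpha>) + 1 / \<alpha>) * (t - x) powr (- \<alpha>))"
  proof -
    have "(t - x) powr (\<alpha> - 1) * ((t - x) powr (- 2 * \<alpha> + 1) / (- 2 * \<alpha> + 1)) = 1 / (1 - 2 * \<alpha>) * (t - x) powr (- \<alpha>)"
      by (simp flip: powr_add)
    then show ?thesis using \<alpha>
      by (simp add: distrib_right flip: ennreal_mult ennreal_plus)
  qed
  finally show ?thesis .
qed

lemma inc_kernel_fubini:
  fixes h :: "real \<Rightarrow> real"
  assumes \<alpha>: "0 < \<alpha>" "\<alpha> < 1/2" and h[measurable]: "h \<in> borel_measurable borel" "\<And>x. h x \<ge> 0"
  shows "(\<integral>\<^sup>+s\<in>{0<..<t}. (\<integral>\<^sup>+x\<in>{0<..<t}. ennreal (h x * inc_kernel \<alpha> t s x) \<partial>lborel) * ennreal ((t - s) powr (- 1 - \<alpha>)) \<partial>lborel)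
    \<le> ennreal (1 / (1 - 2 * \<alpha>) + 1 / \<alpha>) * (\<integral>\<^sup>+x\<in>{0<..<t}. ennreal (h x * (t - x) powr (- \<alpha>)) \<partial>lborel)"
proof -
  let ?\<kappa> = "1 / (1 - 2 * \<alpha>) + 1 / \<alpha>"
  let ?F = "\<lambda>s x. ennreal (h x) * indicator {0<..<t} x * (ennreal (inc_kernel \<alpha> t s x * (t - s) powr (- 1 - \<alpha>)) * indicator {0<..<t} s)"
  have Fm: "case_prod ?F \<in> borel_measurable (lborel \<Otimes>\<^sub>M lborel)" by measurable
  have "(\<integral>\<^sup>+s\<in>{0<..<t}. (\<integral>\<^sup>+x\<in>{0<..<t}. ennreal (h x * inc_kernel \<alpha> t s x) \<partial>lborel) * ennreal ((t - s) powr (- 1 - \<alpha>)) \<partial>lborel)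
     = (\<integral>\<^sup>+s. (\<integral>\<^sup>+x. ?F s x \<partial>lborel) \<partial>lborel)"
  proof (intro nn_integral_cong)
    fix s
    have "(\<integral>\<^sup>+x. ?F s x \<partial>lborel) = (\<integral>\<^sup>+x. (ennreal (h x * inc_kernel \<alpha> t s x) * indicator {0<..<t} x) * (ennreal ((t - s) powr (- 1 - \<alpha>)) * indicator {0<..<t} s) \<partial>lborel)"
      by (intro nn_integral_cong) (simp add: h ennreal_mult mult_ac)
    also have "\<dots> = (\<integral>\<^sup>+x\<in>{0<..<t}. ennreal (h x * inc_kernel \<alpha> t s x) \<partial>lborel) * (ennreal ((t - s) powr (- 1 - \<alpha>)) * indicator {0<..<t} s)"
      by (rule nn_integral_multc) measurable
    finally show "(\<integral>\<^sup>+x\<in>{0<..<t}. ennreal (h x * inc_kernel \<alpha> t s x) \<partial>lborel) * ennreal ((t - s) powr (- 1 - \<alpha>)) * indicator {0<..<t} s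
        = (\<integral>\<^sup>+x. ?F s x \<partial>lborel)"
      by (simp add: mult.assoc)
  qed
  also have "\<dots> = (\<integral>\<^sup>+x. (\<integral>\<^sup>+s. ?F s x \<partial>lborel) \<partial>lborel)"
    by (rule lborel_pair.Fubini'[symmetric]) (use Fm in measurable)
  also have "\<dots> \<le> (\<integral>\<^sup>+x. ennreal ?\<kappa> * (ennreal (h x * (t - x) powr (- \<alpha>)) * indicator {0<..<t} x) \<partial>lborel)"
  proof (intro nn_integral_mono)
    fix x
    have "(\<integral>\<^sup>+s. ?F s x \<partial>lborel) = ennreal (h x) * indicator {0<..<t} x *
        (\<integral>\<^sup>+s\<in>{0<..<t}. ennreal (inc_kernel \<alpha> t s x * (t - s) powr (- 1 - \<alpha>)) \<partial>lborel)"
      by (rule nn_integral_cmult) measurable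
    also have "\<dots> \<le> ennreal (h x) * indicator {0<..<t} x * ennreal (?\<kappa> * (t - x) powr (- \<alpha>))"
    proof (cases "x \<in> {0<..<t}")
      case True
      then show ?thesis by (intro mult_left_mono inc_kernel_integral_le) (use \<alpha> in auto)
    qed simp
    also have "\<dots> = ennreal ?\<kappa> * (ennreal (h x * (t - x) powr (- \<alpha>)) * indicator {0<..<t} x)"
      using \<alpha> h(2)[of x] by (simp add: ennreal_mult mult_ac del: ennreal_plus)
    finally show "(\<integral>\<^sup>+s. ?F s x \<partial>lborel) \<le> ennreal ?\<kappa> * (ennreal (h x * (t - x) powr (- \<alpha>)) * indicator {0<..<t} x)" .
  qed
  also have "\<dots> = ennreal ?\<kappa> * (\<integral>\<^sup>+x\<in>{0<..<t}. ennreal (h x * (t - x) powr (- \<alpha>)) \<partial>lborel)"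
    by (rule nn_integral_cmult) measurable
  finally show ?thesis .
qed

section \<open>Increments of the generalized Lebesgue--Stieltjes integral\<close>

text \<open>The real factor of the right-sided derivative; the remaining factor is a phase divided by \<open>Gamma \<alpha>\<close>.\<close>

definition weyl_right :: "real \<Rightarrow> real \<Rightarrow> (real \<Rightarrow> real) \<Rightarrow> real \<Rightarrow> real" where
  "weyl_right \<alpha> t z x = (z x - z t) / (t - x) powr (1 - \<alpha>)
     + (1 - \<alpha>) * (LBINT y:{x<..<t}. (z x - z y) / (y - x) powr (2 - \<alpha>))"

lemma frac_deriv_right_eq:
  "frac_deriv_right \<alpha> t (\<lambda>x. z x - z t) x
    = exp (- \<i> * of_real (pi * \<alpha>)) / of_real (Gamma \<alpha>) * of_real (weyl_right \<alpha> t z x)"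
  by (simp add: frac_deriv_right_def weyl_right_def)

text \<open>Needed because \<^const>\<open>pnorm_zero\<close> only sees intervals \<open>[u, v]\<close> with \<open>v < T\<close>; monotone convergence along
  \<open>v \<rightarrow> T\<close> covers \<open>v = T\<close>.\<close>

lemma nn_integral_Ioo_left_limit_le:
  fixes f :: "real \<Rightarrow> ennreal"
  assumes [measurable]: "(\<lambda>y. f y * indicator {u<..<T} y) \<in> borel_measurable borel" and u: "u < T"
    and g: "(g \<longlongrightarrow> L) (at_left T)"
    and le: "\<And>v. u < v \<Longrightarrow> v < T \<Longrightarrow> ennreal (g v) + (\<integral>\<^sup>+y\<in>{u<..<v}. f y \<partial>lborel) \<le> C"
  shows "ennreal L + (\<integral>\<^sup>+y\<in>{u<..<T}. f y \<partial>lborel) \<le> C"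
proof -
  define v where "v n = T - (T - u) * inverse (real (Suc (Suc n)))" for n
  have v: "u < v n" "v n < T" for n
  proof -
    have "(T - u) * inverse (real (Suc (Suc n))) < (T - u) * 1"
      using u by (intro mult_strict_left_mono) (auto simp: field_simps)
    then show "u < v n" by (simp add: v_def)
    show "v n < T" using u by (simp add: v_def)
  qed
  have mono: "v i \<le> v j" if "i \<le> j" for i j
    using that u by (auto simp: v_def intro!: mult_left_mono le_imp_inverse_le)
  have lim: "v \<longlonglongrightarrow> T"
  proof -
    have "(\<lambda>n. T - (T - u) * inverse (real (Suc (Suc n)))) \<longlonglongrightarrow> T - (T - u) * 0"
      by (intro tendsto_diff tendsto_mult tendsto_const LIMSEQ_Suc[OF LIMSEQ_inverse_real_of_nat])
    then show ?thesis by (simp add: v_def[abs_def])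
  qed
  then have atl: "filterlim v (at_left T) sequentially"
    using v by (auto simp: filterlim_at intro!: always_eventually)
  have "(\<lambda>n. \<integral>\<^sup>+y. (f y * indicator {u<..<T} y) * indicator {u<..<v n} y \<partial>lborel) \<longlonglongrightarrow> (\<integral>\<^sup>+y. f y * indicator {u<..<T} y \<partial>lborel)"
  proof (rule nn_integral_LIMSEQ)
    show "incseq (\<lambda>n y. (f y * indicator {u<..<T} y) * indicator {u<..<v n} y)"
      using mono by (force simp: incseq_def le_fun_def indicator_def)
    show "(\<lambda>n. (f y * indicator {u<..<T} y) * indicator {u<..<v n} y) \<longlonglongrightarrow> f y * indicator {u<..<T} y" for y
    proof (cases "y \<in> {u<..<T}")
      case True
      then have "\<forall>\<^sub>F n in sequentially. y < v n" using order_tendstoD(1)[OF lim, of y] by simp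
      then have "\<forall>\<^sub>F n in sequentially. (f y * indicator {u<..<T} y) * indicator {u<..<v n} y = f y * indicator {u<..<T} y"
        by eventually_elim (use True in auto)
      then show ?thesis by (rule tendsto_eventually)
    qed simp
  qed auto
  moreover have "(\<integral>\<^sup>+y. (f y * indicator {u<..<T} y) * indicator {u<..<v n} y \<partial>lborel) = (\<integral>\<^sup>+y\<in>{u<..<v n}. f y \<partial>lborel)" for n
    by (intro nn_integral_cong) (use v[of n] in \<open>auto simp: indicator_def\<close>)
  ultimately have "(\<lambda>n. \<integral>\<^sup>+y\<in>{u<..<v n}. f y \<partial>lborel) \<longlonglongrightarrow> (\<integral>\<^sup>+y\<in>{u<..<T}. f y \<partial>lborel)" by simp
  moreover have "(\<lambda>n. ennreal (g (v n))) \<longlonglongrightarrow> ennreal L"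
    by (intro tendsto_ennrealI filterlim_compose[OF g atl])
  ultimately have "(\<lambda>n. ennreal (g (v n)) + (\<integral>\<^sup>+y\<in>{u<..<v n}. f y \<partial>lborel)) \<longlonglongrightarrow> ennreal L + (\<integral>\<^sup>+y\<in>{u<..<T}. f y \<partial>lborel)"
    by (intro tendsto_add)
  then show ?thesis by (rule LIMSEQ_le_const2) (use le v in auto)
qed

context
  fixes \<alpha> T A :: real and z :: "real \<Rightarrow> real"
  assumes \<alpha>: "0 < \<alpha>" "\<alpha> < 1" and cont: "continuous_on {0..T} z" and A0: "A \<ge> 0"
    and A: "pnorm_zero \<alpha> T z \<le> ennreal A"
begin

lemma integrator_measurable_Ioo:
  assumes "0 \<le> u" "v \<le> T"
  shows "(\<lambda>y. indicator {u<..<v} y *\<^sub>R z y) \<in> borel_measurable borel"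
  by (rule borel_measurable_continuous_on_indicator)
     (use assms in \<open>auto intro!: continuous_on_subset[OF cont]\<close>)

lemma pnorm_zero_bound:
  assumes uv: "0 \<le> u" "u < v" "v \<le> T"
  shows "ennreal (\<bar>z v - z u\<bar> / (v - u) powr (1 - \<alpha>))
     + (\<integral>\<^sup>+y\<in>{u<..<v}. ennreal (\<bar>z u - z y\<bar> / (y - u) powr (2 - \<alpha>)) \<partial>lborel) \<le> ennreal A"
proof (cases "v < T")
  case True
  have "ennreal (\<bar>z v - z u\<bar> / (v - u) powr (1 - \<alpha>))
     + (\<integral>\<^sup>+y\<in>{u<..<v}. ennreal (\<bar>z u - z y\<bar> / (y - u) powr (2 - \<alpha>)) \<partial>lborel) \<le> pnorm_zero \<alpha> T z"
    unfolding pnorm_zero_def by (rule SUP_upper2[of "(u, v)"]) (use uv True in auto)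
  then show ?thesis using A by (rule order.trans)
next
  case False
  then have v: "v = T" using uv by simp
  have m: "(\<lambda>y. indicator {u<..<T} y *\<^sub>R z y) \<in> borel_measurable borel"
    using uv by (intro integrator_measurable_Ioo) auto
  show ?thesis unfolding v
  proof (rule nn_integral_Ioo_left_limit_le[where g = "\<lambda>v. \<bar>z v - z u\<bar> / (v - u) powr (1 - \<alpha>)"])
    have "(\<lambda>y. ennreal (\<bar>z u - indicator {u<..<T} y *\<^sub>R z y\<bar> / (y - u) powr (2 - \<alpha>)) * indicator {u<..<T} y) \<in> borel_measurable borel"
      using m by measurable
    also have "(\<lambda>y. ennreal (\<bar>z u - indicator {u<..<T} y *\<^sub>R z y\<bar> / (y - u) powr (2 - \<alpha>)) * indicator {u<..<T} y)
        = (\<lambda>y. ennreal (\<bar>z u - z y\<bar> / (y - u) powr (2 - \<alpha>)) * indicator {u<..<T} y)"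
      by (auto simp: indicator_def)
    finally show "(\<lambda>y. ennreal (\<bar>z u - z y\<bar> / (y - u) powr (2 - \<alpha>)) * indicator {u<..<T} y) \<in> borel_measurable borel" .
    have "(z \<longlongrightarrow> z T) (at T within {0..T})" using cont uv by (auto simp: continuous_on_def)
    then have "(z \<longlongrightarrow> z T) (at_left T)"
      using uv by (simp add: at_within_Icc_at_left v)
    then show "((\<lambda>v. \<bar>z v - z u\<bar> / (v - u) powr (1 - \<alpha>)) \<longlongrightarrow> \<bar>z T - z u\<bar> / (T - u) powr (1 - \<alpha>)) (at_left T)"
      by (intro tendsto_intros) (use uv v in auto)
    show "ennreal (\<bar>z w - z u\<bar> / (w - u) powr (1 - \<alpha>))
      + (\<integral>\<^sup>+y\<in>{u<..<w}. ennreal (\<bar>z u - z y\<bar> / (y - u) powr (2 - \<alpha>)) \<partial>lborel) \<le> ennreal A" if "u < w" "w < T" for w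
    proof -
      have "ennreal (\<bar>z w - z u\<bar> / (w - u) powr (1 - \<alpha>))
         + (\<integral>\<^sup>+y\<in>{u<..<w}. ennreal (\<bar>z u - z y\<bar> / (y - u) powr (2 - \<alpha>)) \<partial>lborel) \<le> pnorm_zero \<alpha> T z"
        unfolding pnorm_zero_def by (rule SUP_upper2[of "(u, w)"]) (use uv that in auto)
      then show ?thesis using A by (rule order.trans)
    qed
  qed (use uv v in auto)
qed

lemma weyl_right_le:
  assumes "0 \<le> x" "x < t" "t \<le> T"
  shows "\<bar>weyl_right \<alpha> t z x\<bar> \<le> A"
proof -
  let ?I = "LBINT y:{x<..<t}. (z x - z y) / (y - x) powr (2 - \<alpha>)"
  have "\<bar>weyl_right \<alpha> t z x\<bar> \<le> \<bar>z t - z x\<bar> / (t - x) powr (1 - \<alpha>) + (1 - \<alpha>) * \<bar>?I\<bar>"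
    unfolding weyl_right_def using \<alpha>
    by (intro order.trans[OF abs_triangle_ineq]) (simp add: abs_mult abs_minus_commute)
  also have "\<dots> \<le> \<bar>z t - z x\<bar> / (t - x) powr (1 - \<alpha>) + \<bar>?I\<bar>"
    using \<alpha> by (simp add: mult_left_le_one_le)
  finally have "ennreal \<bar>weyl_right \<alpha> t z x\<bar> \<le> ennreal (\<bar>z t - z x\<bar> / (t - x) powr (1 - \<alpha>)) + ennreal (norm ?I)"
    by (simp flip: ennreal_plus)
  also have "\<dots> \<le> ennreal (\<bar>z t - z x\<bar> / (t - x) powr (1 - \<alpha>)) + (\<integral>\<^sup>+y\<in>{x<..<t}. ennreal (norm ((z x - z y) / (y - x) powr (2 - \<alpha>))) \<partial>lborel)"
    by (intro add_left_mono norm_set_integral_le_nn_integral)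
  also have "\<dots> \<le> ennreal A"
    using pnorm_zero_bound[OF assms] by (simp add: abs_divide)
  finally show ?thesis using A0 by simp
qed

lemma weyl_integrand_integrable:
  assumes "0 \<le> x" "x < t" "t \<le> T"
  shows "set_integrable lborel {x<..<t} (\<lambda>y. (z x - z y) / (y - x) powr (2 - \<alpha>))"
  unfolding set_integrable_def
proof (rule integrableI_bounded)
  have m: "(\<lambda>y. indicator {x<..<t} y *\<^sub>R z y) \<in> borel_measurable borel"
    using assms by (intro integrator_measurable_Ioo) auto
  have "(\<lambda>y. indicator {x<..<t} y *\<^sub>R ((z x - indicator {x<..<t} y *\<^sub>R z y) / (y - x) powr (2 - \<alpha>))) \<in> borel_measurable borel"
    using m by measurable
  also have "(\<lambda>y. indicator {x<..<t} y *\<^sub>R ((z x - indicator {x<..<t} y *\<^sub>R z y) / (y - x) powr (2 - \<alpha>)))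
      = (\<lambda>y. indicator {x<..<t} y *\<^sub>R ((z x - z y) / (y - x) powr (2 - \<alpha>)))"
    by (auto simp: indicator_def)
  finally show "(\<lambda>y. indicator {x<..<t} y *\<^sub>R ((z x - z y) / (y - x) powr (2 - \<alpha>))) \<in> borel_measurable lborel" by simp
  have "(\<integral>\<^sup>+y. ennreal (norm (indicator {x<..<t} y *\<^sub>R ((z x - z y) / (y - x) powr (2 - \<alpha>)))) \<partial>lborel)
      = (\<integral>\<^sup>+y\<in>{x<..<t}. ennreal (\<bar>z x - z y\<bar> / (y - x) powr (2 - \<alpha>)) \<partial>lborel)"
    by (intro nn_integral_cong) (auto simp: indicator_def abs_divide)
  also have "\<dots> \<le> ennreal A"
    using pnorm_zero_bound[OF assms] by (rule order.trans[rotated]) simp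
  also have "\<dots> < \<infinity>" by simp
  finally show "(\<integral>\<^sup>+y. ennreal (norm (indicator {x<..<t} y *\<^sub>R ((z x - z y) / (y - x) powr (2 - \<alpha>)))) \<partial>lborel) < \<infinity>" .
qed

text \<open>The terms in \<open>z x\<close> combine with \<open>z s\<close>, as
  \<open>(1 - \<alpha>) * \<integral>\<^sub>s\<^sup>t (y - x) powr (\<alpha> - 2) dy = (s - x) powr (\<alpha> - 1) - (t - x) powr (\<alpha> - 1)\<close>, and only
  increments of \<open>z\<close> starting from \<open>s\<close> are left.\<close>

lemma weyl_right_diff_eq:
  assumes xst: "0 \<le> x" "x < s" "s < t" "t \<le> T"
  shows "weyl_right \<alpha> t z x - weyl_right \<alpha> s z x
    = (z s - z t) / (t - x) powr (1 - \<alpha>) + (1 - \<alpha>) * (LBINT y:{s..<t}. (z s - z y) / (y - x) powr (2 - \<alpha>))"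
proof -
  let ?w = "\<lambda>y. (z x - z y) / (y - x) powr (2 - \<alpha>)" and ?p = "\<lambda>y. (y - x) powr (\<alpha> - 2)"
  have int: "set_integrable lborel {x<..<t} ?w"
    using xst by (intro weyl_integrand_integrable) auto
  have ints: "set_integrable lborel {s..<t} ?w" "set_integrable lborel {x<..<s} ?w"
    using xst by (auto intro: set_integrable_subset[OF int])
  have un: "{x<..<t} = {x<..<s} \<union> {s..<t}" using xst by auto
  have split: "(LBINT y:{x<..<t}. ?w y) = (LBINT y:{x<..<s}. ?w y) + (LBINT y:{s..<t}. ?w y)"
    unfolding un by (rule set_integral_Un[OF _ ints(2,1)]) auto
  have FTC: "has_bochner_integral lborel (\<lambda>y. ?p y * indicator {s..t} y)
      ((t - x) powr (\<alpha> - 1) / (\<alpha> - 1) - (s - x) powr (\<alpha> - 1) / (\<alpha> - 1))"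
  proof (rule has_bochner_integral_FTC_Icc_real)
    fix y assume y: "s \<le> y" "y \<le> t"
    have "((\<lambda>y. (y - x) powr (\<alpha> - 1)) has_real_derivative (\<alpha> - 1) * (y - x) powr (\<alpha> - 1 - 1) * 1) (at y)"
      by (rule DERIV_chain2[OF has_real_derivative_powr, where g = "\<lambda>y. y - x"]) (use y xst in \<open>auto intro!: derivative_eq_intros\<close>)
    from DERIV_cdivide[OF this, of "\<alpha> - 1"]
    show "((\<lambda>y. (y - x) powr (\<alpha> - 1) / (\<alpha> - 1)) has_real_derivative ?p y) (at y)"
      using \<alpha> by simp
    show "isCont ?p y" using y xst by (intro continuous_intros) auto
  qed (use xst in simp)
  have AEeq: "AE y in lborel. ?p y * indicator {s..t} y = indicator {s..<t} y *\<^sub>R ?p y"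
    using AE_lborel_singleton[of t] by eventually_elim (auto simp: indicator_def)
  have "has_bochner_integral lborel (\<lambda>y. indicator {s..<t} y *\<^sub>R ?p y)
      ((t - x) powr (\<alpha> - 1) / (\<alpha> - 1) - (s - x) powr (\<alpha> - 1) / (\<alpha> - 1))"
    by (rule has_bochner_integral_cong_AE[THEN iffD1, OF _ _ AEeq FTC]) auto
  then have pint: "set_integrable lborel {s..<t} ?p" and
    p: "(LBINT y:{s..<t}. ?p y) = (t - x) powr (\<alpha> - 1) / (\<alpha> - 1) - (s - x) powr (\<alpha> - 1) / (\<alpha> - 1)"
    by (auto simp: set_integrable_def set_lebesgue_integral_def has_bochner_integral_iff)
  have p': "(1 - \<alpha>) * (LBINT y:{s..<t}. ?p y) = (s - x) powr (\<alpha> - 1) - (t - x) powr (\<alpha> - 1)"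
  proof -
    have "a / (\<alpha> - 1) = - (a / (1 - \<alpha>))" for a :: real
      by (metis minus_diff_eq minus_divide_right)
    then show ?thesis unfolding p using \<alpha> by (simp add: right_diff_distrib)
  qed
  have inv: "a / b powr (2 - \<alpha>) = a * b powr (\<alpha> - 2)" "a / b powr (1 - \<alpha>) = a * b powr (\<alpha> - 1)" for a b :: real
    using powr_minus_divide[of b "2 - \<alpha>"] powr_minus_divide[of b "1 - \<alpha>"] by simp_all
  have "(LBINT y:{s..<t}. (z s - z y) / (y - x) powr (2 - \<alpha>)) = (LBINT y:{s..<t}. ?w y - (z x - z s) * ?p y)"
    by (intro set_lebesgue_integral_cong) (auto simp: inv algebra_simps)
  also have "\<dots> = (LBINT y:{s..<t}. ?w y) - (z x - z s) * (LBINT y:{s..<t}. ?p y)"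
    using ints(1) pint by (subst set_integral_diff) auto
  finally have "(1 - \<alpha>) * (LBINT y:{s..<t}. (z s - z y) / (y - x) powr (2 - \<alpha>))
      = (1 - \<alpha>) * ((LBINT y:{s..<t}. ?w y) - (z x - z s) * (LBINT y:{s..<t}. ?p y))"
    by (rule arg_cong)
  also have "\<dots> = (1 - \<alpha>) * (LBINT y:{s..<t}. ?w y) - (z x - z s) * ((1 - \<alpha>) * (LBINT y:{s..<t}. ?p y))"
    by (simp add: algebra_simps)
  finally have "(1 - \<alpha>) * (LBINT y:{s..<t}. (z s - z y) / (y - x) powr (2 - \<alpha>))
      = (1 - \<alpha>) * (LBINT y:{s..<t}. ?w y) - (z x - z s) * ((1 - \<alpha>) * (LBINT y:{s..<t}. ?p y))" .
  then show ?thesis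
    unfolding weyl_right_def split p' inv(2) by (simp add: algebra_simps)
qed

text \<open>In the previous identity, \<open>(y - s) / (y - x)\<close> is increasing in \<open>y\<close>, so that
  passing from \<open>y - x\<close> to \<open>y - s\<close> under the integral gains the factor \<open>((t - s) / (t - x)) powr (2 - \<alpha>)\<close>. What remains is
  the expression in \<^const>\<open>pnorm_zero\<close> for the pair \<open>(s, t)\<close>.\<close>

lemma weyl_right_diff_le:
  assumes xst: "0 \<le> x" "x < s" "s < t" "t \<le> T"
  shows "\<bar>weyl_right \<alpha> t z x - weyl_right \<alpha> s z x\<bar> \<le> A * ((t - s) / (t - x)) powr (1 - \<alpha>)"
proof -
  let ?q = "(t - s) / (t - x)"
  let ?I = "LBINT y:{s..<t}. (z s - z y) / (y - x) powr (2 - \<alpha>)"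
  let ?J = "\<integral>\<^sup>+y\<in>{s<..<t}. ennreal (\<bar>z s - z y\<bar> / (y - s) powr (2 - \<alpha>)) \<partial>lborel"
  have q: "0 < ?q" "?q \<le> 1" using xst by auto
  have first: "\<bar>z s - z t\<bar> / (t - x) powr (1 - \<alpha>) = ?q powr (1 - \<alpha>) * (\<bar>z t - z s\<bar> / (t - s) powr (1 - \<alpha>))"
    using xst by (simp add: powr_divide abs_minus_commute)
  have "\<bar>weyl_right \<alpha> t z x - weyl_right \<alpha> s z x\<bar> \<le> \<bar>z s - z t\<bar> / (t - x) powr (1 - \<alpha>) + (1 - \<alpha>) * \<bar>?I\<bar>"
    unfolding weyl_right_diff_eq[OF xst] using \<alpha>
    by (intro order.trans[OF abs_triangle_ineq]) (simp add: abs_mult)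
  also have "\<dots> \<le> \<bar>z s - z t\<bar> / (t - x) powr (1 - \<alpha>) + \<bar>?I\<bar>"
    using \<alpha> by (simp add: mult_left_le_one_le)
  finally have "ennreal \<bar>weyl_right \<alpha> t z x - weyl_right \<alpha> s z x\<bar>
      \<le> ennreal (\<bar>z s - z t\<bar> / (t - x) powr (1 - \<alpha>)) + ennreal (norm ?I)"
    by (simp flip: ennreal_plus)
  also have "ennreal (norm ?I) \<le> (\<integral>\<^sup>+y\<in>{s..<t}. ennreal (norm ((z s - z y) / (y - x) powr (2 - \<alpha>))) \<partial>lborel)"
    by (rule norm_set_integral_le_nn_integral)
  also have "\<dots> \<le> (\<integral>\<^sup>+y. ennreal (?q powr (1 - \<alpha>)) * (ennreal (\<bar>z s - z y\<bar> / (y - s) powr (2 - \<alpha>)) * indicator {s<..<t} y) \<partial>lborel)"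
  proof (rule nn_integral_mono)
    fix y
    have "\<bar>z s - z y\<bar> / (y - x) powr (2 - \<alpha>) \<le> ?q powr (1 - \<alpha>) * (\<bar>z s - z y\<bar> / (y - s) powr (2 - \<alpha>))"
      if y: "s < y" "y < t"
    proof -
      have "(y - s) / (y - x) \<le> ?q"
      proof -
        have "0 \<le> (t - y) * (s - x)" using xst y by (intro mult_nonneg_nonneg) auto
        then have "(y - s) * (t - x) \<le> (t - s) * (y - x)" by (simp add: algebra_simps)
        then show ?thesis using xst y by (simp add: pos_divide_le_eq pos_le_divide_eq)
      qed
      then have "((y - s) / (y - x)) powr (2 - \<alpha>) \<le> ?q powr (2 - \<alpha>)"
        using xst y \<alpha> by (intro powr_mono2) auto
      also have "\<dots> \<le> ?q powr (1 - \<alpha>)" using q by (intro powr_mono') auto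
      finally have "((y - s) / (y - x)) powr (2 - \<alpha>) * (\<bar>z s - z y\<bar> / (y - s) powr (2 - \<alpha>))
        \<le> ?q powr (1 - \<alpha>) * (\<bar>z s - z y\<bar> / (y - s) powr (2 - \<alpha>))" by (intro mult_right_mono) auto
      moreover have "((y - s) / (y - x)) powr (2 - \<alpha>) * (\<bar>z s - z y\<bar> / (y - s) powr (2 - \<alpha>)) = \<bar>z s - z y\<bar> / (y - x) powr (2 - \<alpha>)"
        using xst y by (simp add: powr_divide)
      ultimately show ?thesis by simp
    qed
    moreover have "y = s \<or> s < y" if "y \<in> {s..<t}" using that by auto
    ultimately show "ennreal (norm ((z s - z y) / (y - x) powr (2 - \<alpha>))) * indicator {s..<t} y
        \<le> ennreal (?q powr (1 - \<alpha>)) * (ennreal (\<bar>z s - z y\<bar> / (y - s) powr (2 - \<alpha>)) * indicator {s<..<t} y)"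
      by (cases "y = s") (auto simp: indicator_def abs_divide intro!: ennreal_leI simp flip: ennreal_mult)
  qed
  also have "\<dots> = ennreal (?q powr (1 - \<alpha>)) * ?J"
  proof (rule nn_integral_cmult)
    have m: "(\<lambda>y. indicator {s<..<t} y *\<^sub>R z y) \<in> borel_measurable borel"
      using xst by (intro integrator_measurable_Ioo) auto
    have "(\<lambda>y. ennreal (\<bar>z s - indicator {s<..<t} y *\<^sub>R z y\<bar> / (y - s) powr (2 - \<alpha>)) * indicator {s<..<t} y) \<in> borel_measurable borel"
      using m by measurable
    also have "(\<lambda>y. ennreal (\<bar>z s - indicator {s<..<t} y *\<^sub>R z y\<bar> / (y - s) powr (2 - \<alpha>)) * indicator {s<..<t} y)
        = (\<lambda>y. ennreal (\<bar>z s - z y\<bar> / (y - s) powr (2 - \<alpha>)) * indicator {s<..<t} y)"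
      by (auto simp: indicator_def)
    finally show "(\<lambda>y. ennreal (\<bar>z s - z y\<bar> / (y - s) powr (2 - \<alpha>)) * indicator {s<..<t} y) \<in> borel_measurable lborel" by simp
  qed
  also have "ennreal (\<bar>z s - z t\<bar> / (t - x) powr (1 - \<alpha>)) + ennreal (?q powr (1 - \<alpha>)) * ?J
      = ennreal (?q powr (1 - \<alpha>)) * (ennreal (\<bar>z t - z s\<bar> / (t - s) powr (1 - \<alpha>)) + ?J)"
    unfolding first distrib_left by (subst ennreal_mult) auto
  also have "\<dots> \<le> ennreal (?q powr (1 - \<alpha>)) * ennreal A"
    by (intro mult_left_mono pnorm_zero_bound) (use xst in auto)
  finally show ?thesis using A0 by (simp add: mult.commute flip: ennreal_mult)
qed

text \<open>The left-sided derivative of \<open>f\<close> at \<open>0\<close> is common to the integrals over \<open>[0, s]\<close> and \<open>[0, t]\<close>. Their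
  difference is thus controlled by the difference of the right-sided derivatives.\<close>

lemma gls_integral_bounds:
  assumes h[measurable]: "h \<in> borel_measurable borel"
    and D: "\<And>x. x \<in> {0<..<t} \<Longrightarrow> \<bar>frac_deriv_left \<alpha> 0 f x\<bar> \<le> h x"
    and t: "0 \<le> t" "t \<le> T" and gt: "gls_integrable \<alpha> 0 t f z"
  shows "ennreal (cmod (gls_integral \<alpha> 0 t f z)) \<le> ennreal (A / Gamma \<alpha>) * (\<integral>\<^sup>+x\<in>{0<..<t}. ennreal (h x) \<partial>lborel)"
    and "0 < s \<Longrightarrow> s < t \<Longrightarrow> gls_integrable \<alpha> 0 s f z \<Longrightarrow>
      ennreal (cmod (gls_integral \<alpha> 0 t f z - gls_integral \<alpha> 0 s f z))
       \<le> ennreal (A / Gamma \<alpha>) * (\<integral>\<^sup>+x\<in>{0<..<t}. ennreal (h x * inc_kernel \<alpha> t s x) \<partial>lborel)"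
proof -
  let ?D = "frac_deriv_left \<alpha> 0 f" and ?R = "\<lambda>t. frac_deriv_right \<alpha> t (\<lambda>x. z x - z t)"
  have Gp: "Gamma \<alpha> > 0" using \<alpha> by (simp add: Gamma_real_pos)
  have R: "cmod (?R t x) = \<bar>weyl_right \<alpha> t z x\<bar> / Gamma \<alpha>" for t x
    using Gp by (simp add: frac_deriv_right_eq norm_mult norm_divide)
  have Rd: "cmod (?R t x - ?R s x) = \<bar>weyl_right \<alpha> t z x - weyl_right \<alpha> s z x\<bar> / Gamma \<alpha>" for t s x
  proof -
    have "?R t x - ?R s x = exp (- \<i> * of_real (pi * \<alpha>)) / of_real (Gamma \<alpha>) * of_real (weyl_right \<alpha> t z x - weyl_right \<alpha> s z x)"
      by (simp add: frac_deriv_right_eq algebra_simps diff_divide_distrib)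
    then show ?thesis using Gp by (simp add: norm_mult norm_divide del: of_real_diff)
  qed
  have gls: "cmod (gls_integral \<alpha> 0 t f z - c) = cmod ((LBINT x:{0<..<t}. of_real (?D x) * ?R t x) - exp (- \<i> * of_real (pi * \<alpha>)) * c)" for t c
  proof -
    have "gls_integral \<alpha> 0 t f z - c = exp (\<i> * of_real (pi * \<alpha>)) * ((LBINT x:{0<..<t}. of_real (?D x) * ?R t x) - exp (- \<i> * of_real (pi * \<alpha>)) * c)"
      by (simp add: gls_integral_def algebra_simps flip: exp_add)
    then show ?thesis by (simp add: norm_mult)
  qed
  have h0: "h x \<ge> 0" if "x \<in> {0<..<t}" for x using D[OF that] by linarith
  have DR: "norm (of_real (?D x) * r) \<le> A / Gamma \<alpha> * (h x * k)"
    if "x \<in> {0<..<t}" "cmod r \<le> A * k / Gamma \<alpha>" for x r k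
  proof -
    have "norm (of_real (?D x) * r) = \<bar>?D x\<bar> * cmod r" by (simp add: norm_mult)
    also have "\<dots> \<le> h x * (A * k / Gamma \<alpha>)"
      using that D[OF that(1)] h0[OF that(1)] by (intro mult_mono) auto
    finally show ?thesis by (simp add: mult_ac)
  qed
  have "ennreal (cmod (gls_integral \<alpha> 0 t f z)) \<le> (\<integral>\<^sup>+x\<in>{0<..<t}. ennreal (norm (of_real (?D x) * ?R t x)) \<partial>lborel)"
    using gls[of t 0] norm_set_integral_le_nn_integral[of lborel "{0<..<t}" "\<lambda>x. of_real (?D x) * ?R t x"] by simp
  also have "\<dots> \<le> (\<integral>\<^sup>+x. ennreal (A / Gamma \<alpha>) * (ennreal (h x) * indicator {0<..<t} x) \<partial>lborel)"
  proof (rule nn_integral_mono)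
    fix x
    have "norm (of_real (?D x) * ?R t x) \<le> A / Gamma \<alpha> * (h x * 1)" if x: "x \<in> {0<..<t}"
      by (rule DR[OF x]) (use weyl_right_le[of x t] x t Gp in \<open>auto simp: R divide_right_mono\<close>)
    then show "ennreal (norm (of_real (?D x) * ?R t x)) * indicator {0<..<t} x \<le> ennreal (A / Gamma \<alpha>) * (ennreal (h x) * indicator {0<..<t} x)"
      using A0 Gp h0[of x] by (auto simp: indicator_def intro!: ennreal_leI simp flip: ennreal_mult)
  qed
  also have "\<dots> = ennreal (A / Gamma \<alpha>) * (\<integral>\<^sup>+x\<in>{0<..<t}. ennreal (h x) \<partial>lborel)"
    by (rule nn_integral_cmult) measurable
  finally show "ennreal (cmod (gls_integral \<alpha> 0 t f z)) \<le> ennreal (A / Gamma \<alpha>) * (\<integral>\<^sup>+x\<in>{0<..<t}. ennreal (h x) \<partial>lborel)" .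
  assume s: "0 < s" "s < t" and gs: "gls_integrable \<alpha> 0 s f z"
  have int: "set_integrable lborel {0<..<u} (\<lambda>x. of_real (?D x) * ?R u x)"
    if g: "gls_integrable \<alpha> 0 u f z" for u
  proof -
    from g obtain B where B: "AE x in lborel. x \<in> {0<..<u} \<longrightarrow> cmod (?R u x) \<le> B"
      and m1: "(\<lambda>x. indicator {0<..<u} x *\<^sub>R ?R u x) \<in> borel_measurable lborel"
      and i1: "integrable lborel (\<lambda>x. indicator {0<..<u} x *\<^sub>R ?D x)"
      by (auto simp: gls_integrable_def set_borel_measurable_def set_integrable_def)
    have m2: "(\<lambda>x. indicator {0<..<u} x *\<^sub>R ?D x) \<in> borel_measurable lborel" using i1 by simp
    have "integrable lborel (\<lambda>x. of_real (indicator {0<..<u} x *\<^sub>R ?D x) * (indicator {0<..<u} x *\<^sub>R ?R u x))"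
    proof (rule Bochner_Integration.integrable_bound[where f = "\<lambda>x. B * (indicator {0<..<u} x *\<^sub>R ?D x)"])
      show "integrable lborel (\<lambda>x. B * (indicator {0<..<u} x *\<^sub>R ?D x))" using i1 by simp
      show "(\<lambda>x. of_real (indicator {0<..<u} x *\<^sub>R ?D x) * (indicator {0<..<u} x *\<^sub>R ?R u x)) \<in> borel_measurable lborel"
        using m1 m2 by measurable
      show "AE x in lborel. norm (of_real (indicator {0<..<u} x *\<^sub>R ?D x) * (indicator {0<..<u} x *\<^sub>R ?R u x))
          \<le> norm (B * (indicator {0<..<u} x *\<^sub>R ?D x))"
        using B
      proof eventually_elim
        case (elim x)
        show ?case
        proof (cases "x \<in> {0<..<u}")
          case True
          with elim have "cmod (?R u x) \<le> \<bar>B\<bar>" by auto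
          then have "cmod (?R u x) * \<bar>?D x\<bar> \<le> \<bar>B\<bar> * \<bar>?D x\<bar>" by (intro mult_right_mono) auto
          then show ?thesis using True by (simp add: norm_mult abs_mult mult.commute)
        qed simp
      qed
    qed
    moreover have "(\<lambda>x. of_real (indicator {0<..<u} x *\<^sub>R ?D x) * (indicator {0<..<u} x *\<^sub>R ?R u x))
        = (\<lambda>x. indicator {0<..<u} x *\<^sub>R (of_real (?D x) * ?R u x))"
      by (auto simp: indicator_def fun_eq_iff)
    ultimately show ?thesis by (simp add: set_integrable_def)
  qed
  let ?E = "\<lambda>x. indicator {0<..<t} x *\<^sub>R (of_real (?D x) * ?R t x) - indicator {0<..<s} x *\<^sub>R (of_real (?D x) * ?R s x)"
  have "cmod (gls_integral \<alpha> 0 t f z - gls_integral \<alpha> 0 s f z)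
     = cmod ((LBINT x:{0<..<t}. of_real (?D x) * ?R t x) - (LBINT x:{0<..<s}. of_real (?D x) * ?R s x))"
    unfolding gls by (simp add: gls_integral_def mult.assoc[symmetric] flip: exp_add)
  also have "\<dots> = cmod (integral\<^sup>L lborel ?E)"
    using int[OF gt] int[OF gs] by (simp add: set_lebesgue_integral_def set_integrable_def)
  finally have "ennreal (cmod (gls_integral \<alpha> 0 t f z - gls_integral \<alpha> 0 s f z)) \<le> (\<integral>\<^sup>+x. ennreal (norm (?E x)) \<partial>lborel)"
    using norm_integral_le_nn_integral[of lborel ?E] by simp
  also have "\<dots> \<le> (\<integral>\<^sup>+x. ennreal (A / Gamma \<alpha>) * (ennreal (h x * inc_kernel \<alpha> t s x) * indicator {0<..<t} x) \<partial>lborel)"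
  proof (rule nn_integral_mono)
    fix x
    have "norm (?E x) \<le> A / Gamma \<alpha> * (h x * inc_kernel \<alpha> t s x)" if x: "x \<in> {0<..<t}"
    proof (cases "x < s")
      case True
      then have "?E x = of_real (?D x) * (?R t x - ?R s x)" using x by (simp add: algebra_simps)
      also have "norm \<dots> \<le> A / Gamma \<alpha> * (h x * inc_kernel \<alpha> t s x)"
        by (rule DR[OF x]) (use weyl_right_diff_le[of x s t] x s t Gp True in \<open>auto simp: Rd inc_kernel_def divide_right_mono\<close>)
      finally show ?thesis .
    next
      case False
      then have "?E x = of_real (?D x) * ?R t x" using x by simp
      also have "norm \<dots> \<le> A / Gamma \<alpha> * (h x * inc_kernel \<alpha> t s x)"
        by (rule DR[OF x]) (use weyl_right_le[of x t] x s t Gp False in \<open>auto simp: R inc_kernel_def divide_right_mono\<close>)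
      finally show ?thesis .
    qed
    moreover have "?E x = 0" if "x \<notin> {0<..<t}" using that s by (auto simp: indicator_def)
    ultimately show "ennreal (norm (?E x)) \<le> ennreal (A / Gamma \<alpha>) * (ennreal (h x * inc_kernel \<alpha> t s x) * indicator {0<..<t} x)"
      using A0 Gp h0[of x] by (cases "x \<in> {0<..<t}") (auto intro!: ennreal_leI simp flip: ennreal_mult)
  qed
  also have "\<dots> = ennreal (A / Gamma \<alpha>) * (\<integral>\<^sup>+x\<in>{0<..<t}. ennreal (h x * inc_kernel \<alpha> t s x) \<partial>lborel)"
    by (rule nn_integral_cmult) measurable
  finally show "ennreal (cmod (gls_integral \<alpha> 0 t f z - gls_integral \<alpha> 0 s f z))
       \<le> ennreal (A / Gamma \<alpha>) * (\<integral>\<^sup>+x\<in>{0<..<t}. ennreal (h x * inc_kernel \<alpha> t s x) \<partial>lborel)" .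
qed

end

section \<open>The pathwise estimate\<close>

text \<open>The constant by which \<open>1 + pnorm \<alpha> x X\<close> controls the left-sided derivative of \<open>s \<mapsto> c s (X s)\<close> at \<open>x\<close>.\<close>

definition frac_const :: "real \<Rightarrow> real \<Rightarrow> real \<Rightarrow> real \<Rightarrow> real" where
  "frac_const \<alpha> \<beta> T K = K / Gamma (1 - \<alpha>) * (1 + T powr \<beta> / (\<beta> - \<alpha>) + T powr \<alpha>)"

text \<open>The constant of the linear Volterra inequality for \<open>t \<mapsto> pnorm \<alpha> t X\<close>: in
  brackets the contributions of drift and Stieltjes integral, then those of \<open>\<bar>X t\<bar>\<close> and of the singular integral
  in the norm, then the constant from the exponentially weighted integral.\<close>

definition growth_const :: "real \<Rightarrow> real \<Rightarrow> real \<Rightarrow> real \<Rightarrow> real" where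
  "growth_const \<alpha> \<beta> T K = (K * T powr \<alpha> + frac_const \<alpha> \<beta> T K / Gamma \<alpha>)
     * (T powr \<alpha> + (1 / (1 - 2 * \<alpha>) + 1 / \<alpha>)) * (2 * Gamma (1 - 2 * \<alpha>))"

lemma frac_const_nonneg:
  assumes "0 < \<alpha>" "\<alpha> < 1" "\<alpha> < \<beta>" "0 \<le> K"
  shows "0 \<le> frac_const \<alpha> \<beta> T K"
  unfolding frac_const_def using assms
  by (intro mult_nonneg_nonneg add_nonneg_nonneg) (auto simp: Gamma_real_pos less_imp_le)

lemma growth_const_pos:
  assumes "0 < \<alpha>" "\<alpha> < 1/2" "\<alpha> < \<beta>" "0 < T" "0 < K"
  shows "0 < growth_const \<alpha> \<beta> T K"
  unfolding growth_const_def
proof (intro mult_pos_pos add_pos_nonneg add_pos_pos)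
  show "0 \<le> frac_const \<alpha> \<beta> T K / Gamma \<alpha>"
    using frac_const_nonneg[of \<alpha> \<beta> K T] assms by (simp add: Gamma_real_pos less_imp_le)
qed (use assms in \<open>auto simp: Gamma_real_pos\<close>)

lemma pnorm_le_ennrealD:
  assumes "pnorm \<alpha> t X \<le> ennreal P" "0 \<le> P"
  shows "\<bar>X t\<bar> \<le> P"
    and "(\<integral>\<^sup>+s\<in>{0<..<t}. ennreal (\<bar>X t - X s\<bar> * (t - s) powr (- 1 - \<alpha>)) \<partial>lborel) \<le> ennreal P"
proof -
  have "ennreal \<bar>X t\<bar> \<le> ennreal P"
    using assms(1) unfolding pnorm_def by (rule order.trans[rotated]) simp
  then show "\<bar>X t\<bar> \<le> P" using assms(2) by simp
  show "(\<integral>\<^sup>+s\<in>{0<..<t}. ennreal (\<bar>X t - X s\<bar> * (t - s) powr (- 1 - \<alpha>)) \<partial>lborel) \<le> ennreal P"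
    using assms(1) unfolding pnorm_def by (rule order.trans[rotated]) simp
qed

text \<open>Everything is expressed through \<open>x powr (- \<alpha>)\<close>, the singularity of the leading term; the others
  are bounded on \<open>]0, T]\<close> and absorbed at the price of powers of \<open>T\<close>.\<close>

lemma frac_deriv_left_le:
  fixes f X :: "real \<Rightarrow> real"
  assumes \<alpha>: "0 < \<alpha>" "\<alpha> < 1" and \<beta>: "\<alpha> < \<beta>" and K: "0 \<le> K" and x: "0 < x" "x \<le> T"
    and cont: "continuous_on {0..T} X"
    and f: "\<bar>f x\<bar> \<le> K * (1 + \<bar>X x\<bar>)"
    and fd: "\<And>y. y \<in> {0<..<x} \<Longrightarrow> \<bar>f x - f y\<bar> \<le> K * ((x - y) powr \<beta> + \<bar>X x - X y\<bar>)"
    and P: "pnorm \<alpha> x X \<le> ennreal P" "0 \<le> P"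
  shows "\<bar>frac_deriv_left \<alpha> 0 f x\<bar> \<le> frac_const \<alpha> \<beta> T K * (1 + P) * x powr (- \<alpha>)"
proof -
  let ?L = "LBINT y:{0<..<x}. (f x - f y) / (x - y) powr (1 + \<alpha>)"
  note P' = pnorm_le_ennrealD[OF P]
  have Gp: "Gamma (1 - \<alpha>) > 0" using \<alpha> by (simp add: Gamma_real_pos)
  have m: "(\<lambda>y. indicator {0<..<x} y *\<^sub>R X y) \<in> borel_measurable borel"
    by (rule borel_measurable_continuous_on_indicator)
       (use x in \<open>auto intro!: continuous_on_subset[OF cont]\<close>)
  have "(\<lambda>y. ennreal (\<bar>X x - indicator {0<..<x} y *\<^sub>R X y\<bar> * (x - y) powr (- 1 - \<alpha>)) * indicator {0<..<x} y) \<in> borel_measurable borel"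
    using m by measurable
  also have "(\<lambda>y. ennreal (\<bar>X x - indicator {0<..<x} y *\<^sub>R X y\<bar> * (x - y) powr (- 1 - \<alpha>)) * indicator {0<..<x} y)
      = (\<lambda>y. ennreal (\<bar>X x - X y\<bar> * (x - y) powr (- 1 - \<alpha>)) * indicator {0<..<x} y)"
    by (auto simp: indicator_def)
  finally have m': "(\<lambda>y. ennreal (\<bar>X x - X y\<bar> * (x - y) powr (- 1 - \<alpha>)) * indicator {0<..<x} y) \<in> borel_measurable lborel" by simp
  have "ennreal (norm ?L) \<le> (\<integral>\<^sup>+y\<in>{0<..<x}. ennreal (norm ((f x - f y) / (x - y) powr (1 + \<alpha>))) \<partial>lborel)"
    by (rule norm_set_integral_le_nn_integral)
  also have "\<dots> \<le> (\<integral>\<^sup>+y. ennreal K * (ennreal (\<bar>X x - X y\<bar> * (x - y) powr (- 1 - \<alpha>)) * indicator {0<..<x} y)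
      + ennreal K * (ennreal ((x - y) powr (\<beta> - 1 - \<alpha>)) * indicator {0<..<x} y) \<partial>lborel)"
  proof (rule nn_integral_mono)
    fix y
    have "norm ((f x - f y) / (x - y) powr (1 + \<alpha>)) \<le> K * (\<bar>X x - X y\<bar> * (x - y) powr (- 1 - \<alpha>)) + K * (x - y) powr (\<beta> - 1 - \<alpha>)"
      if y: "y \<in> {0<..<x}"
    proof -
      have "norm ((f x - f y) / (x - y) powr (1 + \<alpha>)) = \<bar>f x - f y\<bar> * (x - y) powr (- 1 - \<alpha>)"
        using powr_minus_divide[of "x - y" "1 + \<alpha>"] by simp
      also have "\<dots> \<le> K * ((x - y) powr \<beta> + \<bar>X x - X y\<bar>) * (x - y) powr (- 1 - \<alpha>)"
        by (intro mult_right_mono fd y) simp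
      also have "(x - y) powr (\<beta> - 1 - \<alpha>) = (x - y) powr \<beta> * (x - y) powr (- 1 - \<alpha>)"
        by (simp add: algebra_simps flip: powr_add)
      then have "K * ((x - y) powr \<beta> + \<bar>X x - X y\<bar>) * (x - y) powr (- 1 - \<alpha>)
          = K * (\<bar>X x - X y\<bar> * (x - y) powr (- 1 - \<alpha>)) + K * (x - y) powr (\<beta> - 1 - \<alpha>)"
        by (simp add: algebra_simps)
      finally show ?thesis .
    qed
    then show "ennreal (norm ((f x - f y) / (x - y) powr (1 + \<alpha>))) * indicator {0<..<x} y
      \<le> ennreal K * (ennreal (\<bar>X x - X y\<bar> * (x - y) powr (- 1 - \<alpha>)) * indicator {0<..<x} y)
      + ennreal K * (ennreal ((x - y) powr (\<beta> - 1 - \<alpha>)) * indicator {0<..<x} y)"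
      using K by (cases "y \<in> {0<..<x}") (auto intro!: ennreal_leI simp flip: ennreal_mult ennreal_plus)
  qed
  also have "\<dots> = ennreal K * (\<integral>\<^sup>+y\<in>{0<..<x}. ennreal (\<bar>X x - X y\<bar> * (x - y) powr (- 1 - \<alpha>)) \<partial>lborel)
      + ennreal K * (\<integral>\<^sup>+y\<in>{0<..<x}. ennreal ((x - y) powr (\<beta> - 1 - \<alpha>)) \<partial>lborel)"
    using m' by (simp add: nn_integral_add nn_integral_cmult)
  also have "\<dots> \<le> ennreal K * ennreal P + ennreal K * ennreal (x powr (\<beta> - \<alpha>) / (\<beta> - \<alpha>))"
    using P'(2) nn_integral_powr_Ioo_end[of "\<beta> - 1 - \<alpha>" 0 x] \<beta> x
    by (intro add_mono mult_left_mono) auto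
  also have "\<dots> = ennreal (K * P + K * (x powr (\<beta> - \<alpha>) / (\<beta> - \<alpha>)))"
    using K P \<beta> by (simp flip: ennreal_mult ennreal_plus)
  finally have L: "\<bar>?L\<bar> \<le> K * P + K * (x powr (\<beta> - \<alpha>) / (\<beta> - \<alpha>))"
    using K P \<beta> by (subst (asm) ennreal_le_iff) auto
  have xa: "1 \<le> T powr \<alpha> * x powr (- \<alpha>)"
  proof -
    have "x powr \<alpha> * x powr (- \<alpha>) \<le> T powr \<alpha> * x powr (- \<alpha>)"
      using x \<alpha> by (intro mult_right_mono powr_mono2) auto
    then show ?thesis using x by (simp flip: powr_add)
  qed
  have "x powr (\<beta> - \<alpha>) = x powr \<beta> * x powr (- \<alpha>)" by (simp flip: powr_add)
  also have "\<dots> \<le> T powr \<beta> * x powr (- \<alpha>)" using x \<alpha> \<beta> by (intro mult_right_mono powr_mono2) auto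
  finally have xb: "x powr (\<beta> - \<alpha>) \<le> T powr \<beta> * x powr (- \<alpha>)" .
  have "\<bar>f x / (x - 0) powr \<alpha> + \<alpha> * ?L\<bar> \<le> \<bar>f x\<bar> * x powr (- \<alpha>) + \<bar>?L\<bar>"
  proof -
    have "\<bar>f x / (x - 0) powr \<alpha>\<bar> = \<bar>f x\<bar> * x powr (- \<alpha>)" by (simp add: powr_minus_divide)
    moreover have "\<bar>\<alpha> * ?L\<bar> \<le> \<bar>?L\<bar>" using \<alpha> by (simp add: abs_mult mult_left_le_one_le)
    ultimately show ?thesis by linarith
  qed
  also have "\<dots> \<le> K * (1 + P) * x powr (- \<alpha>) + (K * P + K * (x powr (\<beta> - \<alpha>) / (\<beta> - \<alpha>)))"
    by (intro add_mono L mult_right_mono order.trans[OF f] mult_left_mono) (use P' K in auto)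
  also have "\<dots> \<le> K * (1 + P) * x powr (- \<alpha>) + (K * ((1 + P) * (T powr \<alpha> * x powr (- \<alpha>))) + K * ((1 + P) * (T powr \<beta> * x powr (- \<alpha>) / (\<beta> - \<alpha>))))"
  proof (intro add_left_mono add_mono mult_left_mono K)
    have "P * 1 \<le> (1 + P) * (T powr \<alpha> * x powr (- \<alpha>))" using P xa by (intro mult_mono) auto
    then show "P \<le> (1 + P) * (T powr \<alpha> * x powr (- \<alpha>))" by simp
    have "1 * (x powr (\<beta> - \<alpha>) / (\<beta> - \<alpha>)) \<le> (1 + P) * (T powr \<beta> * x powr (- \<alpha>) / (\<beta> - \<alpha>))"
      using P xb \<beta> by (intro mult_mono divide_right_mono) auto
    then show "x powr (\<beta> - \<alpha>) / (\<beta> - \<alpha>) \<le> (1 + P) * (T powr \<beta> * x powr (- \<alpha>) / (\<beta> - \<alpha>))" by simp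
  qed
  also have "\<dots> = K * (1 + T powr \<beta> / (\<beta> - \<alpha>) + T powr \<alpha>) * (1 + P) * x powr (- \<alpha>)"
    by (simp add: distrib_left distrib_right mult_ac)
  finally have main: "\<bar>f x / (x - 0) powr \<alpha> + \<alpha> * ?L\<bar> \<le> K * (1 + T powr \<beta> / (\<beta> - \<alpha>) + T powr \<alpha>) * (1 + P) * x powr (- \<alpha>)" .
  have "\<bar>frac_deriv_left \<alpha> 0 f x\<bar> = 1 / Gamma (1 - \<alpha>) * \<bar>f x / (x - 0) powr \<alpha> + \<alpha> * ?L\<bar>"
    unfolding frac_deriv_left_def abs_mult using Gp by simp
  also have "\<dots> \<le> 1 / Gamma (1 - \<alpha>) * (K * (1 + T powr \<beta> / (\<beta> - \<alpha>) + T powr \<alpha>) * (1 + P) * x powr (- \<alpha>))"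
    using Gp by (intro mult_left_mono main) auto
  finally show ?thesis by (simp add: frac_const_def)
qed

text \<open>One path of the equation: \<open>X\<close> solves it with integrator \<open>z\<close>, \<open>av\<close> and \<open>f\<close> are the paths of drift and of
  Stieltjes integrand, and \<open>J\<close> is the path of the Ito integral, which enters only through its initial value and
  its Hoelder continuity with exponent \<open>\<eta> > \<alpha>\<close>.\<close>

context
  fixes \<alpha> \<beta> \<eta> T K A \<xi> X0 :: real and z J X av f :: "real \<Rightarrow> real"
  assumes \<alpha>: "0 < \<alpha>" "\<alpha> < 1/2" and \<beta>: "\<alpha> < \<beta>" and \<eta>: "\<alpha> < \<eta>" and T: "0 < T" and K: "0 < K"
    and A0: "0 \<le> A" and \<xi>: "0 \<le> \<xi>"
    and zc: "continuous_on {0..T} z" and A: "pnorm_zero \<alpha> T z \<le> ennreal A"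
    and Xc: "continuous_on {0..T} X"
    and av: "\<And>s. s \<in> {0..T} \<Longrightarrow> \<bar>av s\<bar> \<le> K * (1 + \<bar>X s\<bar>)"
    and f: "\<And>s. s \<in> {0..T} \<Longrightarrow> \<bar>f s\<bar> \<le> K * (1 + \<bar>X s\<bar>)"
    and fd: "\<And>s r. s \<in> {0..T} \<Longrightarrow> r \<in> {0..T} \<Longrightarrow> \<bar>f s - f r\<bar> \<le> K * (\<bar>s - r\<bar> powr \<beta> + \<bar>X s - X r\<bar>)"
    and J0: "J 0 = 0" and J: "\<And>s t. s \<in> {0..T} \<Longrightarrow> t \<in> {0..T} \<Longrightarrow> \<bar>J t - J s\<bar> \<le> \<xi> * \<bar>t - s\<bar> powr \<eta>"
    and int: "\<And>t. t \<in> {0..T} \<Longrightarrow> set_integrable lborel {0..t} av"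
      "\<And>t. t \<in> {0..T} \<Longrightarrow> gls_integrable \<alpha> 0 t f z"
    and eq: "\<And>t. t \<in> {0..T} \<Longrightarrow>
      complex_of_real (X t) = complex_of_real (X0 + (LBINT s:{0..t}. av s) + J t) + gls_integral \<alpha> 0 t f z"
begin

text \<open>Given the a priori bound \<open>1 + pnorm \<alpha> y X \<le> S * exp (l * y)\<close>, drift and Stieltjes
  integral are dominated by integrals of the explicit function \<open>h\<close>, to which Fubini's theorem applies.\<close>

lemma smooth_part_bounds:
  assumes S: "\<And>y. y \<in> {0..T} \<Longrightarrow> pnorm \<alpha> y X \<le> ennreal (S * exp (l * y) - 1)" "1 \<le> S" and l: "0 < l"
    and t: "t \<in> {0..T}"
  defines "B \<equiv> S * ((1 + A) * (K * T powr \<alpha> + frac_const \<alpha> \<beta> T K / Gamma \<alpha>))"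
    and "h \<equiv> \<lambda>x. exp (l * x) * x powr (- \<alpha>)"
  shows "ennreal \<bar>X t - X0 - J t\<bar> \<le> ennreal B * (\<integral>\<^sup>+x\<in>{0<..<t}. ennreal (h x) \<partial>lborel)"
    and "0 < s \<Longrightarrow> s < t \<Longrightarrow> ennreal \<bar>(X t - J t) - (X s - J s)\<bar>
       \<le> ennreal B * (\<integral>\<^sup>+x\<in>{0<..<t}. ennreal (h x * inc_kernel \<alpha> t s x) \<partial>lborel)"
proof -
  let ?C = "frac_const \<alpha> \<beta> T K" and ?ka = "S * K * T powr \<alpha>"
  have Gp: "Gamma \<alpha> > 0" "Gamma (1 - \<alpha>) > 0" using \<alpha> by (simp_all add: Gamma_real_pos)
  have C: "?C \<ge> 0" using frac_const_nonneg[of \<alpha> \<beta> K T] \<alpha> \<beta> K by simp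
  have h0: "h x \<ge> 0" for x by (simp add: h_def)
  have hm[measurable]: "h \<in> borel_measurable borel" unfolding h_def by measurable
  have P0: "0 \<le> S * exp (l * y) - 1" if "y \<in> {0..T}" for y
  proof -
    have "1 * 1 \<le> S * exp (l * y)" using that S(2) l by (intro mult_mono) auto
    then show ?thesis by simp
  qed
  have D: "\<bar>frac_deriv_left \<alpha> 0 f x\<bar> \<le> S * ?C * h x" if x: "x \<in> {0<..<t}" for x
  proof -
    have xT: "x \<in> {0..T}" "0 < x" "x \<le> T" using x t by auto
    have "\<bar>frac_deriv_left \<alpha> 0 f x\<bar> \<le> ?C * (1 + (S * exp (l * x) - 1)) * x powr (- \<alpha>)"
    proof (rule frac_deriv_left_le[where X = X])
      show "continuous_on {0..T} X" "\<bar>f x\<bar> \<le> K * (1 + \<bar>X x\<bar>)" "0 \<le> S * exp (l * x) - 1"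
        "pnorm \<alpha> x X \<le> ennreal (S * exp (l * x) - 1)"
        using Xc f S(1) P0 xT by auto
      fix y assume y: "y \<in> {0<..<x}"
      then show "\<bar>f x - f y\<bar> \<le> K * ((x - y) powr \<beta> + \<bar>X x - X y\<bar>)"
        using fd[of x y] xT by auto
    qed (use \<alpha> \<beta> K xT in auto)
    then show ?thesis by (simp add: h_def mult_ac)
  qed
  have avle: "\<bar>av x\<bar> \<le> ?ka * h x" if x: "0 < x" "x \<le> T" for x
  proof -
    have xT: "x \<in> {0..T}" using x by auto
    have "x powr \<alpha> * x powr (- \<alpha>) \<le> T powr \<alpha> * x powr (- \<alpha>)"
      using x \<alpha> by (intro mult_right_mono powr_mono2) auto
    then have xa: "1 \<le> T powr \<alpha> * x powr (- \<alpha>)" using x by (simp flip: powr_add)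
    have "\<bar>av x\<bar> \<le> K * (1 + \<bar>X x\<bar>)" by (rule av[OF xT])
    also have "\<dots> \<le> K * (S * exp (l * x))"
      using pnorm_le_ennrealD(1)[OF S(1)[OF xT] P0[OF xT]] K by (intro mult_left_mono) auto
    also have "\<dots> * 1 \<le> K * (S * exp (l * x)) * (T powr \<alpha> * x powr (- \<alpha>))"
      using xa K S(2) by (intro mult_left_mono) auto
    finally show ?thesis by (simp add: h_def mult_ac)
  qed
  have Y: "complex_of_real (X u - X0 - J u) = of_real (LBINT s:{0..u}. av s) + gls_integral \<alpha> 0 u f z" if "u \<in> {0..T}" for u
    using eq[OF that] by (simp add: algebra_simps)
  \<comment> \<open>\<open>N\<close> stands for the integral of \<open>h\<close>, with or without the kernel.\<close>
  have comb: "ennreal ?ka * N + ennreal (A / Gamma \<alpha>) * (ennreal (S * ?C) * N) \<le> ennreal B * N" for N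
  proof -
    have "ennreal ?ka * N + ennreal (A / Gamma \<alpha>) * (ennreal (S * ?C) * N) = ennreal (?ka + A / Gamma \<alpha> * (S * ?C)) * N"
    proof -
      have nn: "0 \<le> A / Gamma \<alpha>" "0 \<le> S * ?C" "0 \<le> ?ka" using K S(2) A0 Gp C by auto
      have "ennreal ?ka * N + ennreal (A / Gamma \<alpha>) * (ennreal (S * ?C) * N)
          = (ennreal ?ka + ennreal (A / Gamma \<alpha>) * ennreal (S * ?C)) * N"
        by (simp only: distrib_right mult.assoc)
      also have "ennreal ?ka + ennreal (A / Gamma \<alpha>) * ennreal (S * ?C) = ennreal (?ka + A / Gamma \<alpha> * (S * ?C))"
        using nn by (simp only: ennreal_mult[symmetric] ennreal_plus[symmetric] mult_nonneg_nonneg)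
      finally show ?thesis .
    qed
    also have "\<dots> \<le> ennreal B * N"
    proof (intro mult_right_mono ennreal_leI)
      have "0 \<le> A * (K * T powr \<alpha>)" "0 \<le> ?C / Gamma \<alpha>" using A0 K C Gp by auto
      then have "K * T powr \<alpha> + A / Gamma \<alpha> * ?C \<le> (1 + A) * (K * T powr \<alpha> + ?C / Gamma \<alpha>)"
      proof -
        have "(1 + A) * (K * T powr \<alpha> + ?C / Gamma \<alpha>)
            = (K * T powr \<alpha> + A / Gamma \<alpha> * ?C) + (A * (K * T powr \<alpha>) + ?C / Gamma \<alpha>)"
          by (simp add: distrib_left distrib_right add_divide_distrib)
        then show ?thesis using \<open>0 \<le> A * (K * T powr \<alpha>)\<close> \<open>0 \<le> ?C / Gamma \<alpha>\<close> by linarith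
      qed
      then have "S * (K * T powr \<alpha> + A / Gamma \<alpha> * ?C) \<le> B"
        unfolding B_def using S(2) by (intro mult_left_mono) auto
      then show "?ka + A / Gamma \<alpha> * (S * ?C) \<le> B" by (simp add: algebra_simps)
    qed simp
    finally show ?thesis .
  qed
  have cH: "(\<integral>\<^sup>+x\<in>{0<..<t}. ennreal (c * g x) \<partial>lborel) = ennreal c * (\<integral>\<^sup>+x\<in>{0<..<t}. ennreal (g x) \<partial>lborel)"
    if "0 \<le> c" "g \<in> borel_measurable borel" for c and g :: "real \<Rightarrow> real"
    using that by (subst nn_integral_cmult[symmetric]) (auto simp: ennreal_mult' mult.assoc)
  have \<alpha>1: "\<alpha> < 1" using \<alpha> by simp
  have SC: "0 \<le> S * ?C" "0 \<le> ?ka" using S(2) C K by auto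
  have tT: "0 \<le> t" "t \<le> T" using t by auto
  have Hm: "(\<lambda>x. S * ?C * h x) \<in> borel_measurable borel" by measurable
  note gls = gls_integral_bounds[OF \<alpha>(1) \<alpha>1 zc A0 A Hm D tT int(2)[OF t]]
  show "ennreal \<bar>X t - X0 - J t\<bar> \<le> ennreal B * (\<integral>\<^sup>+x\<in>{0<..<t}. ennreal (h x) \<partial>lborel)"
  proof -
    have "\<bar>X t - X0 - J t\<bar> = cmod (of_real (LBINT s:{0..t}. av s) + gls_integral \<alpha> 0 t f z)"
      unfolding Y[OF t, symmetric] by (simp only: norm_of_real)
    also have "\<dots> \<le> norm (LBINT s:{0..t}. av s) + cmod (gls_integral \<alpha> 0 t f z)"
      by (rule order.trans[OF norm_triangle_ineq]) simp
    finally have "ennreal \<bar>X t - X0 - J t\<bar> \<le> ennreal (norm (LBINT s:{0..t}. av s)) + ennreal (cmod (gls_integral \<alpha> 0 t f z))"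
      by (simp flip: ennreal_plus)
    also have "ennreal (norm (LBINT s:{0..t}. av s)) \<le> (\<integral>\<^sup>+x\<in>{0..t}. ennreal (norm (av x)) \<partial>lborel)"
      by (rule norm_set_integral_le_nn_integral)
    also have "\<dots> = (\<integral>\<^sup>+x\<in>{0<..<t}. ennreal (norm (av x)) \<partial>lborel)" by (rule nn_integral_Icc_eq_Ioo)
    also have "\<dots> \<le> (\<integral>\<^sup>+x\<in>{0<..<t}. ennreal (?ka * h x) \<partial>lborel)"
      by (intro nn_integral_mono) (use avle tT in \<open>auto simp: indicator_def intro!: ennreal_leI\<close>)
    also have "\<dots> = ennreal ?ka * (\<integral>\<^sup>+x\<in>{0<..<t}. ennreal (h x) \<partial>lborel)" by (rule cH[OF SC(2) hm])
    also note gls(1)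
    also have "(\<integral>\<^sup>+x\<in>{0<..<t}. ennreal (S * ?C * h x) \<partial>lborel) = ennreal (S * ?C) * (\<integral>\<^sup>+x\<in>{0<..<t}. ennreal (h x) \<partial>lborel)"
      by (rule cH[OF SC(1) hm])
    also note comb
    finally show ?thesis by (simp add: add_mono)
  qed
  assume s: "0 < s" "s < t"
  then have sT: "s \<in> {0..T}" using t by auto
  have km: "(\<lambda>x. h x * inc_kernel \<alpha> t s x) \<in> borel_measurable borel" by measurable
  let ?N = "\<integral>\<^sup>+x\<in>{0<..<t}. ennreal (h x * inc_kernel \<alpha> t s x) \<partial>lborel"
  let ?E = "\<lambda>x. indicator {0..t} x *\<^sub>R av x - indicator {0..s} x *\<^sub>R av x"
  have "(X t - J t) - (X s - J s) = (X t - X0 - J t) - (X s - X0 - J s)" by simp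
  then have "\<bar>(X t - J t) - (X s - J s)\<bar> = cmod (of_real (X t - X0 - J t) - of_real (X s - X0 - J s))"
    by (metis norm_of_real of_real_diff)
  also have "\<dots> = cmod (of_real ((LBINT s:{0..t}. av s) - (LBINT s:{0..s}. av s)) + (gls_integral \<alpha> 0 t f z - gls_integral \<alpha> 0 s f z))"
    unfolding Y[OF t] Y[OF sT] by (simp add: algebra_simps)
  also have "\<dots> \<le> norm ((LBINT s:{0..t}. av s) - (LBINT s:{0..s}. av s)) + cmod (gls_integral \<alpha> 0 t f z - gls_integral \<alpha> 0 s f z)"
    by (rule order.trans[OF norm_triangle_ineq]) (simp only: norm_of_real real_norm_def)
  also have "(LBINT s:{0..t}. av s) - (LBINT s:{0..s}. av s) = integral\<^sup>L lborel ?E"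
    using int(1)[OF t] int(1)[OF sT] by (simp add: set_lebesgue_integral_def set_integrable_def)
  finally have "ennreal \<bar>(X t - J t) - (X s - J s)\<bar>
      \<le> ennreal (norm (integral\<^sup>L lborel ?E)) + ennreal (cmod (gls_integral \<alpha> 0 t f z - gls_integral \<alpha> 0 s f z))"
    by (simp flip: ennreal_plus)
  also have "ennreal (norm (integral\<^sup>L lborel ?E)) \<le> (\<integral>\<^sup>+x. ennreal (norm (?E x)) \<partial>lborel)"
    by (rule norm_integral_le_nn_integral)
  also have "\<dots> \<le> (\<integral>\<^sup>+x\<in>{0<..<t}. ennreal (?ka * (h x * inc_kernel \<alpha> t s x)) \<partial>lborel)"
  proof (rule nn_integral_mono_AE)
    show "AE x in lborel. ennreal (norm (?E x)) \<le> ennreal (?ka * (h x * inc_kernel \<alpha> t s x)) * indicator {0<..<t} x"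
      using AE_lborel_singleton[of t] AE_lborel_singleton[of s]
    proof eventually_elim
      case (elim x)
      show ?case
      proof (cases "x \<in> {s<..<t}")
        case True
        then show ?thesis using avle[of x] s tT
          by (auto simp: inc_kernel_def intro!: ennreal_leI)
      next
        case False
        then have "indicat_real {0..t} x = indicat_real {0..s} x" using elim s
          by (cases "x \<le> s") (auto simp: indicator_def)
        then show ?thesis by simp
      qed
    qed
  qed
  also have "\<dots> = ennreal ?ka * ?N" by (rule cH[OF SC(2) km])
  also have "ennreal (cmod (gls_integral \<alpha> 0 t f z - gls_integral \<alpha> 0 s f z))
      \<le> ennreal (A / Gamma \<alpha>) * (\<integral>\<^sup>+x\<in>{0<..<t}. ennreal (S * ?C * h x * inc_kernel \<alpha> t s x) \<partial>lborel)"
    by (rule gls(2)[OF _ s int(2)[OF sT]])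
  also have "(\<integral>\<^sup>+x\<in>{0<..<t}. ennreal (S * ?C * h x * inc_kernel \<alpha> t s x) \<partial>lborel) = ennreal (S * ?C) * ?N"
    using cH[OF SC(1) km] by (simp add: mult.assoc)
  also note comb
  finally show "ennreal \<bar>(X t - J t) - (X s - J s)\<bar> \<le> ennreal B * ?N" by (simp add: add_mono)
qed

text \<open>One step of the fixed point argument: the a priori bound with constant \<open>S\<close> reproduces itself with \<open>S\<close>
  multiplied by a factor of order \<open>l powr (2 * \<alpha> - 1)\<close>, small for large \<open>l\<close>, plus a term free of \<open>S\<close>.\<close>

lemma pnorm_step:
  assumes S: "\<And>y. y \<in> {0..T} \<Longrightarrow> pnorm \<alpha> y X \<le> ennreal (S * exp (l * y) - 1)" "1 \<le> S" and l: "0 < l"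
    and t: "t \<in> {0..T}"
  shows "pnorm \<alpha> t X \<le> ennreal (\<bar>X0\<bar> + \<xi> * (T powr \<eta> + T powr (\<eta> - \<alpha>) / (\<eta> - \<alpha>))
     + growth_const \<alpha> \<beta> T K * (1 + A) * l powr (2 * \<alpha> - 1) * S * exp (l * t))"
proof -
  define B where "B = S * ((1 + A) * (K * T powr \<alpha> + frac_const \<alpha> \<beta> T K / Gamma \<alpha>))"
  define h where "h = (\<lambda>x. exp (l * x) * x powr (- \<alpha>))"
  let ?\<kappa> = "1 / (1 - 2 * \<alpha>) + 1 / \<alpha>" and ?G = "2 * Gamma (1 - 2 * \<alpha>) * l powr (2 * \<alpha> - 1) * exp (l * t)"
  let ?H = "\<integral>\<^sup>+x\<in>{0<..<t}. ennreal (h x * (t - x) powr (- \<alpha>)) \<partial>lborel"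
  have sm: "ennreal \<bar>X t - X0 - J t\<bar> \<le> ennreal B * (\<integral>\<^sup>+x\<in>{0<..<t}. ennreal (h x) \<partial>lborel)"
    "\<And>s. 0 < s \<Longrightarrow> s < t \<Longrightarrow> ennreal \<bar>(X t - J t) - (X s - J s)\<bar>
       \<le> ennreal B * (\<integral>\<^sup>+x\<in>{0<..<t}. ennreal (h x * inc_kernel \<alpha> t s x) \<partial>lborel)"
    using smooth_part_bounds[OF S l t] unfolding B_def h_def by blast+
  have Gp: "Gamma \<alpha> > 0" "Gamma (1 - \<alpha>) > 0" "Gamma (1 - 2 * \<alpha>) > 0" using \<alpha> by (simp_all add: Gamma_real_pos)
  have C: "frac_const \<alpha> \<beta> T K \<ge> 0" using frac_const_nonneg[of \<alpha> \<beta> K T] \<alpha> \<beta> K by simp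
  have B0: "B \<ge> 0" unfolding B_def using S(2) A0 K C Gp by (intro mult_nonneg_nonneg add_nonneg_nonneg) auto
  have \<kappa>0: "?\<kappa> \<ge> 0" using \<alpha> by auto
  have tT: "0 \<le> t" "t \<le> T" using t by auto
  have h0: "h x \<ge> 0" for x by (simp add: h_def)
  have hm[measurable]: "h \<in> borel_measurable borel" unfolding h_def by measurable
  have H: "?H \<le> ennreal ?G" unfolding h_def by (rule nn_integral_exp_beta_le[OF \<alpha> l])
  have hH: "(\<integral>\<^sup>+x\<in>{0<..<t}. ennreal (h x) \<partial>lborel) \<le> ennreal (T powr \<alpha>) * ?H"
  proof -
    have "(\<integral>\<^sup>+x\<in>{0<..<t}. ennreal (h x) \<partial>lborel) \<le> (\<integral>\<^sup>+x. ennreal (T powr \<alpha>) * (ennreal (h x * (t - x) powr (- \<alpha>)) * indicator {0<..<t} x) \<partial>lborel)"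
    proof (rule nn_integral_mono)
      fix x
      have "h x \<le> T powr \<alpha> * (h x * (t - x) powr (- \<alpha>))" if x: "x \<in> {0<..<t}"
      proof -
        have "(t - x) powr \<alpha> * (t - x) powr (- \<alpha>) \<le> T powr \<alpha> * (t - x) powr (- \<alpha>)"
          using x \<alpha> tT by (intro mult_right_mono powr_mono2) auto
        then have "1 \<le> T powr \<alpha> * (t - x) powr (- \<alpha>)" using x by (simp flip: powr_add)
        then have "h x * 1 \<le> h x * (T powr \<alpha> * (t - x) powr (- \<alpha>))" using h0 by (intro mult_left_mono) auto
        then show ?thesis by (simp add: mult_ac)
      qed
      then show "ennreal (h x) * indicator {0<..<t} x \<le> ennreal (T powr \<alpha>) * (ennreal (h x * (t - x) powr (- \<alpha>)) * indicator {0<..<t} x)"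
        using h0[of x] by (cases "x \<in> {0<..<t}") (auto intro!: ennreal_leI simp flip: ennreal_mult)
    qed
    also have "\<dots> = ennreal (T powr \<alpha>) * ?H" by (rule nn_integral_cmult) measurable
    finally show ?thesis .
  qed
  have Jt: "\<bar>J t\<bar> \<le> \<xi> * T powr \<eta>"
  proof -
    have "\<bar>J t - J 0\<bar> \<le> \<xi> * \<bar>t - 0\<bar> powr \<eta>" using T t by (intro J) auto
    also have "\<dots> \<le> \<xi> * T powr \<eta>" using \<xi> tT \<alpha> \<eta> by (intro mult_left_mono powr_mono2) auto
    finally show ?thesis by (simp add: J0)
  qed
  have "ennreal \<bar>X t\<bar> \<le> ennreal (\<bar>X0\<bar> + \<bar>J t\<bar> + \<bar>X t - X0 - J t\<bar>)" by (intro ennreal_leI) linarith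
  also have "\<dots> = ennreal (\<bar>X0\<bar> + \<bar>J t\<bar>) + ennreal \<bar>X t - X0 - J t\<bar>" by simp
  also have "\<dots> \<le> ennreal (\<bar>X0\<bar> + \<xi> * T powr \<eta>) + ennreal B * (ennreal (T powr \<alpha>) * ?H)"
    using Jt by (intro add_mono ennreal_leI order.trans[OF sm(1)] mult_left_mono hH) auto
  finally have part1: "ennreal \<bar>X t\<bar> \<le> ennreal (\<bar>X0\<bar> + \<xi> * T powr \<eta>) + ennreal B * (ennreal (T powr \<alpha>) * ?H)" .
  let ?k = "\<lambda>s. \<integral>\<^sup>+x\<in>{0<..<t}. ennreal (h x * inc_kernel \<alpha> t s x) \<partial>lborel"
  have km[measurable]: "?k \<in> borel_measurable borel"
  proof -
    have "case_prod (\<lambda>s x. ennreal (h x * inc_kernel \<alpha> t s x) * indicator {0<..<t} x) \<in> borel_measurable (borel \<Otimes>\<^sub>M lborel)" by measurable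
    from lborel.borel_measurable_nn_integral[OF this] show ?thesis .
  qed
  have "(\<integral>\<^sup>+s\<in>{0<..<t}. ennreal (\<bar>X t - X s\<bar> * (t - s) powr (- 1 - \<alpha>)) \<partial>lborel)
     \<le> (\<integral>\<^sup>+s. ennreal \<xi> * (ennreal ((t - s) powr (\<eta> - 1 - \<alpha>)) * indicator {0<..<t} s)
          + ennreal B * (?k s * ennreal ((t - s) powr (- 1 - \<alpha>)) * indicator {0<..<t} s) \<partial>lborel)"
  proof (rule nn_integral_mono)
    fix s
    have "ennreal (\<bar>X t - X s\<bar> * (t - s) powr (- 1 - \<alpha>)) \<le> ennreal \<xi> * ennreal ((t - s) powr (\<eta> - 1 - \<alpha>))
          + ennreal B * (?k s * ennreal ((t - s) powr (- 1 - \<alpha>)))" if s: "s \<in> {0<..<t}"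
    proof -
      have sT: "s \<in> {0..T}" using s t by auto
      have "\<bar>X t - X s\<bar> \<le> \<bar>J t - J s\<bar> + \<bar>(X t - J t) - (X s - J s)\<bar>" by linarith
      also have "\<dots> \<le> \<xi> * (t - s) powr \<eta> + \<bar>(X t - J t) - (X s - J s)\<bar>" using J[OF sT t] s by simp
      finally have "\<bar>X t - X s\<bar> * (t - s) powr (- 1 - \<alpha>)
        \<le> (\<xi> * (t - s) powr \<eta> + \<bar>(X t - J t) - (X s - J s)\<bar>) * (t - s) powr (- 1 - \<alpha>)" by (intro mult_right_mono) auto
      also have "\<dots> = \<xi> * (t - s) powr (\<eta> - 1 - \<alpha>) + \<bar>(X t - J t) - (X s - J s)\<bar> * (t - s) powr (- 1 - \<alpha>)"
        by (simp add: distrib_right mult.assoc algebra_simps flip: powr_add)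
      finally have "ennreal (\<bar>X t - X s\<bar> * (t - s) powr (- 1 - \<alpha>))
        \<le> ennreal \<xi> * ennreal ((t - s) powr (\<eta> - 1 - \<alpha>)) + ennreal \<bar>(X t - J t) - (X s - J s)\<bar> * ennreal ((t - s) powr (- 1 - \<alpha>))"
        using \<xi> by (simp flip: ennreal_mult ennreal_plus)
      also have "\<dots> \<le> ennreal \<xi> * ennreal ((t - s) powr (\<eta> - 1 - \<alpha>)) + (ennreal B * ?k s) * ennreal ((t - s) powr (- 1 - \<alpha>))"
        using s by (intro add_left_mono mult_right_mono sm(2)) auto
      finally show ?thesis by (simp add: mult.assoc)
    qed
    then show "ennreal (\<bar>X t - X s\<bar> * (t - s) powr (- 1 - \<alpha>)) * indicator {0<..<t} s
        \<le> ennreal \<xi> * (ennreal ((t - s) powr (\<eta> - 1 - \<alpha>)) * indicator {0<..<t} s)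
          + ennreal B * (?k s * ennreal ((t - s) powr (- 1 - \<alpha>)) * indicator {0<..<t} s)"
      by (cases "s \<in> {0<..<t}") auto
  qed
  also have "\<dots> = ennreal \<xi> * (\<integral>\<^sup>+s\<in>{0<..<t}. ennreal ((t - s) powr (\<eta> - 1 - \<alpha>)) \<partial>lborel)
      + ennreal B * (\<integral>\<^sup>+s\<in>{0<..<t}. ?k s * ennreal ((t - s) powr (- 1 - \<alpha>)) \<partial>lborel)"
    by (subst nn_integral_add, measurable, subst nn_integral_cmult, measurable, subst nn_integral_cmult, measurable)
  also have "\<dots> \<le> ennreal \<xi> * ennreal (T powr (\<eta> - \<alpha>) / (\<eta> - \<alpha>)) + ennreal B * (ennreal ?\<kappa> * ?H)"
  proof (intro add_mono mult_left_mono)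
    show "(\<integral>\<^sup>+s\<in>{0<..<t}. ennreal ((t - s) powr (\<eta> - 1 - \<alpha>)) \<partial>lborel) \<le> ennreal (T powr (\<eta> - \<alpha>) / (\<eta> - \<alpha>))"
      using nn_integral_powr_Ioo_end[of "\<eta> - 1 - \<alpha>" 0 t] tT \<eta>
      by (auto intro!: ennreal_leI divide_right_mono powr_mono2)
    show "(\<integral>\<^sup>+s\<in>{0<..<t}. ?k s * ennreal ((t - s) powr (- 1 - \<alpha>)) \<partial>lborel) \<le> ennreal ?\<kappa> * ?H"
      by (rule inc_kernel_fubini[OF \<alpha> hm h0])
  qed auto
  finally have part2: "(\<integral>\<^sup>+s\<in>{0<..<t}. ennreal (\<bar>X t - X s\<bar> * (t - s) powr (- 1 - \<alpha>)) \<partial>lborel)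
     \<le> ennreal \<xi> * ennreal (T powr (\<eta> - \<alpha>) / (\<eta> - \<alpha>)) + ennreal B * (ennreal ?\<kappa> * ?H)" .
  have "pnorm \<alpha> t X \<le> (ennreal (\<bar>X0\<bar> + \<xi> * T powr \<eta>) + ennreal B * (ennreal (T powr \<alpha>) * ?H))
      + (ennreal \<xi> * ennreal (T powr (\<eta> - \<alpha>) / (\<eta> - \<alpha>)) + ennreal B * (ennreal ?\<kappa> * ?H))"
    unfolding pnorm_def by (intro add_mono part1 part2)
  also have "\<dots> \<le> (ennreal (\<bar>X0\<bar> + \<xi> * T powr \<eta>) + ennreal B * (ennreal (T powr \<alpha>) * ennreal ?G))
      + (ennreal \<xi> * ennreal (T powr (\<eta> - \<alpha>) / (\<eta> - \<alpha>)) + ennreal B * (ennreal ?\<kappa> * ennreal ?G))"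
    by (intro add_mono mult_left_mono order_refl H) auto
  also have "\<dots> = ennreal ((\<bar>X0\<bar> + \<xi> * T powr \<eta> + B * (T powr \<alpha> * ?G)) + (\<xi> * (T powr (\<eta> - \<alpha>) / (\<eta> - \<alpha>)) + B * (?\<kappa> * ?G)))"
  proof -
    have "0 \<le> ?G" using Gp by simp
    moreover have "0 \<le> T powr (\<eta> - \<alpha>) / (\<eta> - \<alpha>)" using \<eta> by simp
    ultimately show ?thesis using \<xi> B0 \<kappa>0 by (simp only: ennreal_mult[symmetric] ennreal_plus[symmetric] mult_nonneg_nonneg add_nonneg_nonneg abs_ge_zero powr_ge_zero)
  qed
  also have "(\<bar>X0\<bar> + \<xi> * T powr \<eta> + B * (T powr \<alpha> * ?G)) + (\<xi> * (T powr (\<eta> - \<alpha>) / (\<eta> - \<alpha>)) + B * (?\<kappa> * ?G))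
      = \<bar>X0\<bar> + \<xi> * (T powr \<eta> + T powr (\<eta> - \<alpha>) / (\<eta> - \<alpha>)) + B * ((T powr \<alpha> + ?\<kappa>) * ?G)"
    by (simp only: distrib_left distrib_right add_ac)
  also have "B * ((T powr \<alpha> + ?\<kappa>) * ?G) = growth_const \<alpha> \<beta> T K * (1 + A) * l powr (2 * \<alpha> - 1) * S * exp (l * t)"
    unfolding B_def growth_const_def by (simp only: mult_ac)
  finally show ?thesis .
qed

text \<open>The best constant \<open>S\<close> is finite because the norm is, and for the
  chosen \<open>l\<close> the previous step gives \<open>S \<le> R + S / 2\<close>. Solving \<open>(1 + A) * l powr (2 * \<alpha> - 1) \<sim> 1\<close> for \<open>l\<close> is the
  origin of the exponent \<open>1 / (1 - 2 * \<alpha>)\<close>.\<close>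

lemma pnorm_sup_bound:
  assumes fin: "pnorm_sup \<alpha> T X < \<infinity>"
  shows "pnorm_sup \<alpha> T X \<le> ennreal (2 * (1 + \<bar>X0\<bar> + \<xi> * (T powr \<eta> + T powr (\<eta> - \<alpha>) / (\<eta> - \<alpha>)))
      * exp (T * (2 * growth_const \<alpha> \<beta> T K * (1 + A)) powr (1 / (1 - 2 * \<alpha>))))"
proof -
  let ?g = "growth_const \<alpha> \<beta> T K"
  define R where "R = 1 + \<bar>X0\<bar> + \<xi> * (T powr \<eta> + T powr (\<eta> - \<alpha>) / (\<eta> - \<alpha>))"
  define l where "l = (2 * ?g * (1 + A)) powr (1 / (1 - 2 * \<alpha>))"
  have g: "?g > 0" by (rule growth_const_pos[OF \<alpha> \<beta> T K])
  have gA: "2 * ?g * (1 + A) > 0" using g A0 by (intro mult_pos_pos) auto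
  have l: "l > 0" unfolding l_def powr_gt_zero using gA by linarith
  have half: "?g * (1 + A) * l powr (2 * \<alpha> - 1) = 1/2"
  proof -
    have "l powr (2 * \<alpha> - 1) = (2 * ?g * (1 + A)) powr (1 / (1 - 2 * \<alpha>) * (2 * \<alpha> - 1))" by (simp add: l_def powr_powr)
    also have "1 / (1 - 2 * \<alpha>) * (2 * \<alpha> - 1) = -1" using \<alpha> by (simp add: field_simps)
    finally have "l powr (2 * \<alpha> - 1) = 1 / (2 * ?g * (1 + A))" using gA by (simp add: powr_minus_divide)
    moreover have "?g \<noteq> 0" "1 + A \<noteq> 0" using g A0 by auto
    then have "?g * (1 + A) / (2 * (?g * (1 + A))) = 1 / 2" by simp
    ultimately show ?thesis by (simp only: mult.assoc times_divide_eq_right mult_1_right)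
  qed
  define \<phi> where "\<phi> t = enn2real (pnorm \<alpha> t X)" for t
  define N where "N = enn2real (pnorm_sup \<alpha> T X)"
  have le_sup: "pnorm \<alpha> t X \<le> pnorm_sup \<alpha> T X" if "t \<in> {0..T}" for t
    unfolding pnorm_sup_def by (rule SUP_upper[OF that])
  have \<phi>: "pnorm \<alpha> t X = ennreal (\<phi> t)" "0 \<le> \<phi> t" "\<phi> t \<le> N" if "t \<in> {0..T}" for t
    using le_sup[OF that] fin unfolding \<phi>_def N_def
    by (auto simp: enn2real_mono less_top[symmetric] intro!: ennreal_enn2real[symmetric] order.strict_trans1[OF le_sup[OF that]])
  \<comment> \<open>The smallest constant admissible in the a priori bound.\<close>
  define S where "S = (SUP t\<in>{0..T}. exp (- l * t) * (1 + \<phi> t))"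
  have bdd: "bdd_above ((\<lambda>t. exp (- l * t) * (1 + \<phi> t)) ` {0..T})"
  proof (rule bdd_aboveI2)
    fix t assume t: "t \<in> {0..T}"
    then have "exp (- l * t) * (1 + \<phi> t) \<le> 1 * (1 + N)" using \<phi>[OF t] l by (intro mult_mono) auto
    then show "exp (- l * t) * (1 + \<phi> t) \<le> 1 + N" by simp
  qed
  have ub: "exp (- l * t) * (1 + \<phi> t) \<le> S" if "t \<in> {0..T}" for t
    unfolding S_def by (rule cSUP_upper[OF that bdd])
  have ub': "1 + \<phi> t \<le> S * exp (l * t)" if "t \<in> {0..T}" for t
  proof -
    have "1 + \<phi> t = (exp (- l * t) * (1 + \<phi> t)) * exp (l * t)" by (simp add: mult.assoc mult.commute[of "1 + \<phi> t"] flip: exp_add mult.assoc)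
    also have "\<dots> \<le> S * exp (l * t)" by (intro mult_right_mono ub that) simp
    finally show ?thesis .
  qed
  have S1: "1 \<le> S" using ub[of 0] \<phi>[of 0] T by simp
  have S2: "S \<le> R + S / 2"
  proof -
    have "exp (- l * t) * (1 + \<phi> t) \<le> R + S / 2" if t: "t \<in> {0..T}" for t
    proof -
      have R1: "R \<ge> 1" unfolding R_def using \<xi> \<eta> by (simp add: add_nonneg_nonneg)
      have "ennreal (\<phi> t) \<le> ennreal (\<bar>X0\<bar> + \<xi> * (T powr \<eta> + T powr (\<eta> - \<alpha>) / (\<eta> - \<alpha>)) + ?g * (1 + A) * l powr (2 * \<alpha> - 1) * S * exp (l * t))"
        unfolding \<phi>(1)[OF t, symmetric]
      proof (rule pnorm_step[OF _ S1 l t])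
        fix y assume y: "y \<in> {0..T}"
        show "pnorm \<alpha> y X \<le> ennreal (S * exp (l * y) - 1)"
          unfolding \<phi>(1)[OF y] using ub'[OF y] by (intro ennreal_leI) auto
      qed
      then have "ennreal (\<phi> t) \<le> ennreal (R - 1 + S / 2 * exp (l * t))" unfolding half by (simp add: R_def)
      moreover have "0 \<le> R - 1 + S / 2 * exp (l * t)" using R1 S1 by (intro add_nonneg_nonneg mult_nonneg_nonneg) auto
      ultimately have "\<phi> t \<le> R - 1 + S / 2 * exp (l * t)" by (simp only: ennreal_le_iff)
      then have "exp (- l * t) * (1 + \<phi> t) \<le> exp (- l * t) * (R + S / 2 * exp (l * t))" by (intro mult_left_mono) auto
      also have "\<dots> = exp (- l * t) * R + S / 2" by (simp add: distrib_left mult.left_commute flip: exp_add)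
      also have "\<dots> \<le> 1 * R + S / 2" using R1 l t by (intro add_right_mono mult_right_mono) auto
      finally show ?thesis by simp
    qed
    then show ?thesis unfolding S_def using T by (intro cSUP_least) (auto simp: S_def[symmetric])
  qed
  then have S2R: "S \<le> 2 * R" by simp
  have "pnorm \<alpha> t X \<le> ennreal (2 * R * exp (T * l))" if t: "t \<in> {0..T}" for t
  proof -
    have "\<phi> t \<le> S * exp (l * t)" using ub'[OF t] by simp
    also have "\<dots> \<le> 2 * R * exp (T * l)" using S2R S1 t l by (intro mult_mono) (auto simp: mult.commute intro!: mult_left_mono)
    finally show ?thesis unfolding \<phi>(1)[OF t] by (rule ennreal_leI)
  qed
  then show ?thesis unfolding pnorm_sup_def R_def l_def by (intro SUP_least) auto
qed

end

section \<open>Moments of the solution\<close>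

lemma continuous_on_if_hoelder:
  fixes z :: "real \<Rightarrow> real"
  assumes "\<gamma> > 0" and "\<And>s t. s \<in> S \<Longrightarrow> t \<in> S \<Longrightarrow> \<bar>z s - z t\<bar> \<le> C * \<bar>s - t\<bar> powr \<gamma>"
  shows "continuous_on S z"
  unfolding continuous_on_def
proof
  fix t assume t: "t \<in> S"
  have "((\<lambda>s. \<bar>s - t\<bar>) \<longlongrightarrow> \<bar>t - t\<bar>) (at t within S)" by (intro tendsto_intros)
  then have "((\<lambda>s. C * \<bar>s - t\<bar> powr \<gamma>) \<longlongrightarrow> C * \<bar>t - t\<bar> powr \<gamma>) (at t within S)"
    by (intro tendsto_mult[OF tendsto_const] tendsto_powr' tendsto_const) (use assms(1) in auto)
  then have "((\<lambda>s. C * \<bar>s - t\<bar> powr \<gamma>) \<longlongrightarrow> 0) (at t within S)" by simp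
  then have "((\<lambda>s. z s - z t) \<longlongrightarrow> 0) (at t within S)"
    by (rule Lim_null_comparison[rotated])
       (use assms(2) t in \<open>auto simp: eventually_at_filter\<close>)
  then show "(z \<longlongrightarrow> z t) (at t within S)" by (simp add: LIM_zero_iff)
qed

text \<open>The \<open>p\<close>-th power of the pathwise bound is a product of a power of \<open>1 + \<xi>\<close> and an exponential of a
  multiple of \<open>(1 + A) powr q\<close>. The inequality \<open>u * v \<le> u\<^sup>2 + v\<^sup>2\<close>, used twice, separates \<open>\<xi>\<close>, \<open>A\<close> and the constants, and
  each term is integrable on its own. If \<open>P = \<infinity>\<close>, the right-hand side is infinite.\<close>

lemma pathwise_moment_split:
  assumes pos: "0 < p" "0 < q" "0 < g" "0 < T" "0 \<le> N" "0 \<le> x0" "0 \<le> \<xi>" and m: "2 * p \<le> real m"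
    and le: "\<And>A. 0 \<le> A \<Longrightarrow> P = ennreal A \<Longrightarrow>
      S \<le> ennreal (2 * (1 + x0 + \<xi> * N) * exp (T * (2 * g * (1 + A)) powr q))"
  shows "ennreal_rpow S p \<le> ennreal_exp (ennreal (4 * p * T * (4 * g) powr q) * ennreal_rpow P q)
    + (ennreal ((2 * (1 + x0 + N)) powr (2 * p) * 2 ^ m * (1 + \<xi> ^ m)) + ennreal (exp (4 * p * T * (4 * g) powr q)))"
proof (cases P)
  case top
  then show ?thesis using pos by (simp add: ennreal_rpow_def ennreal_exp_def ennreal_mult_top)
next
  case (real A)
  let ?\<theta> = "2 * p * T * (4 * g) powr q" and ?c = "2 * (1 + x0 + N)"
  let ?a = "2 * (1 + x0 + \<xi> * N)" and ?e = "T * (2 * g * (1 + A)) powr q"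
  have \<theta>: "?\<theta> \<ge> 0" using pos by simp
  have S: "S \<le> ennreal (?a * exp ?e)" using le real by auto
  have a: "0 < ?a" "?a \<le> ?c * (1 + \<xi>)"
    using pos by (auto simp: algebra_simps add_pos_nonneg intro!: add_nonneg_nonneg)
  have "(1 + A) powr q \<le> (2 * max 1 A) powr q" using pos real by (intro powr_mono2) auto
  also have "\<dots> = 2 powr q * max 1 A powr q" by (simp add: powr_mult)
  also have "\<dots> \<le> 2 powr q * (1 + A powr q)" by (intro mult_left_mono) (auto simp: max_def)
  finally have "(2 * g) powr q * (1 + A) powr q \<le> (2 * g) powr q * (2 powr q * (1 + A powr q))" by (intro mult_left_mono) auto
  also have "(2 * g) powr q * (2 powr q * (1 + A powr q)) = (4 * g) powr q * (1 + A powr q)"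
    by (simp add: powr_mult[symmetric] mult.assoc[symmetric])
  finally have pw: "(2 * g * (1 + A)) powr q \<le> (4 * g) powr q * (1 + A powr q)" by (simp add: powr_mult)
  have "ennreal_rpow S p \<le> ennreal ((?a * exp ?e) powr p)"
  proof -
    have "S \<noteq> \<infinity>" using S by (auto simp: top_unique)
    moreover have "enn2real S \<le> ?a * exp ?e" using enn2real_mono[OF S] a by (simp add: less_imp_le)
    ultimately show ?thesis using pos by (auto simp: ennreal_rpow_def intro!: ennreal_leI powr_mono2)
  qed
  also have "(?a * exp ?e) powr p \<le> exp (4 * p * T * (4 * g) powr q * A powr q)
      + (?c powr (2 * p) * 2 ^ m * (1 + \<xi> ^ m) + exp (4 * p * T * (4 * g) powr q))"
  proof -
    have sq: "u * v \<le> u\<^sup>2 + v\<^sup>2" for u v :: real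
      using zero_le_power2[of "u - v"] zero_le_power2[of u] zero_le_power2[of v] unfolding power2_diff by linarith
    have e2: "(exp (p * ?e))\<^sup>2 \<le> exp (4 * p * T * (4 * g) powr q * A powr q) + exp (4 * p * T * (4 * g) powr q)"
    proof -
      have "(exp (p * ?e))\<^sup>2 = exp (2 * p * T * (2 * g * (1 + A)) powr q)"
        by (simp add: mult_ac flip: exp_double)
      also have "\<dots> \<le> exp (2 * p * T * ((4 * g) powr q * (1 + A powr q)))"
        unfolding exp_le_cancel_iff by (rule mult_left_mono[OF pw]) (use pos in auto)
      also have "\<dots> = exp ?\<theta> * exp (?\<theta> * A powr q)" by (simp add: algebra_simps flip: exp_add)
      also have "\<dots> \<le> (exp ?\<theta>)\<^sup>2 + (exp (?\<theta> * A powr q))\<^sup>2" by (rule sq)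
      finally show ?thesis by (simp add: mult_ac flip: exp_double)
    qed
    have x2: "(?a powr p)\<^sup>2 \<le> ?c powr (2 * p) * 2 ^ m * (1 + \<xi> ^ m)"
    proof -
      have "(?a powr p)\<^sup>2 = ?a powr (2 * p)" by (simp add: power2_eq_square flip: powr_add)
      also have "\<dots> \<le> (?c * (1 + \<xi>)) powr (2 * p)" using a pos by (intro powr_mono2) auto
      also have "\<dots> = ?c powr (2 * p) * (1 + \<xi>) powr (2 * p)" by (rule powr_mult)
      also have "(1 + \<xi>) powr (2 * p) \<le> (1 + \<xi>) powr real m" using pos m by (intro powr_mono) auto
      also have "\<dots> = (1 + \<xi>) ^ m" using pos by (simp add: powr_realpow)
      also have "\<dots> \<le> (2 * max 1 \<xi>) ^ m" using pos by (intro power_mono) auto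
      also have "\<dots> \<le> 2 ^ m * (1 + \<xi> ^ m)" using pos by (auto simp: power_mult_distrib max_def)
      finally show ?thesis by (simp add: mult.assoc mult_left_mono)
    qed
    have "(?a * exp ?e) powr p = ?a powr p * exp (p * ?e)"
    proof -
      have "exp ?e powr p = exp (p * ?e)" by (simp add: powr_def)
      then show ?thesis by (simp only: powr_mult[of ?a "exp ?e"])
    qed
    also have "\<dots> \<le> (?a powr p)\<^sup>2 + (exp (p * ?e))\<^sup>2" by (rule sq)
    finally show ?thesis using e2 x2 by linarith
  qed
  then have "ennreal ((?a * exp ?e) powr p) \<le> ennreal (exp (4 * p * T * (4 * g) powr q * A powr q)
      + (?c powr (2 * p) * 2 ^ m * (1 + \<xi> ^ m) + exp (4 * p * T * (4 * g) powr q)))" by (rule ennreal_leI)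
  also have "\<dots> = ennreal (exp (4 * p * T * (4 * g) powr q * A powr q))
      + (ennreal (?c powr (2 * p) * 2 ^ m * (1 + \<xi> ^ m)) + ennreal (exp (4 * p * T * (4 * g) powr q)))"
    using pos by (simp add: ennreal_plus[symmetric] del: ennreal_plus)
  also have "ennreal (exp (4 * p * T * (4 * g) powr q * A powr q))
      = ennreal_exp (ennreal (4 * p * T * (4 * g) powr q) * ennreal_rpow P q)"
    using real pos by (simp add: ennreal_rpow_def ennreal_exp_def flip: ennreal_mult)
  finally show ?thesis .
qed

theorem proposition2p1:
  fixes M :: "'a measure" and F :: "real \<Rightarrow> 'a measure"
    and T \<gamma> \<alpha> X0 K K1 \<beta> :: real
    and W Z X :: "real \<Rightarrow> 'a \<Rightarrow> real"
    and a b c :: "real \<Rightarrow> real \<Rightarrow> real"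
  assumes "prob_space M" and "complete_measure M"
    and "T > 0" and "1/2 < \<gamma>" and "\<gamma> \<le> 1" and "1 - \<gamma> < \<alpha>" and "\<alpha> < 1/2"
    and "usual_filtration M T F"
    and "wiener_process M T F W"
    and "adapted_on T F Z" and "hoelder_paths M T \<gamma> Z"
    and "K > 0" and "K1 > 0" and "\<beta> > 1/2"
    and "\<And>t x. t \<in> {0..T} \<Longrightarrow> c t field_differentiable at x"
    and "\<And>t x. t \<in> {0..T} \<Longrightarrow> \<bar>a t x\<bar> + \<bar>b t x\<bar> + \<bar>c t x\<bar> \<le> K * (1 + \<bar>x\<bar>)"
    and "\<And>t x. t \<in> {0..T} \<Longrightarrow> \<bar>deriv (c t) x\<bar> \<le> K"
    and "\<And>t x. t \<in> {0..T} \<Longrightarrow> \<bar>b t x\<bar> \<le> K1"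
    and "\<And>t x y. t \<in> {0..T} \<Longrightarrow>
      \<bar>a t x - a t y\<bar> + \<bar>b t x - b t y\<bar> + \<bar>deriv (c t) x - deriv (c t) y\<bar> \<le> K * \<bar>x - y\<bar>"
    and "\<And>s t x. s \<in> {0..T} \<Longrightarrow> t \<in> {0..T} \<Longrightarrow>
      \<bar>a s x - a t x\<bar> + \<bar>b s x - b t x\<bar> + \<bar>c s x - c t x\<bar> + \<bar>deriv (c s) x - deriv (c t) x\<bar>
        \<le> K * \<bar>s - t\<bar> powr \<beta>"
    and "\<And>\<theta>::real. \<theta> > 0 \<Longrightarrow>
      (\<integral>\<^sup>+\<omega>. ennreal_exp (ennreal \<theta> *
          ennreal_rpow (pnorm_zero \<alpha> T (\<lambda>t. Z t \<omega>)) (1 / (1 - 2 * \<alpha>))) \<partial>M) < \<infinity>"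
    and "mixed_sde_solution M T F \<alpha> a b c W Z X0 X"
    and "AE \<omega> in M. pnorm_sup \<alpha> T (\<lambda>t. X t \<omega>) < \<infinity>"
  shows "(\<forall>p::real. p > 0 \<longrightarrow> (SUP t\<in>{0..T}. \<integral>\<^sup>+\<omega>. ennreal (\<bar>X t \<omega>\<bar> powr p) \<partial>M) < \<infinity>)
    \<and> (\<forall>p::real. p > 0 \<longrightarrow> (\<integral>\<^sup>+\<omega>. ennreal_rpow (pnorm_sup \<alpha> T (\<lambda>t. X t \<omega>)) p \<partial>M) < \<infinity>)"
proof -
  interpret prob_space M by fact
  note T = \<open>T > 0\<close> and K = \<open>K > 0\<close>
  note growth = assms(16) and dc_le = assms(17) and b_le = assms(18) and time_reg = assms(20) and exp_mom = assms(21)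
  have \<alpha>: "0 < \<alpha>" "\<alpha> < 1/2" using assms(5,6,7) by auto
  have \<beta>: "\<alpha> < \<beta>" using \<alpha> \<open>\<beta> > 1/2\<close> by simp
  \<comment> \<open>Any exponent strictly between \<open>\<alpha>\<close> and \<open>1/2\<close> will do.\<close>
  define \<eta> where "\<eta> = (\<alpha> + 1/2) / 2"
  have \<eta>: "\<alpha> < \<eta>" "0 < \<eta>" "\<eta> < 1/2" using \<alpha> by (auto simp: \<eta>_def)
  define q where "q = 1 / (1 - 2 * \<alpha>)"
  define g where "g = growth_const \<alpha> \<beta> T K"
  define N where "N = T powr \<eta> + T powr (\<eta> - \<alpha>) / (\<eta> - \<alpha>)"
  have q: "0 < q" using \<alpha> by (simp add: q_def)
  have N: "0 \<le> N" using \<eta> by (simp add: N_def)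
  have g: "0 < g" unfolding g_def by (rule growth_const_pos[OF \<alpha> \<beta> T K])
  have sol: "continuous_paths M T X"
    using assms(22) by (simp add: mixed_sde_solution_def)
  obtain I where I: "ito_integral M T F W (\<lambda>s \<omega>. b s (X s \<omega>)) I"
    and eq: "AE \<omega> in M. \<forall>t\<in>{0..T}.
           set_integrable lborel {0..t} (\<lambda>s. a s (X s \<omega>)) \<and>
           gls_integrable \<alpha> 0 t (\<lambda>s. c s (X s \<omega>)) (\<lambda>s. Z s \<omega>) \<and>
           complex_of_real (X t \<omega>) =
             complex_of_real (X0 + (LBINT s:{0..t}. a s (X s \<omega>)) + I t \<omega>)
             + gls_integral \<alpha> 0 t (\<lambda>s. c s (X s \<omega>)) (\<lambda>s. Z s \<omega>)"
    using assms(22) unfolding mixed_sde_solution_def by blast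
  have Im: "I t \<in> borel_measurable M" if "t \<in> {0..T}" for t
  proof -
    have "subalgebra M (F t)" "I t \<in> borel_measurable (F t)"
      using assms(8) I that by (auto simp: usual_filtration_def ito_integral_def adapted_on_def)
    then show ?thesis using measurable_from_subalg by blast
  qed
  have I_cont: "continuous_paths M T I" using I by (simp add: ito_integral_def)
  have c_lip: "\<bar>c t x - c t y\<bar> \<le> K * \<bar>x - y\<bar>" if t: "t \<in> {0..T}" for t x y
  proof -
    have "norm (c t x - c t y) \<le> K * norm (x - y)"
    proof (rule field_differentiable_bound[of UNIV _ "deriv (c t)"])
      show "(c t has_field_derivative deriv (c t) z) (at z within UNIV)" for z
        using assms(15)[OF t, of z] by (simp add: DERIV_deriv_iff_field_differentiable)
    qed (use dc_le[OF t] in auto)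
    then show ?thesis by simp
  qed
  have moment: "(\<integral>\<^sup>+\<omega>. ennreal_rpow (pnorm_sup \<alpha> T (\<lambda>t. X t \<omega>)) p \<partial>M) < \<infinity>" if p: "p > 0" for p
  proof -
    \<comment> \<open>Large enough for \<open>(1 + \<xi>) powr (2 * p)\<close> to be integrable and for the dyadic series to converge.\<close>
    define m where "m = nat \<lceil>2 * p\<rceil> + nat \<lceil>1 / (1/2 - \<eta>)\<rceil> + 1"
    have m: "m > 0" "2 * p \<le> real m" "1 / (1/2 - \<eta>) < real m"
      using real_nat_ceiling_ge[of "2 * p"] real_nat_ceiling_ge[of "1 / (1/2 - \<eta>)"]
      unfolding m_def of_nat_add by linarith+
    have m': "\<eta> * real m + 1 < real m / 2"
      using m(3) \<eta> by (simp add: divide_less_eq algebra_simps)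
    let ?C = "2 * fact m * exp (K1\<^sup>2)"
    obtain \<xi> :: "'a \<Rightarrow> real" where \<xi>m[measurable]: "\<xi> \<in> borel_measurable M" and \<xi>0: "\<And>\<omega>. \<xi> \<omega> \<ge> 0"
      and \<xi>_mom: "(\<integral>\<^sup>+\<omega>. ennreal (\<xi> \<omega> ^ m) \<partial>M) < \<infinity>"
      and \<xi>: "AE \<omega> in M. \<forall>s\<in>{0..T}. \<forall>t\<in>{0..T}. \<bar>I t \<omega> - I s \<omega>\<bar> \<le> \<xi> \<omega> * \<bar>t - s\<bar> powr \<eta>"
    proof (rule hoelder_modulus_moment[OF T \<eta>(2) m(1) m' Im I_cont, of ?C])
      fix s t :: real assume "0 \<le> s" "s < t" "t \<le> T"
      then show "(\<integral>\<^sup>+\<omega>. ennreal (\<bar>I t \<omega> - I s \<omega>\<bar> ^ m) \<partial>M) \<le> ennreal (?C * (t - s) powr (m / 2))"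
        by (intro ito_integral_increment_moment[OF assms(8,9) I]) (use b_le in auto)
    qed auto
    \<comment> \<open>The functional of \<open>Z\<close> goes into \<open>?U\<close>, which need not be measurable; \<open>?V\<close> is measurable.\<close>
    let ?\<theta> = "4 * p * T * (4 * g) powr q"
    let ?U = "\<lambda>\<omega>. ennreal_exp (ennreal ?\<theta> * ennreal_rpow (pnorm_zero \<alpha> T (\<lambda>t. Z t \<omega>)) q)"
    let ?V = "\<lambda>\<omega>. ennreal ((2 * (1 + \<bar>X0\<bar> + N)) powr (2 * p) * 2 ^ m * (1 + \<xi> \<omega> ^ m)) + ennreal (exp ?\<theta>)"
    have "AE \<omega> in M. ennreal_rpow (pnorm_sup \<alpha> T (\<lambda>t. X t \<omega>)) p \<le> ?U \<omega> + ?V \<omega>"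
      using \<xi> eq assms(23) sol[unfolded continuous_paths_def] assms(11)[unfolded hoelder_paths_def]
        ito_integral_at_0[OF I T]
    proof eventually_elim
      case (elim \<omega>)
      have "\<exists>C. \<forall>s\<in>{0..T}. \<forall>t\<in>{0..T}. \<bar>Z s \<omega> - Z t \<omega>\<bar> \<le> C * \<bar>s - t\<bar> powr \<gamma>" using elim by blast
      then obtain C where C: "\<And>s t. s \<in> {0..T} \<Longrightarrow> t \<in> {0..T} \<Longrightarrow> \<bar>Z s \<omega> - Z t \<omega>\<bar> \<le> C * \<bar>s - t\<bar> powr \<gamma>" by blast
      have zc: "continuous_on {0..T} (\<lambda>t. Z t \<omega>)"
        by (rule continuous_on_if_hoelder[of \<gamma> _ _ C]) (use C assms(4) in auto)
      show ?case
      proof (rule pathwise_moment_split[OF p q g T N abs_ge_zero \<xi>0 m(2)])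
        fix A assume A: "0 \<le> A" "pnorm_zero \<alpha> T (\<lambda>t. Z t \<omega>) = ennreal A"
        show "pnorm_sup \<alpha> T (\<lambda>t. X t \<omega>) \<le> ennreal (2 * (1 + \<bar>X0\<bar> + \<xi> \<omega> * N) * exp (T * (2 * g * (1 + A)) powr q))"
          unfolding N_def g_def q_def
        proof (rule pnorm_sup_bound[OF \<alpha> \<beta> \<eta>(1) T K A(1) \<xi>0 zc])
          fix s r :: real assume s: "s \<in> {0..T}"
          show "\<bar>a s (X s \<omega>)\<bar> \<le> K * (1 + \<bar>X s \<omega>\<bar>)" "\<bar>c s (X s \<omega>)\<bar> \<le> K * (1 + \<bar>X s \<omega>\<bar>)"
            using growth[OF s, of "X s \<omega>"] by auto
          assume r: "r \<in> {0..T}"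
          have "\<bar>c s (X s \<omega>) - c r (X s \<omega>)\<bar> \<le> K * \<bar>s - r\<bar> powr \<beta>"
            using time_reg[OF s r, of "X s \<omega>"] by linarith
          then show "\<bar>c s (X s \<omega>) - c r (X r \<omega>)\<bar> \<le> K * (\<bar>s - r\<bar> powr \<beta> + \<bar>X s \<omega> - X r \<omega>\<bar>)"
            using c_lip[OF r, of "X s \<omega>" "X r \<omega>"] unfolding distrib_left by linarith
          show "\<bar>I r \<omega> - I s \<omega>\<bar> \<le> \<xi> \<omega> * \<bar>r - s\<bar> powr \<eta>" using elim s r by blast
        qed (use elim A in auto)
      qed
    qed
    then have "(\<integral>\<^sup>+\<omega>. ennreal_rpow (pnorm_sup \<alpha> T (\<lambda>t. X t \<omega>)) p \<partial>M) \<le> (\<integral>\<^sup>+\<omega>. ?U \<omega> + ?V \<omega> \<partial>M)"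
      by (rule nn_integral_mono_AE)
    also have "\<dots> \<le> (\<integral>\<^sup>+\<omega>. ?U \<omega> \<partial>M) + (\<integral>\<^sup>+\<omega>. ?V \<omega> \<partial>M)"
      by (rule nn_integral_add_le) measurable
    also have "\<dots> < \<infinity>"
    proof -
      let ?k = "(2 * (1 + \<bar>X0\<bar> + N)) powr (2 * p) * 2 ^ m"
      have "(\<integral>\<^sup>+\<omega>. ?V \<omega> \<partial>M) = (\<integral>\<^sup>+\<omega>. ennreal ?k * (1 + ennreal (\<xi> \<omega> ^ m)) + ennreal (exp ?\<theta>) \<partial>M)"
        by (intro nn_integral_cong) (simp add: \<xi>0 ennreal_mult flip: ennreal_1)
      also have "\<dots> = ennreal ?k * (1 + (\<integral>\<^sup>+\<omega>. ennreal (\<xi> \<omega> ^ m) \<partial>M)) + ennreal (exp ?\<theta>)"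
        by (simp add: nn_integral_add nn_integral_cmult emeasure_space_1)
      also have "\<dots> < \<infinity>" using \<xi>_mom by (simp add: ennreal_mult_less_top)
      finally have "(\<integral>\<^sup>+\<omega>. ?V \<omega> \<partial>M) < \<infinity>" .
      moreover have "(\<integral>\<^sup>+\<omega>. ?U \<omega> \<partial>M) < \<infinity>"
        unfolding q_def by (rule exp_mom) (use p T g in simp)
      ultimately show ?thesis by simp
    qed
    finally show ?thesis .
  qed
  have "(SUP t\<in>{0..T}. \<integral>\<^sup>+\<omega>. ennreal (\<bar>X t \<omega>\<bar> powr p) \<partial>M) < \<infinity>" if p: "p > 0" for p
  proof -
    have "(\<integral>\<^sup>+\<omega>. ennreal (\<bar>X t \<omega>\<bar> powr p) \<partial>M) \<le> (\<integral>\<^sup>+\<omega>. ennreal_rpow (pnorm_sup \<alpha> T (\<lambda>t. X t \<omega>)) p \<partial>M)"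
      if t: "t \<in> {0..T}" for t
    proof (rule nn_integral_mono_AE)
      show "AE \<omega> in M. ennreal (\<bar>X t \<omega>\<bar> powr p) \<le> ennreal_rpow (pnorm_sup \<alpha> T (\<lambda>t. X t \<omega>)) p"
        using assms(23)
      proof eventually_elim
        case (elim \<omega>)
        have "ennreal \<bar>X t \<omega>\<bar> \<le> pnorm \<alpha> t (\<lambda>t. X t \<omega>)" by (simp add: pnorm_def)
        also have "\<dots> \<le> pnorm_sup \<alpha> T (\<lambda>t. X t \<omega>)" unfolding pnorm_sup_def by (rule SUP_upper[OF t])
        finally have "\<bar>X t \<omega>\<bar> \<le> enn2real (pnorm_sup \<alpha> T (\<lambda>t. X t \<omega>))"
          using enn2real_mono[of "ennreal \<bar>X t \<omega>\<bar>" "pnorm_sup \<alpha> T (\<lambda>t. X t \<omega>)"] elim by simp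
        then show ?case using elim p by (auto simp: ennreal_rpow_def intro!: ennreal_leI powr_mono2)
      qed
    qed
    then have "(SUP t\<in>{0..T}. \<integral>\<^sup>+\<omega>. ennreal (\<bar>X t \<omega>\<bar> powr p) \<partial>M) \<le> (\<integral>\<^sup>+\<omega>. ennreal_rpow (pnorm_sup \<alpha> T (\<lambda>t. X t \<omega>)) p \<partial>M)"
      by (rule SUP_least)
    also have "\<dots> < \<infinity>" by (rule moment[OF p])
    finally show ?thesis .
  qed
  with moment show ?thesis by blast
qed

end
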